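(* Let $\pi\colon P\to M$ be a principal $\mathbb{X}$-bundle for a Lie groupoid $\mathbb{X}=[X_1\rightrightarrows X_0]$ and let $\sigma$ be an (Ehresmann) connection on $\mathbb{X}$. Then there is a one-to-one correspondence between the set of connection $1$-forms $\omega$ (with respect to $\sigma$) and the set of all smooth subbundles $\mathcal{H}$ of $TP\to P$ satisfying $$TP=\mathcal{H}\oplus\ker d\pi,\qquad \mathcal{H}_{pg}=\mathcal{H}_p.g\ \text{ for } a(p)=t(g),$$ where $\mathcal{H}_p.g$ denotes the restriction to $\mathcal{H}$ of the quasi action $\tau$ of $\mathbb{X}$ on $TP$ induced by $\sigma$, i.e. $\mathcal{H}_p.g=\tau_g(\mathcal{H}_p)$.
   Context: Lie groupoid $\mathbb{X}=[X_1\rightrightarrows X_0]$: source $s$, target $t$ are submersions, $gh$ is defined when $s(g)=t(h)$, units $1_x$, inversion $i$. Right action on $P$ with anchor $a\colon P\to X_0$: $pg$ is defined when $a(p)=t(g)$, $a(pg)=s(g)$, $(pg)h=p(gh)$, $p1_{a(p)}=p$; for $(u,\beta)$ tangent to $P\times_{a,X_0,t}X_1$ at $(p,g)$, $u.\beta\in T_{pg}P$ is its image under the differential of the action. Principal $\mathbb{X}$-bundle: a surjective submersion $\pi\colon P\to M$ with a right action, $\pi(pg)=\pi(p)$, and $(p,g)\mapsto(p,pg)$ a diffeomorphism $P\times_{X_0}X_1\to P\times_MP$. Lie algebroid $A\to X_0$: $A_x=\ker(ds)_{1_x}$; $P\times_{X_0}A=a^*A$. $r_g\colon A_{t(g)}\to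 T_gX_1$ is the differential at $1_{t(g)}$ of $h\mapsto hg$ (isomorphism onto $\ker(ds)_g$); $l_g\colon A_{s(g)}\to T_gX_1$ is the differential at $1_{s(g)}$ of $h\mapsto gh^{-1}$ on $s^{-1}(s(g))$. Ehresmann connection: a smooth subbundle $\mathbb{H}\subset TX_1$ with $TX_1=\mathbb{H}\oplus\ker ds$ and $\mathbb{H}_{1_x}=(d1)_x(T_xX_0)$; equivalently $\sigma_g\colon T_{s(g)}X_0\to\mathbb{H}_g$, the inverse of $ds|_{\mathbb{H}_g}$. $\psi_g\colon T_gX_1\to A_{t(g)}$ satisfies $r_g\psi_g+\sigma_g(ds)_g=\mathrm{Id}$. Put $\lambda_g=-\psi_gl_g\colon A_{s(g)}\to A_{t(g)}$ and, for $a(p)=t(g)$, $\tau_g\colon T_pP\to T_{pg}P$, $\tau_g(u)=u.(di)_{g^{-1}}\sigma_{g^{-1}}(da)_p(u)$. Fundamental vector field map: $d\delta_p\colon A_{a(p)}\to T_pP$ is the differential at $1_{a(p)}$ of $s^{-1}(a(p))\to\pi^{-1}(\pi(p))$, $h\mapsto ph^{-1}$. Connection $1$-form (with respect to $\sigma$): a smooth vector bundle map $\omega\colon TP\to P\times_{X_0}A$ over $P$ with $\omega_{pg}(\tau_g(u))=\lambda_{g^{-1}}(\omega_p(u))$ for all $u\in T_pP$ and $(p,g)$ with $a(p)=t(g)$, and $\omega_p(d\delta_p(\alpha))=\alpha$ for all $\alpha\in A_{a(p)}$. *)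

theory Defs
  imports "HOL-Analysis.Analysis" "HOL-Library.Function_Algebras"
begin

section \<open>Model spaces\<close>

text \<open>
  The class of model spaces is \<^class>\<open>euclidean_space\<close> without the requirement of positive
  dimension. Manifolds of dimension 0 must not be excluded: a Lie group is a Lie groupoid whose
  object manifold is a point.
\<close>

class model_space = real_inner +
  assumes finite_dim_ex: "\<exists>B. finite B \<and> (\<forall>x. \<exists>c. x = (\<Sum>b\<in>B. c b *\<^sub>R b))"

lemma finite_dim: "\<exists>B::'a::model_space set. finite B \<and> span B = UNIV"
proof -
  obtain B :: "'a set" where B: "finite B" "\<And>x. \<exists>c. x = (\<Sum>b\<in>B. c b *\<^sub>R b)"
    using finite_dim_ex by blast
  have "x \<in> span B" for x
  proof -
    obtain c where "x = (\<Sum>b\<in>B. c b *\<^sub>R b)" using B(2) by blast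
    then show ?thesis by (simp add: span_sum span_scale span_base)
  qed
  then show ?thesis using B(1) by blast
qed

lemma finite_dim_exI:
  assumes "finite B" "span B = (UNIV :: 'a::real_vector set)"
  shows "\<exists>B. finite B \<and> (\<forall>x::'a. \<exists>c. x = (\<Sum>b\<in>B. c b *\<^sub>R b))"
proof -
  have "\<exists>c. x = (\<Sum>b\<in>B. c b *\<^sub>R b)" for x :: 'a
  proof -
    have "x \<in> range (\<lambda>c. \<Sum>b\<in>B. c b *\<^sub>R b)"
      using span_finite[OF assms(1)] assms(2) by simp
    then show ?thesis by (rule imageE) (rule exI)
  qed
  then show ?thesis using assms(1) by (intro exI[of _ B] conjI allI)
qed

instance euclidean_space \<subseteq> model_space
  by (intro_classes, rule finite_dim_exI[OF finite_Basis span_Basis])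

instance prod :: (model_space, model_space) model_space
proof
  obtain B :: "'a set" where B: "finite B" "span B = UNIV" using finite_dim by blast
  obtain C :: "'b set" where C: "finite C" "span C = UNIV" using finite_dim by blast
  let ?D = "(\<lambda>b. (b, 0)) ` B \<union> Pair 0 ` C"
  have l: "linear (\<lambda>b::'a. (b, 0::'b))" and r: "linear (Pair (0::'a) :: 'b \<Rightarrow> 'a \<times> 'b)"
    by (auto intro!: linearI)
  have "z \<in> span ?D" for z :: "'a \<times> 'b"
  proof -
    have "(fst z, 0::'b) \<in> span ((\<lambda>b. (b, 0)) ` B)"
      unfolding linear_span_image[OF l] B(2) by blast
    moreover have "(0::'a, snd z) \<in> span (Pair 0 ` C)"
      unfolding linear_span_image[OF r] C(2) by blast
    ultimately have "(fst z, 0) + (0, snd z) \<in> span ?D"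
      by (intro span_add) (rule subsetD[OF span_mono], rule Un_upper1 Un_upper2, assumption)+
    then show ?thesis by simp
  qed
  then have "span ?D = UNIV" by blast
  then show "\<exists>D::('a \<times> 'b) set. finite D \<and> (\<forall>x. \<exists>c. x = (\<Sum>b\<in>D. c b *\<^sub>R b))"
    by (rule finite_dim_exI[rotated]) (simp add: B(1) C(1))
qed

text \<open>The zero-dimensional model space.\<close>

instantiation unit :: real_inner
begin
definition "(0::unit) = ()"
definition "(x::unit) + y = ()"
definition "r *\<^sub>R (x::unit) = ()"
definition "inner (x::unit) y = (0::real)"
definition "norm (x::unit) = (0::real)"
definition "sgn (x::unit) = ()"
definition "dist (x::unit) y = (0::real)"
definition "(uniformity :: (unit \<times> unit) filter) = (INF e\<in>{0<..}. principal {(x, y). dist x y < e})"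
definition "open (U :: unit set) \<longleftrightarrow> (\<forall>x\<in>U. eventually (\<lambda>(x', y). x' = x \<longrightarrow> y \<in> U) uniformity)"
instance
  by standard (simp_all add: uniformity_unit_def open_unit_def inner_unit_def norm_unit_def
      dist_unit_def)
end

instance unit :: model_space
  by standard (auto intro!: exI[of _ "{}"])

section \<open>Smooth maps between model spaces\<close>

primrec C_diff :: "nat \<Rightarrow> 'a::model_space set \<Rightarrow> ('a \<Rightarrow> 'b::model_space) \<Rightarrow> bool" where
  "C_diff 0 S f \<longleftrightarrow> continuous_on S f"
| "C_diff (Suc k) S f \<longleftrightarrow> (\<forall>x\<in>S. f differentiable (at x)) \<and>
     (\<forall>v. C_diff k S (\<lambda>x. frechet_derivative f (at x) v))"

text \<open>Used for open \<open>S\<close> only.\<close>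

definition smooth_on :: "'a::model_space set \<Rightarrow> ('a \<Rightarrow> 'b::model_space) \<Rightarrow> bool" where
  "smooth_on S f \<longleftrightarrow> (\<forall>k. C_diff k S f)"

section \<open>Manifolds\<close>

text \<open>
  A chart is a pair of a domain and a coordinate map; the values of the coordinate map outside its
  domain are irrelevant. The underlying set of a manifold, its topology and its smooth structure
  are determined by an atlas, which need not be maximal.
\<close>

type_synonym ('a, 'e) chart = "'a set \<times> ('a \<Rightarrow> 'e)"
type_synonym ('a, 'e) atlas = "('a, 'e) chart set"

abbreviation chart_inv :: "('a, 'e) chart \<Rightarrow> 'e \<Rightarrow> 'a" where
  "chart_inv c \<equiv> inv_into (fst c) (snd c)"

definition pts :: "('a, 'e) atlas \<Rightarrow> 'a set" where
  "pts A = (\<Union>c\<in>A. fst c)"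

definition smooth_atlas :: "('a, 'e::model_space) atlas \<Rightarrow> bool" where
  "smooth_atlas A \<longleftrightarrow>
     (\<forall>c\<in>A. inj_on (snd c) (fst c) \<and> open (snd c ` fst c)) \<and>
     (\<forall>c\<in>A. \<forall>d\<in>A. open (snd c ` (fst c \<inter> fst d)) \<and>
        smooth_on (snd c ` (fst c \<inter> fst d)) (snd d \<circ> chart_inv c))"

definition mopen :: "('a, 'e::model_space) atlas \<Rightarrow> 'a set \<Rightarrow> bool" where
  "mopen A W \<longleftrightarrow> W \<subseteq> pts A \<and> (\<forall>c\<in>A. open (snd c ` (W \<inter> fst c)))"

lemma istopology_mopen:
  assumes "smooth_atlas A"
  shows "istopology (mopen A)"
  unfolding istopology_def
proof (intro conjI allI impI)
  fix S T assume S: "mopen A S" and T: "mopen A T"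
  have "open (snd c ` (S \<inter> T \<inter> fst c))" if c: "c \<in> A" for c
  proof -
    have "inj_on (snd c) (fst c)" using assms c by (auto simp: smooth_atlas_def)
    then have "snd c ` (S \<inter> T \<inter> fst c) = snd c ` (S \<inter> fst c) \<inter> snd c ` (T \<inter> fst c)"
      by (auto simp: inj_on_def)
    then show ?thesis using S T c by (auto simp: mopen_def)
  qed
  then show "mopen A (S \<inter> T)" using S by (auto simp: mopen_def)
next
  fix K assume K: "\<forall>S\<in>K. mopen A S"
  have "open (snd c ` (\<Union>K \<inter> fst c))" if c: "c \<in> A" for c
  proof -
    have "snd c ` (\<Union>K \<inter> fst c) = (\<Union>S\<in>K. snd c ` (S \<inter> fst c))" by auto
    moreover have "open (\<Union>S\<in>K. snd c ` (S \<inter> fst c))"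
      using K c by (intro open_UN) (simp add: mopen_def)
    ultimately show ?thesis by simp
  qed
  moreover have "\<Union>K \<subseteq> pts A" using K by (auto simp: mopen_def)
  ultimately show "mopen A (\<Union>K)" by (simp add: mopen_def)
qed

definition manifold :: "('a, 'e::model_space) atlas \<Rightarrow> bool" where
  "manifold A \<longleftrightarrow> smooth_atlas A \<and>
     Hausdorff_space (topology (mopen A)) \<and> second_countable (topology (mopen A))"

text \<open>Smooth maps on an open subset \<open>W\<close>; openness of \<open>snd c ` D\<close> expresses continuity.\<close>

definition smooth_on_open ::
  "('a, 'e::model_space) atlas \<Rightarrow> 'a set \<Rightarrow> ('b, 'f::model_space) atlas \<Rightarrow> ('a \<Rightarrow> 'b) \<Rightarrow> bool" where
  "smooth_on_open A W B f \<longleftrightarrow> f ` W \<subseteq> pts B \<and>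
     (\<forall>c\<in>A. \<forall>d\<in>B. let D = {x \<in> W \<inter> fst c. f x \<in> fst d} in
        open (snd c ` D) \<and> smooth_on (snd c ` D) (snd d \<circ> f \<circ> chart_inv c))"

text \<open>
  Smooth maps on an arbitrary subset \<open>S\<close> are those that extend smoothly to a neighbourhood of
  every point of \<open>S\<close>. For an embedded submanifold \<open>S\<close> (below: fibre products along a
  submersion and fibres of a submersion) these are the smooth maps on the manifold \<open>S\<close>.
  Smooth maps into an embedded submanifold are smooth maps into the ambient manifold that take
  values in the submanifold.
\<close>

definition local_ext :: "('a, 'e::model_space) atlas \<Rightarrow> 'a set \<Rightarrow> ('b, 'f::model_space) atlas \<Rightarrow>
    ('a \<Rightarrow> 'b) \<Rightarrow> 'a \<Rightarrow> ('a \<Rightarrow> 'b) \<Rightarrow> bool" where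
  "local_ext A S B f p F \<longleftrightarrow>
     (\<exists>W. mopen A W \<and> p \<in> W \<and> smooth_on_open A W B F \<and> (\<forall>q\<in>S \<inter> W. F q = f q))"

definition smooth_map ::
  "('a, 'e::model_space) atlas \<Rightarrow> 'a set \<Rightarrow> ('b, 'f::model_space) atlas \<Rightarrow> ('a \<Rightarrow> 'b) \<Rightarrow> bool" where
  "smooth_map A S B f \<longleftrightarrow> (\<forall>p\<in>S. \<exists>F. local_ext A S B f p F)"

definition diffeo :: "('a, 'e::model_space) atlas \<Rightarrow> 'a set \<Rightarrow>
    ('b, 'f::model_space) atlas \<Rightarrow> 'b set \<Rightarrow> ('a \<Rightarrow> 'b) \<Rightarrow> bool" where
  "diffeo A S B T f \<longleftrightarrow> bij_betw f S T \<and> smooth_map A S B f \<and> smooth_map B T A (inv_into S f)"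

definition prod_atlas :: "('a, 'e) atlas \<Rightarrow> ('b, 'f) atlas \<Rightarrow> ('a \<times> 'b, 'e \<times> 'f) atlas" where
  "prod_atlas A B = (\<lambda>(c, d). (fst c \<times> fst d, map_prod (snd c) (snd d))) ` (A \<times> B)"

section \<open>Tangent vectors and differentials\<close>

text \<open>Pointwise scalar multiplication; the additive structure is in \<open>Function_Algebras\<close>.\<close>

instantiation "fun" :: (type, real_vector) real_vector
begin
definition "r *\<^sub>R f = (\<lambda>x. r *\<^sub>R f x)"
instance
  by standard (simp_all add: scaleR_fun_def plus_fun_def fun_eq_iff scaleR_add_right scaleR_add_left)
end

text \<open>
  A tangent vector at \<open>p\<close> assigns to each chart at \<open>p\<close> a coordinate vector, and
  these transform under the derivatives of the coordinate changes.
\<close>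

type_synonym ('a, 'e) tvec = "('a, 'e) chart \<Rightarrow> 'e"

definition tspace :: "('a, 'e::model_space) atlas \<Rightarrow> 'a \<Rightarrow> ('a, 'e) tvec set" where
  "tspace A p = {v. (\<forall>c. c \<notin> A \<or> p \<notin> fst c \<longrightarrow> v c = 0) \<and>
     (\<forall>c\<in>A. \<forall>d\<in>A. p \<in> fst c \<longrightarrow> p \<in> fst d \<longrightarrow>
        v d = frechet_derivative (snd d \<circ> chart_inv c) (at (snd c p)) (v c))}"

definition tbundle :: "('a, 'e::model_space) atlas \<Rightarrow> ('a \<times> ('a, 'e) tvec) set" where
  "tbundle A = Sigma (pts A) (tspace A)"

definition tangent_atlas ::
  "('a, 'e::model_space) atlas \<Rightarrow> ('a \<times> ('a, 'e) tvec, 'e \<times> 'e) atlas" where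
  "tangent_atlas A = (\<lambda>c. (Sigma (fst c) (tspace A), \<lambda>(p, v). (snd c p, v c))) ` A"

text \<open>The differential at \<open>p\<close> of a map that is smooth near \<open>p\<close>.\<close>

definition differential :: "('a, 'e::model_space) atlas \<Rightarrow> ('b, 'f::model_space) atlas \<Rightarrow> ('a \<Rightarrow> 'b) \<Rightarrow>
    'a \<Rightarrow> ('a, 'e) tvec \<Rightarrow> ('b, 'f) tvec" where
  "differential A B f p v = (\<lambda>d. if d \<in> B \<and> f p \<in> fst d
     then (let c = (SOME c. c \<in> A \<and> p \<in> fst c) in
       frechet_derivative (snd d \<circ> f \<circ> chart_inv c) (at (snd c p)) (v c))
     else 0)"

text \<open>
  The differential of a smooth map on an embedded submanifold \<open>S\<close> is the differential of a
  local extension. It is independent of the extension for \<open>v\<close> tangent to \<open>S\<close>.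
\<close>

definition differential_on :: "('a, 'e::model_space) atlas \<Rightarrow> 'a set \<Rightarrow> ('b, 'f::model_space) atlas \<Rightarrow>
    ('a \<Rightarrow> 'b) \<Rightarrow> 'a \<Rightarrow> ('a, 'e) tvec \<Rightarrow> ('b, 'f) tvec" where
  "differential_on A S B f p = differential A B (SOME F. local_ext A S B f p F) p"

text \<open>The tangent vector \<open>(u, v)\<close> of a product manifold.\<close>

definition tpair :: "('a, 'e::model_space) atlas \<Rightarrow> ('b, 'f::model_space) atlas \<Rightarrow> 'a \<times> 'b \<Rightarrow>
    ('a, 'e) tvec \<Rightarrow> ('b, 'f) tvec \<Rightarrow> ('a \<times> 'b, 'e \<times> 'f) tvec" where
  "tpair A B z u v = (THE w. w \<in> tspace (prod_atlas A B) z \<and>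
     differential (prod_atlas A B) A fst z w = u \<and> differential (prod_atlas A B) B snd z w = v)"

definition tker :: "('a, 'e::model_space) atlas \<Rightarrow> ('b, 'f::model_space) atlas \<Rightarrow> ('a \<Rightarrow> 'b) \<Rightarrow>
    'a \<Rightarrow> ('a, 'e) tvec set" where
  "tker A B f p = {v \<in> tspace A p. differential A B f p v = 0}"

definition submersion ::
  "('a, 'e::model_space) atlas \<Rightarrow> ('b, 'f::model_space) atlas \<Rightarrow> ('a \<Rightarrow> 'b) \<Rightarrow> bool" where
  "submersion A B f \<longleftrightarrow> smooth_map A (pts A) B f \<and>
     (\<forall>p\<in>pts A. differential A B f p ` tspace A p = tspace B (f p))"

text \<open>
  A smooth subbundle is a set \<open>H\<close> of pairs \<open>(p, v)\<close> with \<open>v\<close> tangent at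
  \<open>p\<close>, with fibres \<open>H `` {p}\<close>, that is locally spanned by a smooth frame.
\<close>

definition smooth_subbundle ::
  "('a, 'e::model_space) atlas \<Rightarrow> ('a \<times> ('a, 'e) tvec) set \<Rightarrow> bool" where
  "smooth_subbundle A H \<longleftrightarrow> H \<subseteq> tbundle A \<and>
     (\<forall>p\<in>pts A. \<exists>W k (X :: nat \<Rightarrow> 'a \<Rightarrow> ('a, 'e) tvec). mopen A W \<and> p \<in> W \<and>
        (\<forall>i<k. smooth_map A W (tangent_atlas A) (\<lambda>q. (q, X i q))) \<and>
        (\<forall>q\<in>W. inj_on (\<lambda>i. X i q) {..<k} \<and> independent ((\<lambda>i. X i q) ` {..<k}) \<and>
           span ((\<lambda>i. X i q) ` {..<k}) = H `` {q}))"

definition direct_sum :: "'v::real_vector set \<Rightarrow> 'v set \<Rightarrow> 'v set \<Rightarrow> bool" where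
  "direct_sum V U W \<longleftrightarrow> U \<inter> W = {0} \<and> V = {u + w | u w. u \<in> U \<and> w \<in> W}"

section \<open>Lie groupoids and Ehresmann connections\<close>

record ('x, 'e, 'g, 'f) groupoid_data =
  Ob :: "('x, 'e) atlas"
  Ar :: "('g, 'f) atlas"
  src :: "'g \<Rightarrow> 'x"
  tgt :: "'g \<Rightarrow> 'x"
  mul :: "'g \<Rightarrow> 'g \<Rightarrow> 'g"
  gunit :: "'x \<Rightarrow> 'g"
  ginv :: "'g \<Rightarrow> 'g"

definition composable :: "('x, 'e, 'g, 'f) groupoid_data \<Rightarrow> ('g \<times> 'g) set" where
  "composable X = {(g, h). g \<in> pts (Ar X) \<and> h \<in> pts (Ar X) \<and> src X g = tgt X h}"

definition lie_groupoid ::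
  "('x, 'e::model_space, 'g, 'f::model_space) groupoid_data \<Rightarrow> bool" where
  "lie_groupoid X \<longleftrightarrow>
     manifold (Ob X) \<and> manifold (Ar X) \<and>
     submersion (Ar X) (Ob X) (src X) \<and> submersion (Ar X) (Ob X) (tgt X) \<and>
     smooth_map (prod_atlas (Ar X) (Ar X)) (composable X) (Ar X) (\<lambda>(g, h). mul X g h) \<and>
     smooth_map (Ob X) (pts (Ob X)) (Ar X) (gunit X) \<and>
     smooth_map (Ar X) (pts (Ar X)) (Ar X) (ginv X) \<and>
     (\<forall>(g, h)\<in>composable X. src X (mul X g h) = src X h \<and> tgt X (mul X g h) = tgt X g) \<and>
     (\<forall>g h k. (g, h) \<in> composable X \<longrightarrow> (h, k) \<in> composable X \<longrightarrow>
        mul X (mul X g h) k = mul X g (mul X h k)) \<and>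
     (\<forall>x\<in>pts (Ob X). src X (gunit X x) = x \<and> tgt X (gunit X x) = x) \<and>
     (\<forall>g\<in>pts (Ar X). mul X g (gunit X (src X g)) = g \<and> mul X (gunit X (tgt X g)) g = g) \<and>
     (\<forall>g\<in>pts (Ar X). src X (ginv X g) = tgt X g \<and> tgt X (ginv X g) = src X g \<and>
        mul X g (ginv X g) = gunit X (tgt X g) \<and> mul X (ginv X g) g = gunit X (src X g))"

definition src_fibre :: "('x, 'e, 'g, 'f) groupoid_data \<Rightarrow> 'x \<Rightarrow> 'g set" where
  "src_fibre X x = {h \<in> pts (Ar X). src X h = x}"

text \<open>The fibre over \<open>x\<close> of the Lie algebroid; also the tangent space at the unit of
  \<open>src_fibre X x\<close>.\<close>

definition algebroid ::
  "('x, 'e::model_space, 'g, 'f::model_space) groupoid_data \<Rightarrow> 'x \<Rightarrow> ('g, 'f) tvec set" where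
  "algebroid X x = tker (Ar X) (Ob X) (src X) (gunit X x)"

definition rtrans :: "('x, 'e::model_space, 'g, 'f::model_space) groupoid_data \<Rightarrow> 'g \<Rightarrow>
    ('g, 'f) tvec \<Rightarrow> ('g, 'f) tvec" where
  "rtrans X g = differential_on (Ar X) (src_fibre X (tgt X g)) (Ar X) (\<lambda>h. mul X h g) (gunit X (tgt X g))"

definition ltrans :: "('x, 'e::model_space, 'g, 'f::model_space) groupoid_data \<Rightarrow> 'g \<Rightarrow>
    ('g, 'f) tvec \<Rightarrow> ('g, 'f) tvec" where
  "ltrans X g =
     differential_on (Ar X) (src_fibre X (src X g)) (Ar X) (\<lambda>h. mul X g (ginv X h)) (gunit X (src X g))"

definition ehresmann_connection :: "('x, 'e::model_space, 'g, 'f::model_space) groupoid_data \<Rightarrow>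
    ('g \<times> ('g, 'f) tvec) set \<Rightarrow> bool" where
  "ehresmann_connection X E \<longleftrightarrow> smooth_subbundle (Ar X) E \<and>
     (\<forall>g\<in>pts (Ar X). direct_sum (tspace (Ar X) g) (E `` {g}) (tker (Ar X) (Ob X) (src X) g)) \<and>
     (\<forall>x\<in>pts (Ob X). E `` {gunit X x} = differential (Ob X) (Ar X) (gunit X) x ` tspace (Ob X) x)"

text \<open>In the following, \<open>E\<close> is an Ehresmann connection on \<open>X\<close>.\<close>

definition sigma :: "('x, 'e::model_space, 'g, 'f::model_space) groupoid_data \<Rightarrow>
    ('g \<times> ('g, 'f) tvec) set \<Rightarrow> 'g \<Rightarrow> ('x, 'e) tvec \<Rightarrow> ('g, 'f) tvec" where
  "sigma X E g v = (THE w. w \<in> E `` {g} \<and> differential (Ar X) (Ob X) (src X) g w = v)"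

definition psi :: "('x, 'e::model_space, 'g, 'f::model_space) groupoid_data \<Rightarrow>
    ('g \<times> ('g, 'f) tvec) set \<Rightarrow> 'g \<Rightarrow> ('g, 'f) tvec \<Rightarrow> ('g, 'f) tvec" where
  "psi X E g v = (THE \<alpha>. \<alpha> \<in> algebroid X (tgt X g) \<and>
     rtrans X g \<alpha> + sigma X E g (differential (Ar X) (Ob X) (src X) g v) = v)"

definition lambda :: "('x, 'e::model_space, 'g, 'f::model_space) groupoid_data \<Rightarrow>
    ('g \<times> ('g, 'f) tvec) set \<Rightarrow> 'g \<Rightarrow> ('g, 'f) tvec \<Rightarrow> ('g, 'f) tvec" where
  "lambda X E g \<alpha> = - psi X E g (ltrans X g \<alpha>)"

section \<open>Principal bundles\<close>

record ('p, 'q, 'm, 'n, 'g, 'x) bundle_data =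
  Tot :: "('p, 'q) atlas"
  Base :: "('m, 'n) atlas"
  proj :: "'p \<Rightarrow> 'm"
  anchor :: "'p \<Rightarrow> 'x"
  act :: "'p \<Rightarrow> 'g \<Rightarrow> 'p"

definition act_dom :: "('x, 'e, 'g, 'f) groupoid_data \<Rightarrow> ('p, 'q, 'm, 'n, 'g, 'x) bundle_data \<Rightarrow>
    ('p \<times> 'g) set" where
  "act_dom X P = {(p, g). p \<in> pts (Tot P) \<and> g \<in> pts (Ar X) \<and> anchor P p = tgt X g}"

definition right_action :: "('x, 'e::model_space, 'g, 'f::model_space) groupoid_data \<Rightarrow>
    ('p, 'q::model_space, 'm, 'n::model_space, 'g, 'x) bundle_data \<Rightarrow> bool" where
  "right_action X P \<longleftrightarrow>
     smooth_map (Tot P) (pts (Tot P)) (Ob X) (anchor P) \<and>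
     smooth_map (prod_atlas (Tot P) (Ar X)) (act_dom X P) (Tot P) (\<lambda>(p, g). act P p g) \<and>
     (\<forall>(p, g)\<in>act_dom X P. anchor P (act P p g) = src X g) \<and>
     (\<forall>p g h. (p, g) \<in> act_dom X P \<longrightarrow> (g, h) \<in> composable X \<longrightarrow>
        act P (act P p g) h = act P p (mul X g h)) \<and>
     (\<forall>p\<in>pts (Tot P). act P p (gunit X (anchor P p)) = p)"

definition principal_bundle :: "('x, 'e::model_space, 'g, 'f::model_space) groupoid_data \<Rightarrow>
    ('p, 'q::model_space, 'm, 'n::model_space, 'g, 'x) bundle_data \<Rightarrow> bool" where
  "principal_bundle X P \<longleftrightarrow>
     manifold (Tot P) \<and> manifold (Base P) \<and>
     submersion (Tot P) (Base P) (proj P) \<and> proj P ` pts (Tot P) = pts (Base P) \<and>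
     right_action X P \<and>
     (\<forall>(p, g)\<in>act_dom X P. proj P (act P p g) = proj P p) \<and>
     diffeo (prod_atlas (Tot P) (Ar X)) (act_dom X P)
       (prod_atlas (Tot P) (Tot P))
       {(p, q). p \<in> pts (Tot P) \<and> q \<in> pts (Tot P) \<and> proj P p = proj P q}
       (\<lambda>(p, g). (p, act P p g))"

text \<open>\<open>dact X P p g u \<beta>\<close> is the tangent vector \<open>u.\<beta>\<close> at \<open>pg\<close>.\<close>

definition dact :: "('x, 'e::model_space, 'g, 'f::model_space) groupoid_data \<Rightarrow>
    ('p, 'q::model_space, 'm, 'n::model_space, 'g, 'x) bundle_data \<Rightarrow>
    'p \<Rightarrow> 'g \<Rightarrow> ('p, 'q) tvec \<Rightarrow> ('g, 'f) tvec \<Rightarrow> ('p, 'q) tvec" where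
  "dact X P p g u \<beta> =
     differential_on (prod_atlas (Tot P) (Ar X)) (act_dom X P) (Tot P) (\<lambda>(p, g). act P p g) (p, g)
       (tpair (Tot P) (Ar X) (p, g) u \<beta>)"

text \<open>The quasi action \<open>tau\<close> of the groupoid on the tangent bundle of the total space.\<close>

definition tau :: "('x, 'e::model_space, 'g, 'f::model_space) groupoid_data \<Rightarrow>
    ('g \<times> ('g, 'f) tvec) set \<Rightarrow> ('p, 'q::model_space, 'm, 'n::model_space, 'g, 'x) bundle_data \<Rightarrow>
    'p \<Rightarrow> 'g \<Rightarrow> ('p, 'q) tvec \<Rightarrow> ('p, 'q) tvec" where
  "tau X E P p g u = dact X P p g u
     (differential (Ar X) (Ar X) (ginv X) (ginv X g)
       (sigma X E (ginv X g) (differential (Tot P) (Ob X) (anchor P) p u)))"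

definition fund :: "('x, 'e::model_space, 'g, 'f::model_space) groupoid_data \<Rightarrow>
    ('p, 'q::model_space, 'm, 'n::model_space, 'g, 'x) bundle_data \<Rightarrow>
    'p \<Rightarrow> ('g, 'f) tvec \<Rightarrow> ('p, 'q) tvec" where
  "fund X P p = differential_on (Ar X) (src_fibre X (anchor P p)) (Tot P) (\<lambda>h. act P p (ginv X h))
     (gunit X (anchor P p))"

section \<open>Connection forms and horizontal subbundles\<close>

text \<open>
  A connection form maps \<open>(p, u)\<close> to the component in \<open>algebroid X (anchor P p)\<close> of
  the value in the pullback of the Lie algebroid. The total space of the Lie algebroid is the
  embedded submanifold of all \<open>(gunit X x, \<alpha>)\<close> in the tangent bundle of \<open>Ar X\<close>,
  which gives the smoothness condition. The values of \<open>\<omega>\<close> outside the tangent bundle are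
  fixed, so that equality of functions is equality of bundle maps.
\<close>

definition connection_form :: "('x, 'e::model_space, 'g, 'f::model_space) groupoid_data \<Rightarrow>
    ('g \<times> ('g, 'f) tvec) set \<Rightarrow> ('p, 'q::model_space, 'm, 'n::model_space, 'g, 'x) bundle_data \<Rightarrow>
    ('p \<times> ('p, 'q) tvec \<Rightarrow> ('g, 'f) tvec) \<Rightarrow> bool" where
  "connection_form X E P \<omega> \<longleftrightarrow>
     \<omega> \<in> extensional (tbundle (Tot P)) \<and>
     (\<forall>(p, u)\<in>tbundle (Tot P). \<omega> (p, u) \<in> algebroid X (anchor P p)) \<and>
     (\<forall>p\<in>pts (Tot P). \<forall>u\<in>tspace (Tot P) p. \<forall>v\<in>tspace (Tot P) p. \<forall>r::real.
        \<omega> (p, u + v) = \<omega> (p, u) + \<omega> (p, v) \<and> \<omega> (p, r *\<^sub>R u) = r *\<^sub>R \<omega> (p, u)) \<and>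
     smooth_map (tangent_atlas (Tot P)) (tbundle (Tot P)) (tangent_atlas (Ar X))
       (\<lambda>(p, u). (gunit X (anchor P p), \<omega> (p, u))) \<and>
     (\<forall>(p, g)\<in>act_dom X P. \<forall>u\<in>tspace (Tot P) p.
        \<omega> (act P p g, tau X E P p g u) = lambda X E (ginv X g) (\<omega> (p, u))) \<and>
     (\<forall>p\<in>pts (Tot P). \<forall>\<alpha>\<in>algebroid X (anchor P p). \<omega> (p, fund X P p \<alpha>) = \<alpha>)"

definition horizontal_subbundle :: "('x, 'e::model_space, 'g, 'f::model_space) groupoid_data \<Rightarrow>
    ('g \<times> ('g, 'f) tvec) set \<Rightarrow> ('p, 'q::model_space, 'm, 'n::model_space, 'g, 'x) bundle_data \<Rightarrow>
    ('p \<times> ('p, 'q) tvec) set \<Rightarrow> bool" where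
  "horizontal_subbundle X E P H \<longleftrightarrow> smooth_subbundle (Tot P) H \<and>
     (\<forall>p\<in>pts (Tot P). direct_sum (tspace (Tot P) p) (H `` {p})
        (tker (Tot P) (Base P) (proj P) p)) \<and>
     (\<forall>(p, g)\<in>act_dom X P. H `` {act P p g} = tau X E P p g ` (H `` {p}))"

definition form_kernel :: "('p, 'q::model_space, 'm, 'n::model_space, 'g, 'x) bundle_data \<Rightarrow>
    ('p \<times> ('p, 'q) tvec \<Rightarrow> ('g, 'f::model_space) tvec) \<Rightarrow> ('p \<times> ('p, 'q) tvec) set" where
  "form_kernel P \<omega> = {(p, u) \<in> tbundle (Tot P). \<omega> (p, u) = 0}"

end

theory Submission
  imports Defs
begin

text \<open>
  The action turns the division map \<open>(p, p h\<^sup>-\<^sup>1) \<mapsto> h\<close> into a smooth map on the pairs of points in a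
  common fibre of \<open>\<pi>\<close>. Its differential inverts the fundamental vector map, so \<open>d\<delta>\<^sub>p\<close> is a linear
  bijection from \<open>A\<^bsub>a(p)\<^esub>\<close> onto \<open>ker d\<pi>\<^sub>p\<close> (\<open>quotient_fund\<close>, \<open>fund_surj\<close>, \<open>fund_inj\<close>). Hence giving a
  bundle map \<open>\<omega>\<close> with \<open>\<omega> \<circ> d\<delta> = id\<close> amounts to giving a complement of \<open>ker d\<pi>\<close>: the complement is the
  kernel of \<open>\<omega>\<close>, and \<open>\<omega>(u)\<close> is the unique \<open>\<alpha>\<close> for which \<open>u - d\<delta>(\<alpha>)\<close> lies in the complement.

  The two invariance conditions correspond because of two properties of the quasi action. It is
  compatible with the projection, \<open>d\<pi> (\<tau>\<^sub>g u) = d\<pi> u\<close> (\<open>tau_props\<close>), and it sends fundamental vectors to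
  fundamental vectors, \<open>\<tau>\<^sub>g (d\<delta>\<^sub>p \<alpha>) = d\<delta>\<^bsub>pg\<^esub> (\<lambda>\<^bsub>g\<^sup>-\<^sup>1\<^esub> \<alpha>)\<close> (\<open>tau_fund\<close>). The second identity is the reason for
  the definition of \<open>\<lambda>\<close>. If \<open>\<omega>\<close> is equivariant, then \<open>\<tau>\<^sub>g\<close> maps \<open>ker \<omega>\<^sub>p\<close> into \<open>ker \<omega>\<^bsub>pg\<^esub>\<close>, and onto it by the
  first property, although \<open>\<tau>\<close> is not an action. Conversely, for an invariant complement \<open>H\<close> one
  decomposes \<open>u = h + d\<delta> \<alpha>\<close> and reads off the equivariance from \<open>\<tau>\<^sub>g u = \<tau>\<^sub>g h + d\<delta> (\<lambda>\<^bsub>g\<^sup>-\<^sup>1\<^esub> \<alpha>)\<close>.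

  Smoothness of the kernel: projecting vector fields with constant coordinates along the fundamental
  vectors gives smooth horizontal fields; if their images under \<open>d\<pi>\<close> form an orthonormal basis at one
  point, then they are a frame near that point (\<open>frame_near_orthonormal\<close>). Smoothness of the form: the
  coefficients of the horizontal part of \<open>u\<close> in a smooth frame of \<open>H\<close> are smooth
  (\<open>smooth_coefficients\<close>), and \<open>\<omega>\<close> is a partial differential of the division map, applied to the
  vertical part (\<open>form_of_smooth\<close>).

  Differentials on fibres and fibre products are computed with curves. The one analytic fact behind
  this is that a curve in the target of a submersion, with velocity \<open>df(w)\<close>, lifts to a curve with
  velocity \<open>w\<close> (\<open>curve_lift_submersion\<close>). Curves need a derivative at parameter 0 only, and for this the
  lift exists by Brouwer's fixed point theorem.
\<close>

section \<open>Calculus on model spaces\<close>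

lemma orthonormal_basis_exists:
  "\<exists>B::'a::model_space set. finite B \<and> span B = UNIV \<and>
     (\<forall>b\<in>B. \<forall>b'\<in>B. inner b b' = (if b = b' then 1 else 0))"
proof -
  obtain B0 :: "'a set" where B0: "finite B0" "span B0 = UNIV" using finite_dim by blast
  obtain C where C: "finite C" "span C = span B0" "pairwise orthogonal C"
    using basis_orthogonal[OF B0(1)] by blast
  define D where "D = (\<lambda>x. x /\<^sub>R norm x) ` (C - {0})"
  have "c \<in> span D" if "c \<in> C" for c
  proof (cases "c = 0")
    case False
    then have "c /\<^sub>R norm c \<in> span D" using that by (auto simp: D_def intro: span_base)
    then have "norm c *\<^sub>R (c /\<^sub>R norm c) \<in> span D" by (rule span_scale)
    then show ?thesis using False by simp
  qed (simp add: span_zero)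
  then have "span C \<subseteq> span D" by (meson span_minimal subsetI subspace_span)
  then have "span D = UNIV" using C(2) B0(2) by auto
  moreover have "inner b b' = (if b = b' then 1 else 0)" if b: "b \<in> D" "b' \<in> D" for b b'
  proof -
    obtain x y where x: "x \<in> C" "x \<noteq> 0" "b = x /\<^sub>R norm x" and y: "y \<in> C" "y \<noteq> 0" "b' = y /\<^sub>R norm y"
      using b unfolding D_def by blast
    show ?thesis
    proof (cases "x = y")
      case True
      then show ?thesis using x y by (simp add: dot_square_norm power2_eq_square)
    next
      case False
      then have "inner x y = 0" using C(3) x y by (auto simp: pairwise_def orthogonal_def)
      then have "inner b b' = 0" using x y by simp
      moreover have "b \<noteq> b'"
        using \<open>inner b b' = 0\<close> x by (metis inner_eq_zero_iff inverse_nonzero_iff_nonzero norm_eq_zero scaleR_eq_0_iff)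
      ultimately show ?thesis by simp
    qed
  qed
  moreover have "finite D" using C(1) by (simp add: D_def)
  ultimately show ?thesis by blast
qed

definition obasis :: "'a::model_space set" where
  "obasis = (SOME B. finite B \<and> span B = UNIV \<and>
     (\<forall>b\<in>B. \<forall>b'\<in>B. inner b b' = (if b = b' then 1 else 0)))"

lemma finite_obasis: "finite obasis"
  and span_obasis: "span obasis = UNIV"
  and inner_obasis: "b \<in> obasis \<Longrightarrow> b' \<in> obasis \<Longrightarrow> inner b b' = (if b = b' then 1 else 0)"
  using someI_ex[OF orthonormal_basis_exists] unfolding obasis_def by blast+

lemma obasis_expansion: "(\<Sum>b\<in>obasis. inner x b *\<^sub>R b) = x"
proof -
  have "x \<in> span obasis" by (simp add: span_obasis)
  then show ?thesis
  proof (induction rule: span_induct_alt)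
    case base
    then show ?case by simp
  next
    case (step c b y)
    have "(\<Sum>b'\<in>obasis. inner b b' *\<^sub>R b') = (\<Sum>b'\<in>obasis. if b' = b then b else 0)"
      using step(1) by (intro sum.cong refl) (auto simp: inner_obasis)
    then have "(\<Sum>b'\<in>obasis. inner b b' *\<^sub>R b') = b"
      using step(1) by (simp add: sum.delta finite_obasis)
    then show ?case using step(2)
      by (simp add: inner_add_left scaleR_add_left sum.distrib flip: scaleR_scaleR scaleR_sum_right)
  qed
qed

lemma linear_expansion:
  assumes "linear (f :: 'a::model_space \<Rightarrow> 'b::real_vector)"
  shows "f x = (\<Sum>b\<in>obasis. inner x b *\<^sub>R f b)"
  by (subst obasis_expansion[of x, symmetric]) (simp add: linear_sum[OF assms] linear_scale[OF assms])

lemma linear_bounded_linear: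
  assumes "linear (f :: 'a::model_space \<Rightarrow> 'b::real_normed_vector)"
  shows "bounded_linear f"
proof (rule bounded_linear_intro[where K = "\<Sum>b\<in>obasis. norm (f b)"])
  show "f (x + y) = f x + f y" "f (r *\<^sub>R x) = r *\<^sub>R f x" for x y r
    using assms by (simp_all add: linear_add linear_scale)
  fix x
  have "norm (f x) \<le> (\<Sum>b\<in>obasis. norm (inner x b *\<^sub>R f b))"
    unfolding linear_expansion[OF assms, of x] by (rule norm_sum)
  also have "\<dots> \<le> (\<Sum>b\<in>obasis. norm x * norm (f b))"
  proof (rule sum_mono)
    fix b :: 'a assume "b \<in> obasis"
    then have "norm b = 1" using inner_obasis[of b b] by (simp add: norm_eq_sqrt_inner)
    then have "\<bar>inner x b\<bar> \<le> norm x" using Cauchy_Schwarz_ineq2[of x b] by simp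
    then show "norm (inner x b *\<^sub>R f b) \<le> norm x * norm (f b)" by (simp add: mult_right_mono)
  qed
  finally show "norm (f x) \<le> norm x * (\<Sum>b\<in>obasis. norm (f b))" by (simp add: sum_distrib_left)
qed

lemma frechet_derivative_eq:
  assumes "open S" "x \<in> S" "\<And>y. y \<in> S \<Longrightarrow> f y = g y"
  shows "f differentiable (at x) \<longleftrightarrow> g differentiable (at x)"
    and "f differentiable (at x) \<Longrightarrow> frechet_derivative g (at x) = frechet_derivative f (at x)"
proof -
  have *: "(f has_derivative f') (at x) \<longleftrightarrow> (g has_derivative f') (at x)" for f'
    using assms by (metis has_derivative_transform_within_open)
  then show "f differentiable (at x) \<longleftrightarrow> g differentiable (at x)" by (simp add: differentiable_def)
  show "f differentiable (at x) \<Longrightarrow> frechet_derivative g (at x) = frechet_derivative f (at x)"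
    using * frechet_derivative_at frechet_derivative_works by metis
qed

lemma C_diff_cong:
  assumes "open S" "\<And>x. x \<in> S \<Longrightarrow> f x = g x" "C_diff k S f"
  shows "C_diff k S g"
  using assms
proof (induction k arbitrary: f g)
  case 0
  then show ?case by (simp cong: continuous_on_cong)
next
  case (Suc k)
  have "C_diff k S (\<lambda>x. frechet_derivative g (at x) v)" for v
    by (rule Suc.IH[of "\<lambda>x. frechet_derivative f (at x) v"])
       (use Suc.prems frechet_derivative_eq[OF Suc.prems(1) _ Suc.prems(2)] in \<open>auto\<close>)
  moreover have "g differentiable (at x)" if "x \<in> S" for x
    using frechet_derivative_eq(1)[OF Suc.prems(1) that Suc.prems(2)] Suc.prems(3) that by auto
  ultimately show ?case by simp
qed

lemma C_diff_SucI:
  assumes "open S" "\<And>x. x \<in> S \<Longrightarrow> (f has_derivative f' x) (at x)" "\<And>v. C_diff k S (\<lambda>x. f' x v)"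
  shows "C_diff (Suc k) S f"
proof -
  have "C_diff k S (\<lambda>x. frechet_derivative f (at x) v)" for v
    by (rule C_diff_cong[OF assms(1) _ assms(3)]) (simp add: frechet_derivative_at[OF assms(2)])
  then show ?thesis using assms(2) by (auto simp: differentiable_def)
qed

lemma C_diff_derivative:
  assumes "C_diff (Suc k) S f" "x \<in> S"
  shows "(f has_derivative frechet_derivative f (at x)) (at x)"
  using assms frechet_derivative_works by auto

lemma C_diff_SucD: "C_diff (Suc k) S f \<Longrightarrow> C_diff k S (\<lambda>x. frechet_derivative f (at x) v)"
  by simp

lemma C_diff_continuous: "open S \<Longrightarrow> C_diff k S f \<Longrightarrow> continuous_on S f"
  by (cases k) (auto simp: continuous_on_eq_continuous_at intro!: differentiable_imp_continuous_within)

lemma C_diff_Suc_imp: "open S \<Longrightarrow> C_diff (Suc k) S f \<Longrightarrow> C_diff k S f"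
proof (induction k arbitrary: f)
  case 0
  then show ?case using C_diff_continuous by fastforce
qed auto

lemma C_diff_subset: "C_diff k S f \<Longrightarrow> T \<subseteq> S \<Longrightarrow> C_diff k T f"
  by (induction k arbitrary: f) (auto intro: continuous_on_subset)

lemma C_diff_const: "open S \<Longrightarrow> C_diff k S (\<lambda>x. c)"
proof (induction k arbitrary: c)
  case (Suc k)
  show ?case by (rule C_diff_SucI[where f' = "\<lambda>x v. 0"]) (use Suc in auto)
qed simp

lemma C_diff_bounded_linear:
  assumes "bounded_linear L" "open S"
  shows "C_diff k S L"
proof (cases k)
  case 0
  then show ?thesis using assms by (simp add: linear_continuous_on)
next
  case (Suc k)
  show ?thesis unfolding Suc
    by (rule C_diff_SucI[where f' = "\<lambda>x. L"])
       (use assms in \<open>auto intro: bounded_linear_imp_has_derivative C_diff_const\<close>)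
qed

lemma C_diff_linear_comp:
  assumes "bounded_linear L" "open S" "C_diff k S f"
  shows "C_diff k S (\<lambda>x. L (f x))"
  using assms(3)
proof (induction k arbitrary: f)
  case 0
  then show ?case using assms by (simp add: bounded_linear.continuous_on)
next
  case (Suc k)
  show ?case
    by (rule C_diff_SucI[where f' = "\<lambda>x v. L (frechet_derivative f (at x) v)"])
       (use assms(2) Suc bounded_linear.has_derivative[OF assms(1) C_diff_derivative[OF Suc.prems]] in auto)
qed

lemma C_diff_add:
  assumes "open S" "C_diff k S f" "C_diff k S g"
  shows "C_diff k S (\<lambda>x. f x + g x)"
  using assms(2,3)
proof (induction k arbitrary: f g)
  case 0
  then show ?case by (simp add: continuous_on_add)
next
  case (Suc k)
  show ?case
    by (rule C_diff_SucI[where f' = "\<lambda>x v. frechet_derivative f (at x) v + frechet_derivative g (at x) v"])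
       (use assms(1) Suc.prems Suc.IH has_derivative_add[OF C_diff_derivative[OF Suc.prems(1)] C_diff_derivative[OF Suc.prems(2)]] in auto)
qed

lemma C_diff_bilinear:
  fixes B :: "'b::model_space \<Rightarrow> 'c::model_space \<Rightarrow> 'd::model_space"
  assumes "bounded_bilinear B" "open S" "C_diff k S f" "C_diff k S g"
  shows "C_diff k S (\<lambda>x. B (f x) (g x))"
  using assms(3,4)
proof (induction k arbitrary: f g)
  case 0
  then show ?case by (simp add: bounded_bilinear.continuous_on[OF assms(1)])
next
  case (Suc k)
  show ?case
    by (rule C_diff_SucI[where f' = "\<lambda>x v. B (f x) (frechet_derivative g (at x) v) + B (frechet_derivative f (at x) v) (g x)"])
       (intro assms C_diff_add Suc.IH[OF C_diff_SucD[OF Suc.prems(1)] C_diff_Suc_imp[OF assms(2) Suc.prems(2)]]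
         Suc.IH[OF C_diff_Suc_imp[OF assms(2) Suc.prems(1)] C_diff_SucD[OF Suc.prems(2)]]
         bounded_bilinear.FDERIV[OF assms(1)] C_diff_derivative[OF Suc.prems(1)] C_diff_derivative[OF Suc.prems(2)]; assumption)+
qed

lemma C_diff_sum:
  assumes "open S" "\<And>i. i \<in> I \<Longrightarrow> C_diff k S (f i)"
  shows "C_diff k S (\<lambda>x. \<Sum>i\<in>I. f i x)"
  using assms(2) by (induction I rule: infinite_finite_induct) (auto intro!: C_diff_const C_diff_add assms(1))

lemma C_diff_inverse:
  fixes f :: "'a::model_space \<Rightarrow> real"
  assumes "open S" "C_diff k S f" "\<And>x. x \<in> S \<Longrightarrow> f x \<noteq> 0"
  shows "C_diff k S (\<lambda>x. inverse (f x))"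
  using assms(2,3)
proof (induction k arbitrary: f)
  case 0
  then show ?case by (auto intro: continuous_on_inverse)
next
  case (Suc k)
  have inv: "C_diff k S (\<lambda>x. inverse (f x))"
    by (rule Suc.IH[OF C_diff_Suc_imp[OF assms(1) Suc.prems(1)] Suc.prems(2)])
  note mult = C_diff_bilinear[OF bounded_bilinear_mult assms(1)]
  show ?case
  proof (rule C_diff_SucI[OF assms(1)])
    show "((\<lambda>x. inverse (f x)) has_derivative
        (\<lambda>v. - (inverse (f x) * frechet_derivative f (at x) v * inverse (f x)))) (at x)" if "x \<in> S" for x
      using that Suc.prems(2) by (intro Deriv.has_derivative_inverse C_diff_derivative[OF Suc.prems(1)]) auto
    show "C_diff k S (\<lambda>x. - (inverse (f x) * frechet_derivative f (at x) v * inverse (f x)))" for v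
      by (rule C_diff_linear_comp[OF bounded_linear_minus[OF bounded_linear_ident] assms(1)
            mult[OF mult[OF inv C_diff_SucD[OF Suc.prems(1)]] inv]])
  qed
qed

text \<open>In coordinates the chain rule contains only finitely many directional derivatives of the
  outer function; this makes the induction on the order of differentiability work.\<close>

lemma C_diff_compose:
  fixes g :: "'a::model_space \<Rightarrow> 'b::model_space" and f :: "'b \<Rightarrow> 'c::model_space"
  assumes "open S" "open T" "g ` S \<subseteq> T" "C_diff k T f" "C_diff k S g"
  shows "C_diff k S (\<lambda>x. f (g x))"
  using assms(4,5)
proof (induction k arbitrary: f)
  case 0
  then show ?case using assms(3) by (auto intro: continuous_on_compose2)
next
  case (Suc k)
  note f' = C_diff_derivative[OF Suc.prems(1)] and g' = C_diff_derivative[OF Suc.prems(2)]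
  show ?case
  proof (rule C_diff_SucI[where f' = "\<lambda>x v. \<Sum>b\<in>obasis. inner (frechet_derivative g (at x) v) b *\<^sub>R
        frechet_derivative f (at (g x)) b", OF assms(1)])
    fix x assume x: "x \<in> S"
    then have y: "g x \<in> T" using assms(3) by auto
    have "(\<lambda>v. \<Sum>b\<in>obasis. inner (frechet_derivative g (at x) v) b *\<^sub>R frechet_derivative f (at (g x)) b)
        = frechet_derivative f (at (g x)) \<circ> frechet_derivative g (at x)"
      by (simp add: fun_eq_iff linear_expansion[OF has_derivative_linear[OF f'[OF y]], symmetric])
    moreover have "((\<lambda>x. f (g x)) has_derivative frechet_derivative f (at (g x)) \<circ> frechet_derivative g (at x)) (at x)"
      using diff_chain_at[OF g'[OF x] f'[OF y]] by (simp add: o_def)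
    ultimately show "((\<lambda>x. f (g x)) has_derivative (\<lambda>v. \<Sum>b\<in>obasis. inner (frechet_derivative g (at x) v) b *\<^sub>R
        frechet_derivative f (at (g x)) b)) (at x)" by simp
  next
    fix v
    show "C_diff k S (\<lambda>x. \<Sum>b\<in>obasis. inner (frechet_derivative g (at x) v) b *\<^sub>R frechet_derivative f (at (g x)) b)"
      by (intro C_diff_sum C_diff_bilinear[OF bounded_bilinear_scaleR] assms(1)
          C_diff_linear_comp[OF bounded_linear_inner_left] C_diff_SucD[OF Suc.prems(2)]
          Suc.IH[OF C_diff_SucD[OF Suc.prems(1)] C_diff_Suc_imp[OF assms(1) Suc.prems(2)]])
  qed
qed

subsection \<open>Smoothness at a point\<close>

text \<open>Working with germs keeps domains of definition out of all later statements.\<close>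

definition smooth_near :: "('a::model_space \<Rightarrow> 'b::model_space) \<Rightarrow> 'a \<Rightarrow> bool" where
  "smooth_near f x \<longleftrightarrow> (\<exists>U. open U \<and> x \<in> U \<and> smooth_on U f)"

lemma smooth_nearI: "open U \<Longrightarrow> smooth_on U f \<Longrightarrow> x \<in> U \<Longrightarrow> smooth_near f x"
  by (auto simp: smooth_near_def)

lemma smooth_near_eventually: "smooth_near f x \<Longrightarrow> eventually (smooth_near f) (nhds x)"
  by (auto simp: smooth_near_def eventually_nhds)

lemma C_diff_local:
  assumes "\<And>x. x \<in> S \<Longrightarrow> \<exists>U. open U \<and> x \<in> U \<and> C_diff k U f"
  shows "C_diff k S f"
  using assms
proof (induction k arbitrary: f)
  case 0
  have "isCont f x" if "x \<in> S" for x
    using 0[OF that] by (auto simp: continuous_on_eq_continuous_at)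
  then show ?case by (simp add: continuous_at_imp_continuous_on)
next
  case (Suc k)
  have "C_diff k S (\<lambda>x. frechet_derivative f (at x) v)" for v
  proof (rule Suc.IH)
    fix x assume "x \<in> S"
    then obtain U where "open U" "x \<in> U" "C_diff (Suc k) U f" using Suc.prems by blast
    then show "\<exists>U. open U \<and> x \<in> U \<and> C_diff k U (\<lambda>x. frechet_derivative f (at x) v)"
      using C_diff_SucD by blast
  qed
  moreover have "f differentiable (at x)" if "x \<in> S" for x
    using Suc.prems[OF that] by auto
  ultimately show ?case by simp
qed

lemma smooth_on_local: "(\<And>x. x \<in> S \<Longrightarrow> smooth_near f x) \<Longrightarrow> smooth_on S f"
  unfolding smooth_on_def smooth_near_def by (intro allI C_diff_local) blast

lemma smooth_near_cong:
  assumes "smooth_near f x" "eventually (\<lambda>y. f y = g y) (nhds x)"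
  shows "smooth_near g x"
proof -
  obtain U V where "open U" "x \<in> U" "smooth_on U f" "open V" "x \<in> V" "\<forall>y\<in>V. f y = g y"
    using assms by (auto simp: smooth_near_def eventually_nhds)
  then have "smooth_on (U \<inter> V) g"
    using C_diff_cong[of "U \<inter> V" f g] C_diff_subset[of _ U f "U \<inter> V"]
    by (auto simp: smooth_on_def open_Int)
  then show ?thesis using \<open>open U\<close> \<open>open V\<close> \<open>x \<in> U\<close> \<open>x \<in> V\<close>
    by (auto simp: smooth_near_def intro!: exI[of _ "U \<inter> V"])
qed

lemma smooth_near_has_derivative:
  "smooth_near f x \<Longrightarrow> (f has_derivative frechet_derivative f (at x)) (at x)"
  unfolding smooth_near_def smooth_on_def using C_diff_derivative by blast

lemma smooth_near_isCont: "smooth_near f x \<Longrightarrow> isCont f x"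
  using smooth_near_has_derivative has_derivative_continuous by blast

lemma smooth_near_tendsto: "smooth_near f x \<Longrightarrow> filterlim f (nhds (f x)) (nhds x)"
  using smooth_near_isCont[of f x] tendsto_at_iff_tendsto_nhds[of f x] by (simp add: isCont_def)

lemma smooth_near_linear_derivative: "smooth_near f x \<Longrightarrow> linear (frechet_derivative f (at x))"
  using smooth_near_has_derivative has_derivative_linear by blast

lemma smooth_near_linear: "linear L \<Longrightarrow> smooth_near L x"
  using C_diff_bounded_linear[OF linear_bounded_linear, of L UNIV]
  by (auto simp: smooth_near_def smooth_on_def intro!: exI[of _ UNIV])

lemma smooth_near_const: "smooth_near (\<lambda>x. c) x"
  using C_diff_const[of UNIV] by (auto simp: smooth_near_def smooth_on_def intro!: exI[of _ UNIV])

lemma smooth_near_compose: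
  assumes "smooth_near f (g x)" "smooth_near g x"
  shows "smooth_near (\<lambda>x. f (g x)) x"
proof -
  obtain U V where U: "open U" "x \<in> U" "smooth_on U g" and V: "open V" "g x \<in> V" "smooth_on V f"
    using assms by (auto simp: smooth_near_def)
  have "continuous_on U g" using U C_diff_continuous by (auto simp: smooth_on_def)
  then have o: "open (U \<inter> g -` V)" using U V continuous_on_open_vimage by (metis Int_commute)
  have "smooth_on (U \<inter> g -` V) (\<lambda>x. f (g x))"
    using C_diff_compose[OF o V(1), of g _ f] C_diff_subset[of _ U g "U \<inter> g -` V"] U V
    by (auto simp: smooth_on_def)
  then show ?thesis using o U V by (auto simp: smooth_near_def)
qed

lemma smooth_near_common:
  assumes "smooth_near f x" "smooth_near g x"
    and "\<And>k U. open U \<Longrightarrow> C_diff k U f \<Longrightarrow> C_diff k U g \<Longrightarrow> C_diff k U h"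
  shows "smooth_near h x"
proof -
  obtain U V where U: "open U" "x \<in> U" "smooth_on U f" and V: "open V" "x \<in> V" "smooth_on V g"
    using assms(1,2) by (auto simp: smooth_near_def)
  have "smooth_on (U \<inter> V) h"
    using assms(3)[of "U \<inter> V"] C_diff_subset[of _ U f "U \<inter> V"] C_diff_subset[of _ V g "U \<inter> V"] U V
    by (auto simp: smooth_on_def)
  then show ?thesis using U V by (auto simp: smooth_near_def intro!: exI[of _ "U \<inter> V"])
qed

lemma smooth_near_add:
  "smooth_near f x \<Longrightarrow> smooth_near g x \<Longrightarrow> smooth_near (\<lambda>x. f x + g x) x"
  by (erule (1) smooth_near_common) (rule C_diff_add)

lemma smooth_near_bilinear:
  fixes B :: "'b::model_space \<Rightarrow> 'c::model_space \<Rightarrow> 'd::model_space"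
  shows "bounded_bilinear B \<Longrightarrow> smooth_near f x \<Longrightarrow> smooth_near g x \<Longrightarrow> smooth_near (\<lambda>x. B (f x) (g x)) x"
  by (rule smooth_near_common[of f x g]) (simp_all add: C_diff_bilinear)

lemmas smooth_near_scaleR = smooth_near_bilinear[OF bounded_bilinear_scaleR]
  and smooth_near_inner = smooth_near_bilinear[OF bounded_bilinear_inner]
  and smooth_near_mult = smooth_near_bilinear[OF bounded_bilinear_mult[where 'a = real]]

lemma smooth_near_linear_comp: "linear L \<Longrightarrow> smooth_near f x \<Longrightarrow> smooth_near (\<lambda>x. L (f x)) x"
  by (rule smooth_near_compose[OF smooth_near_linear])

lemma smooth_near_diff:
  "smooth_near f x \<Longrightarrow> smooth_near g x \<Longrightarrow> smooth_near (\<lambda>x. f x - g x) x"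
  using smooth_near_add[of f x "\<lambda>x. - g x"] smooth_near_linear_comp[of uminus g x]
  by (simp add: linear_iff)

lemma smooth_near_sum:
  "(\<And>i. i \<in> I \<Longrightarrow> smooth_near (f i) x) \<Longrightarrow> smooth_near (\<lambda>x. \<Sum>i\<in>I. f i x) x"
  by (induction I rule: infinite_finite_induct) (auto intro!: smooth_near_const smooth_near_add)

lemma smooth_near_Pair:
  assumes "smooth_near f x" "smooth_near g x"
  shows "smooth_near (\<lambda>x. (f x, g x)) x"
proof -
  have l: "linear (\<lambda>y::'b. (y, 0::'c))" "linear (Pair (0::'b) :: 'c \<Rightarrow> 'b \<times> 'c)"
    by (auto intro!: linearI)
  show ?thesis
    using smooth_near_add[OF smooth_near_linear_comp[OF l(1) assms(1)] smooth_near_linear_comp[OF l(2) assms(2)]]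
    by simp
qed

lemma smooth_near_ident: "smooth_near (\<lambda>x. x) x"
  by (rule smooth_near_linear) (simp add: linear_iff)

lemma smooth_near_inverse:
  fixes f :: "'a::model_space \<Rightarrow> real"
  assumes "smooth_near f x" "f x \<noteq> 0"
  shows "smooth_near (\<lambda>x. inverse (f x)) x"
proof -
  have "C_diff k (- {0}) (inverse :: real \<Rightarrow> real)" for k
    by (rule C_diff_inverse[of "- {0}" k "\<lambda>x. x"])
       (simp_all add: C_diff_bounded_linear bounded_linear_ident open_Compl)
  then have "smooth_near (inverse :: real \<Rightarrow> real) (f x)"
    unfolding smooth_near_def smooth_on_def
    using assms(2) by (intro exI[of _ "- {0}"]) (simp add: open_Compl)
  then show ?thesis by (rule smooth_near_compose[OF _ assms(1)])
qed

text \<open>The derivative of \<open>f\<close> is smooth jointly in the point and the vector, since it is a combination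
  of the directional derivatives along a basis, with the coordinates of the vector as coefficients.\<close>

lemma smooth_near_derivative:
  assumes "smooth_near f (y x)" "smooth_near y x" "smooth_near v x"
  shows "smooth_near (\<lambda>x. frechet_derivative f (at (y x)) (v x)) x"
proof -
  have "smooth_near (\<lambda>z. frechet_derivative f (at z) b) (y x)" for b
    using assms(1) C_diff_SucD unfolding smooth_near_def smooth_on_def by blast
  then have "smooth_near (\<lambda>x. frechet_derivative f (at (y x)) b) x" for b
    by (rule smooth_near_compose[OF _ assms(2)])
  then have "smooth_near (\<lambda>x. \<Sum>b\<in>obasis. inner (v x) b *\<^sub>R frechet_derivative f (at (y x)) b) x"
    by (intro smooth_near_sum smooth_near_scaleR[OF smooth_near_inner[OF assms(3) smooth_near_const]])
  moreover have "eventually (\<lambda>x. smooth_near f (y x)) (nhds x)"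
    using smooth_near_eventually[OF assms(1)] smooth_near_tendsto[OF assms(2)]
    by (auto simp: filterlim_iff)
  then have "eventually (\<lambda>x. (\<Sum>b\<in>obasis. inner (v x) b *\<^sub>R frechet_derivative f (at (y x)) b)
      = frechet_derivative f (at (y x)) (v x)) (nhds x)"
    by eventually_elim (simp add: linear_expansion[OF smooth_near_linear_derivative, symmetric])
  ultimately show ?thesis by (rule smooth_near_cong)
qed

section \<open>Lifting curves through submersions of model spaces\<close>

text \<open>A Euclidean space has positive dimension, a model space need not. Adding one dimension turns
  every model space isometrically into a retract of a Euclidean space, so that Brouwer's theorem
  applies to it.\<close>

typedef (overloaded) 'a padded = "UNIV :: ('a::model_space \<times> real) set" by simp

instantiation padded :: (model_space) real_inner
begin
definition "0 = Abs_padded 0"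
definition "x + y = Abs_padded (Rep_padded x + Rep_padded y)"
definition "x - y = Abs_padded (Rep_padded x - Rep_padded y)"
definition "- x = Abs_padded (- Rep_padded x)"
definition "r *\<^sub>R (x :: 'a padded) = Abs_padded (r *\<^sub>R Rep_padded x)"
definition "inner (x :: 'a padded) y = inner (Rep_padded x) (Rep_padded y)"
definition "norm (x :: 'a padded) = norm (Rep_padded x)"
definition "sgn x = Abs_padded (Rep_padded x /\<^sub>R norm (Rep_padded x))"
definition "dist x y = norm (Rep_padded x - Rep_padded y)"
definition "(uniformity :: ('a padded \<times> 'a padded) filter) = (INF e\<in>{0<..}. principal {(x, y). dist x y < e})"
definition "open (U :: 'a padded set) \<longleftrightarrow> (\<forall>x\<in>U. eventually (\<lambda>(x', y). x' = x \<longrightarrow> y \<in> U) uniformity)"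
instance
  by standard (simp_all add: zero_padded_def plus_padded_def minus_padded_def uminus_padded_def
      scaleR_padded_def inner_padded_def norm_padded_def sgn_padded_def dist_padded_def
      uniformity_padded_def open_padded_def Abs_padded_inverse Rep_padded_inverse Abs_padded_inject
      Rep_padded_inject[symmetric] algebra_simps norm_eq_sqrt_inner inner_commute)
end

instantiation padded :: (model_space) euclidean_space
begin
definition "(Basis :: 'a padded set) = Abs_padded ` obasis"
instance
proof
  have "(obasis :: ('a \<times> real) set) \<noteq> {}"
  proof
    assume "(obasis :: ('a \<times> real) set) = {}"
    moreover have "span (obasis :: ('a \<times> real) set) = UNIV" by (rule span_obasis)
    ultimately have "(UNIV :: ('a \<times> real) set) = {0}" by simp
    then have "(0, 1) \<in> {0 :: 'a \<times> real}" by blast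
    then show False by (simp add: zero_prod_def)
  qed
  then show "(Basis :: 'a padded set) \<noteq> {}" by (simp add: Basis_padded_def)
  show "finite (Basis :: 'a padded set)" by (simp add: Basis_padded_def finite_obasis)
  show "inner u v = (if u = v then 1 else 0)" if uv: "u \<in> Basis" "v \<in> Basis" for u v :: "'a padded"
  proof -
    obtain b b' where "u = Abs_padded b" "b \<in> obasis" "v = Abs_padded b'" "b' \<in> obasis"
      using uv unfolding Basis_padded_def by blast
    then show ?thesis
      using inner_obasis[of b b'] by (simp add: inner_padded_def Abs_padded_inverse Abs_padded_inject)
  qed
  show "(\<forall>u\<in>Basis. inner x u = 0) \<longleftrightarrow> x = 0" for x :: "'a padded"
  proof
    assume "\<forall>u\<in>Basis. inner x u = 0"
    then have "\<forall>b\<in>obasis. inner (Rep_padded x) b = 0"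
      by (simp add: Basis_padded_def inner_padded_def Abs_padded_inverse del: split_paired_All)
    then have "Rep_padded x = 0" using obasis_expansion[of "Rep_padded x"] by simp
    then show "x = 0" by (metis Rep_padded_inverse zero_padded_def)
  qed simp
qed
end

lemma brouwer_model_space:
  fixes f :: "'a::model_space \<Rightarrow> 'a"
  assumes "0 \<le> r" "continuous_on (cball 0 r) f" "f ` cball 0 r \<subseteq> cball 0 r"
  shows "\<exists>x\<in>cball 0 r. f x = x"
proof -
  define i where "i x = Abs_padded (x, 0)" for x :: 'a
  define j where "j y = fst (Rep_padded y)" for y :: "'a padded"
  have ji: "j (i x) = x" for x by (simp add: i_def j_def Abs_padded_inverse)
  have ni: "norm (i x) = norm x" for x by (simp add: i_def norm_padded_def Abs_padded_inverse norm_Pair)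
  have nj: "norm (j y) \<le> norm y" for y
    by (simp add: j_def norm_padded_def) (metis norm_fst_le prod.collapse)
  have "bounded_linear i"
    by (intro linear_bounded_linear linearI)
       (simp_all add: i_def plus_padded_def scaleR_padded_def Abs_padded_inverse)
  moreover have "bounded_linear j"
    by (intro linear_bounded_linear linearI)
       (simp_all add: j_def plus_padded_def scaleR_padded_def Abs_padded_inverse)
  moreover have jc: "j ` cball 0 r \<subseteq> cball 0 r" using nj order_trans by fastforce
  ultimately have "continuous_on (cball 0 r) (\<lambda>y. i (f (j y)))"
    by (intro bounded_linear.continuous_on[of i] continuous_on_compose2[OF assms(2), of _ j]
        linear_continuous_on[of j])
  moreover have "(\<lambda>y. i (f (j y))) \<in> cball 0 r \<rightarrow> cball 0 r"
    using jc assms(3) by (force simp: ni)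
  moreover have "cball (0::'a padded) r \<noteq> {}" using assms(1) by auto
  ultimately obtain y where y: "y \<in> cball 0 r" "i (f (j y)) = y"
    using brouwer[of "cball 0 r" "\<lambda>y. i (f (j y))"] by (auto simp: compact_cball convex_cball)
  then have "f (j y) = j y" using ji by metis
  then show ?thesis using y jc by blast
qed

text \<open>The equation \<open>\<Phi> (y0 + s w + R z) = \<eta> s\<close> is solved for \<open>z\<close> in a ball whose radius is small
  compared with \<open>s\<close>. The map \<open>z \<mapsto> z - (\<Phi> (y0 + s w + R z) - \<eta> s)\<close> preserves that ball since its
  values are differences of two first-order remainders.\<close>

lemma curve_lift_estimate:
  fixes \<Phi> :: "'a::model_space \<Rightarrow> 'b::model_space"
  assumes "open U" "y0 \<in> U" "continuous_on U \<Phi>" and \<Phi>: "(\<Phi> has_derivative \<Phi>') (at y0)"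
    and R: "linear R" "\<And>z. \<Phi>' (R z) = z"
    and \<eta>: "(\<eta> has_vector_derivative \<Phi>' w) (at 0)" "\<eta> 0 = \<Phi> y0" and "\<epsilon> > 0"
  shows "\<exists>\<delta>>0. \<forall>s. \<bar>s\<bar> < \<delta> \<longrightarrow> (\<exists>z. norm z \<le> \<epsilon> * \<bar>s\<bar> \<and> \<Phi> (y0 + s *\<^sub>R w + R z) = \<eta> s)"
proof -
  obtain K where K: "K > 0" "\<And>z. norm (R z) \<le> norm z * K"
    using bounded_linear.pos_bounded[OF linear_bounded_linear[OF R(1)]] by blast
  define C where "C = norm w + K * \<epsilon>"
  have C: "C > 0" using K(1) \<open>\<epsilon> > 0\<close> by (simp add: C_def add_nonneg_pos)
  have e1: "\<epsilon> / (2 * C) > 0" "\<epsilon> / 2 > 0" using C \<open>\<epsilon> > 0\<close> by simp_all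
  obtain d1 where d1: "d1 > 0" "\<And>y. norm (y - y0) < d1 \<Longrightarrow>
      norm (\<Phi> y - \<Phi> y0 - \<Phi>' (y - y0)) \<le> \<epsilon> / (2 * C) * norm (y - y0)"
    using \<Phi> e1 unfolding has_derivative_at_alt by blast
  obtain d2 where d2: "d2 > 0" "ball y0 d2 \<subseteq> U"
    using assms(1,2) openE by blast
  obtain d3 where d3: "d3 > 0" "\<And>s. norm (s - 0) < d3 \<Longrightarrow>
      norm (\<eta> s - \<eta> 0 - (s - 0) *\<^sub>R \<Phi>' w) \<le> \<epsilon> / 2 * norm (s - 0)"
    using \<eta>(1) e1(2) unfolding has_vector_derivative_def has_derivative_at_alt by blast
  define \<delta> where "\<delta> = min (min d1 d2 / C) d3"
  have \<Phi>'l: "linear \<Phi>'" using \<Phi> by (rule has_derivative_linear)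
  have "\<exists>z. norm z \<le> \<epsilon> * \<bar>s\<bar> \<and> \<Phi> (y0 + s *\<^sub>R w + R z) = \<eta> s" if s: "\<bar>s\<bar> < \<delta>" for s
  proof -
    define h where "h z = s *\<^sub>R w + R z" for z
    have h: "norm (h z) \<le> C * \<bar>s\<bar>" "norm (h z) < d1" "norm (h z) < d2" if "norm z \<le> \<epsilon> * \<bar>s\<bar>" for z
    proof -
      have "norm (h z) \<le> norm (s *\<^sub>R w) + norm (R z)" unfolding h_def by (rule norm_triangle_ineq)
      also have "\<dots> \<le> \<bar>s\<bar> * norm w + (\<epsilon> * \<bar>s\<bar>) * K"
        using K that order_trans[OF K(2) mult_right_mono[OF that, of K]] by simp
      finally show *: "norm (h z) \<le> C * \<bar>s\<bar>" by (simp add: C_def algebra_simps)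
      have "\<bar>s\<bar> < min d1 d2 / C" using s by (simp add: \<delta>_def)
      then have "C * \<bar>s\<bar> < min d1 d2" using C by (simp add: pos_less_divide_eq mult.commute)
      then show "norm (h z) < d1" "norm (h z) < d2" using * by auto
    qed
    define f where "f z = z - (\<Phi> (y0 + h z) - \<eta> s)" for z
    have "\<exists>z\<in>cball 0 (\<epsilon> * \<bar>s\<bar>). f z = z"
    proof (rule brouwer_model_space)
      show "0 \<le> \<epsilon> * \<bar>s\<bar>" using \<open>\<epsilon> > 0\<close> by simp
      have "continuous_on (cball 0 (\<epsilon> * \<bar>s\<bar>)) (\<lambda>z. y0 + h z)" unfolding h_def
        by (intro continuous_intros linear_continuous_on linear_bounded_linear R)
      moreover have "(\<lambda>z. y0 + h z) ` cball 0 (\<epsilon> * \<bar>s\<bar>) \<subseteq> U"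
      proof (rule image_subsetI)
        fix z :: 'b assume "z \<in> cball 0 (\<epsilon> * \<bar>s\<bar>)"
        then have "y0 + h z \<in> ball y0 d2" using h(3)[of z] by (simp add: dist_norm)
        then show "y0 + h z \<in> U" using d2(2) by blast
      qed
      ultimately show "continuous_on (cball 0 (\<epsilon> * \<bar>s\<bar>)) f" unfolding f_def
        by (intro continuous_on_diff continuous_on_const continuous_on_id) (rule continuous_on_compose2[OF assms(3)])
      show "f ` cball 0 (\<epsilon> * \<bar>s\<bar>) \<subseteq> cball 0 (\<epsilon> * \<bar>s\<bar>)"
      proof (rule image_subsetI)
        fix z :: 'b assume "z \<in> cball 0 (\<epsilon> * \<bar>s\<bar>)"
        then have z: "norm z \<le> \<epsilon> * \<bar>s\<bar>" by simp
        have "\<Phi>' (h z) = s *\<^sub>R \<Phi>' w + z"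
          by (simp add: h_def linear_add[OF \<Phi>'l] linear_scale[OF \<Phi>'l] R)
        then have "f z = (\<eta> s - \<eta> 0 - s *\<^sub>R \<Phi>' w) - (\<Phi> (y0 + h z) - \<Phi> y0 - \<Phi>' (h z))"
          using \<eta>(2) by (simp add: f_def)
        then have "norm (f z) \<le> norm (\<eta> s - \<eta> 0 - s *\<^sub>R \<Phi>' w) + norm (\<Phi> (y0 + h z) - \<Phi> y0 - \<Phi>' (h z))"
          by (simp add: norm_triangle_ineq4)
        also have "\<dots> \<le> \<epsilon> / 2 * \<bar>s\<bar> + \<epsilon> / (2 * C) * norm (h z)"
          using d3(2)[of s] d1(2)[of "y0 + h z"] h(2)[OF z] s by (intro add_mono) (auto simp: \<delta>_def)
        also have "\<dots> \<le> \<epsilon> / 2 * \<bar>s\<bar> + \<epsilon> / (2 * C) * (C * \<bar>s\<bar>)"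
          using h(1)[OF z] C \<open>\<epsilon> > 0\<close> by (intro add_left_mono mult_left_mono) auto
        also have "\<dots> = \<epsilon> * \<bar>s\<bar>" using C by simp
        finally show "f z \<in> cball 0 (\<epsilon> * \<bar>s\<bar>)" by simp
      qed
    qed
    then show ?thesis by (auto simp: f_def h_def add.assoc)
  qed
  moreover have "\<delta> > 0" using d1 d2 d3 C by (simp add: \<delta>_def)
  ultimately show ?thesis by blast
qed

text \<open>The estimate holds for every \<open>\<epsilon>\<close>, but the solution it provides depends on \<open>\<epsilon>\<close>. A single curve
  arises by taking, for each \<open>s\<close>, a solution \<open>z\<close> of almost minimal norm.\<close>

lemma curve_lift:
  fixes \<Phi> :: "'a::model_space \<Rightarrow> 'b::model_space"
  assumes "open U" "y0 \<in> U" "continuous_on U \<Phi>" "(\<Phi> has_derivative \<Phi>') (at y0)"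
    and R: "linear R" "\<And>z. \<Phi>' (R z) = z"
    and \<eta>: "(\<eta> has_vector_derivative \<Phi>' w) (at 0)" "\<eta> 0 = \<Phi> y0"
  shows "\<exists>y. y 0 = y0 \<and> (y has_vector_derivative w) (at 0) \<and> (\<forall>\<^sub>F s in nhds 0. \<Phi> (y s) = \<eta> s)"
proof -
  define S where "S s = {z. \<Phi> (y0 + s *\<^sub>R w + R z) = \<eta> s}" for s
  (* the solution z is chosen almost as small as possible, so that it satisfies the estimate for every epsilon *)
  have "\<exists>z. S s \<noteq> {} \<longrightarrow> z \<in> S s \<and> (\<forall>z'\<in>S s. norm z \<le> norm z' + s\<^sup>2)" for s
  proof (cases "S s = {} \<or> s = 0")
    case True
    have "0 \<in> S 0" using \<eta>(2) by (simp add: S_def linear_0[OF R(1)])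
    then show ?thesis using True by (intro exI[of _ 0]) auto
  next
    case False
    have "Inf (norm ` S s) < Inf (norm ` S s) + s\<^sup>2" using False by simp
    then obtain z where z: "z \<in> S s" "norm z < Inf (norm ` S s) + s\<^sup>2"
      using cInf_lessD[of "norm ` S s" "Inf (norm ` S s) + s\<^sup>2"] False by auto
    have "Inf (norm ` S s) \<le> norm z'" if "z' \<in> S s" for z'
      using that by (intro cInf_lower bdd_belowI[of _ 0]) auto
    then show ?thesis using z by (intro exI[of _ z]) force
  qed
  then obtain z where z: "\<And>s. S s \<noteq> {} \<Longrightarrow> z s \<in> S s"
    "\<And>s z'. z' \<in> S s \<Longrightarrow> norm (z s) \<le> norm z' + s\<^sup>2" by (metis empty_iff)
  define y where "y s = y0 + s *\<^sub>R w + R (z s)" for s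
  have est: "\<exists>\<delta>>0. \<forall>s. \<bar>s\<bar> < \<delta> \<longrightarrow> S s \<noteq> {} \<and> norm (z s) \<le> \<epsilon> * \<bar>s\<bar> + s\<^sup>2" if e: "\<epsilon> > 0" for \<epsilon>
  proof -
    obtain \<delta> where d: "\<delta> > 0" "\<forall>s. \<bar>s\<bar> < \<delta> \<longrightarrow> (\<exists>z. norm z \<le> \<epsilon> * \<bar>s\<bar> \<and> \<Phi> (y0 + s *\<^sub>R w + R z) = \<eta> s)"
      using curve_lift_estimate[OF assms e] by blast
    have "S s \<noteq> {} \<and> norm (z s) \<le> \<epsilon> * \<bar>s\<bar> + s\<^sup>2" if s: "\<bar>s\<bar> < \<delta>" for s
    proof -
      obtain z' where z': "norm z' \<le> \<epsilon> * \<bar>s\<bar>" "z' \<in> S s" using d(2) s by (auto simp: S_def)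
      then show ?thesis using z(2)[OF z'(2)] by auto
    qed
    then show ?thesis using d(1) by blast
  qed
  have "0 \<in> S 0" using \<eta>(2) by (simp add: S_def linear_0[OF R(1)])
  then have "z 0 = 0" using z(2)[of 0 0] by simp
  then have y0: "y 0 = y0" by (simp add: y_def linear_0[OF R(1)])
  obtain K where K: "K > 0" "\<And>z. norm (R z) \<le> norm z * K"
    using bounded_linear.pos_bounded[OF linear_bounded_linear[OF R(1)]] by blast
  have "(y has_vector_derivative w) (at 0)"
    unfolding has_vector_derivative_def has_derivative_at_alt
  proof (intro conjI allI impI)
    show "bounded_linear (\<lambda>x. x *\<^sub>R w)" by (rule bounded_linear_scaleR_left)
    fix e :: real assume e: "e > 0"
    define \<epsilon> where "\<epsilon> = e / (2 * K)"
    have \<epsilon>: "\<epsilon> > 0" using e K by (simp add: \<epsilon>_def)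
    obtain \<delta> where d: "\<delta> > 0" "\<And>s. \<bar>s\<bar> < \<delta> \<Longrightarrow> norm (z s) \<le> \<epsilon> * \<bar>s\<bar> + s\<^sup>2"
      using est[OF \<epsilon>] by blast
    have "norm (y s - y 0 - (s - 0) *\<^sub>R w) \<le> e * norm (s - 0)" if "norm (s - 0) < min \<delta> \<epsilon>" for s
    proof -
      have s: "\<bar>s\<bar> < \<delta>" "\<bar>s\<bar> \<le> \<epsilon>" using that by auto
      have "s\<^sup>2 \<le> \<epsilon> * \<bar>s\<bar>" using s(2) mult_right_mono[OF s(2), of "\<bar>s\<bar>"] by (simp add: power2_eq_square)
      then have "norm (z s) \<le> 2 * \<epsilon> * \<bar>s\<bar>" using d(2)[OF s(1)] by simp
      then have "norm (R (z s)) \<le> 2 * \<epsilon> * \<bar>s\<bar> * K"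
        using K order_trans[OF K(2) mult_right_mono] by (meson less_imp_le)
      then show ?thesis using K by (simp add: y0) (simp add: y_def \<epsilon>_def)
    qed
    then show "\<exists>d>0. \<forall>s. norm (s - 0) < d \<longrightarrow> norm (y s - y 0 - (s - 0) *\<^sub>R w) \<le> e * norm (s - 0)"
      using d(1) \<epsilon> by (intro exI[of _ "min \<delta> \<epsilon>"]) simp
  qed
  moreover have "\<forall>\<^sub>F s in nhds 0. \<Phi> (y s) = \<eta> s"
  proof -
    obtain \<delta> where d: "\<delta> > 0" "\<And>s. \<bar>s\<bar> < \<delta> \<Longrightarrow> S s \<noteq> {}" using est[of 1] by auto
    have "\<Phi> (y s) = \<eta> s" if "\<bar>s\<bar> < \<delta>" for s using z(1)[OF d(2)[OF that]] by (simp add: S_def y_def)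
    then show ?thesis using d(1) unfolding eventually_nhds_metric by (auto simp: dist_norm)
  qed
  ultimately show ?thesis using y0 by blast
qed

section \<open>Germs of smooth maps between manifolds\<close>

lemma chart_inv_in: "x \<in> snd c ` fst c \<Longrightarrow> chart_inv c x \<in> fst c"
  by (rule inv_into_into)

lemma chart_chart_inv: "x \<in> snd c ` fst c \<Longrightarrow> snd c (chart_inv c x) = x"
  by (rule f_inv_into_f)

lemma chart_inv_chart: "smooth_atlas A \<Longrightarrow> c \<in> A \<Longrightarrow> p \<in> fst c \<Longrightarrow> chart_inv c (snd c p) = p"
  by (simp add: smooth_atlas_def)

lemma chart_open: "smooth_atlas A \<Longrightarrow> c \<in> A \<Longrightarrow> open (snd c ` fst c)"
  by (simp add: smooth_atlas_def)

lemma chart_subset_pts: "c \<in> A \<Longrightarrow> p \<in> fst c \<Longrightarrow> p \<in> pts A"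
  by (auto simp: pts_def)

lemma ptsE: "p \<in> pts A \<Longrightarrow> \<exists>c\<in>A. p \<in> fst c"
  by (auto simp: pts_def)

lemma transition_smooth_near:
  assumes "smooth_atlas A" "c \<in> A" "d \<in> A" "p \<in> fst c" "p \<in> fst d"
  shows "smooth_near (snd d \<circ> chart_inv c) (snd c p)"
proof (rule smooth_nearI)
  show "open (snd c ` (fst c \<inter> fst d))" "smooth_on (snd c ` (fst c \<inter> fst d)) (snd d \<circ> chart_inv c)"
    using assms by (simp_all add: smooth_atlas_def)
  show "snd c p \<in> snd c ` (fst c \<inter> fst d)" using assms by blast
qed

lemma mopen_pts: "smooth_atlas A \<Longrightarrow> mopen A (pts A)"
proof -
  assume A: "smooth_atlas A"
  have "pts A \<inter> fst c = fst c" if "c \<in> A" for c using that by (auto simp: pts_def)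
  then show ?thesis using A by (simp add: mopen_def smooth_atlas_def)
qed

lemma mopen_Int: "smooth_atlas A \<Longrightarrow> mopen A S \<Longrightarrow> mopen A T \<Longrightarrow> mopen A (S \<inter> T)"
  using istopology_mopen[of A, unfolded istopology_def, THEN conjunct1] by simp

lemma mopen_chart_image:
  assumes A: "smooth_atlas A" and c: "c \<in> A" and U: "open U" "U \<subseteq> snd c ` fst c"
  shows "mopen A (chart_inv c ` U)"
proof -
  have sub: "chart_inv c ` U \<subseteq> fst c" using U(2) by (intro image_subsetI chart_inv_in) auto
  have "open (snd d ` (chart_inv c ` U \<inter> fst d))" if d: "d \<in> A" for d
  proof -
    let ?V = "snd d ` (fst d \<inter> fst c)" and ?g = "snd c \<circ> chart_inv d"
    have V: "open ?V" "smooth_on ?V ?g" using A c d by (simp_all add: smooth_atlas_def)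
    have eq: "snd d ` (chart_inv c ` U \<inter> fst d) = ?V \<inter> ?g -` U" (is "?L = ?R")
    proof
      show "?L \<subseteq> ?R"
      proof
        fix y assume "y \<in> ?L"
        then obtain x where x: "x \<in> U" "chart_inv c x \<in> fst d" "y = snd d (chart_inv c x)" by blast
        then have "x \<in> snd c ` fst c" using U(2) by blast
        then show "y \<in> ?R"
          using x chart_inv_in[of x c] by (simp add: chart_inv_chart[OF A d] chart_chart_inv)
      qed
      show "?R \<subseteq> ?L"
      proof
        fix y assume y: "y \<in> ?R"
        then obtain q where q: "q \<in> fst d" "q \<in> fst c" "y = snd d q" by blast
        then have "snd c q \<in> U" using y by (simp add: chart_inv_chart[OF A d])
        then have "q \<in> chart_inv c ` U" using chart_inv_chart[OF A c q(2)] by (metis imageI)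
        then show "y \<in> ?L" using q by blast
      qed
    qed
    have "continuous_on ?V ?g" using V C_diff_continuous unfolding smooth_on_def by blast
    then have "open (?g -` U \<inter> ?V)" using U(1) continuous_on_open_vimage[OF V(1), of ?g] by blast
    with eq show ?thesis by (simp only: Int_commute)
  qed
  then show ?thesis using sub c by (auto simp: mopen_def pts_def)
qed

text \<open>The neighbourhood filter of \<open>p\<close> in the topology of the atlas. In a chart it is the neighbourhood
  filter of the coordinates, so that statements about germs can be moved to model spaces.\<close>

definition mnhds :: "('a, 'e::model_space) atlas \<Rightarrow> 'a \<Rightarrow> 'a filter" where
  "mnhds A p = (INF W\<in>{W. mopen A W \<and> p \<in> W}. principal W)"

lemma eventually_mnhds:
  assumes "smooth_atlas A" "p \<in> pts A"
  shows "eventually P (mnhds A p) \<longleftrightarrow> (\<exists>W. mopen A W \<and> p \<in> W \<and> (\<forall>q\<in>W. P q))"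
proof -
  have "{W. mopen A W \<and> p \<in> W} \<noteq> {}" using mopen_pts assms by blast
  moreover have "\<exists>W\<in>{W. mopen A W \<and> p \<in> W}. principal W \<le> inf (principal S) (principal T)"
    if "S \<in> {W. mopen A W \<and> p \<in> W}" "T \<in> {W. mopen A W \<and> p \<in> W}" for S T
    using that mopen_Int[OF assms(1), of S T] by (intro bexI[of _ "S \<inter> T"]) auto
  ultimately show ?thesis
    unfolding mnhds_def by (subst eventually_INF_base) (auto simp: eventually_principal)
qed

lemma mnhds_chart:
  assumes A: "smooth_atlas A" and c: "c \<in> A" "p \<in> fst c"
  shows "mnhds A p = filtermap (chart_inv c) (nhds (snd c p))"
proof (rule filter_eq_iff[THEN iffD2], rule allI)
  fix P
  have p: "p \<in> pts A" using c by (rule chart_subset_pts)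
  have "(\<exists>W. mopen A W \<and> p \<in> W \<and> (\<forall>q\<in>W. P q)) \<longleftrightarrow> (\<exists>U. open U \<and> snd c p \<in> U \<and> (\<forall>x\<in>U. P (chart_inv c x)))"
    (is "?L \<longleftrightarrow> ?R")
  proof
    assume ?L
    then obtain W where W: "mopen A W" "p \<in> W" "\<forall>q\<in>W. P q" by blast
    have "open (snd c ` (W \<inter> fst c))" using W c by (simp add: mopen_def)
    moreover have "\<forall>x\<in>snd c ` (W \<inter> fst c). P (chart_inv c x)"
      using W(3) chart_inv_chart[OF A c(1)] by auto
    ultimately show ?R using W(2) c(2) by blast
  next
    assume ?R
    then obtain U where U: "open U" "snd c p \<in> U" "\<forall>x\<in>U. P (chart_inv c x)" by blast
    have "mopen A (chart_inv c ` (U \<inter> snd c ` fst c))"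
      using U(1) chart_open[OF A c(1)] by (intro mopen_chart_image[OF A c(1)]) auto
    moreover have "p \<in> chart_inv c ` (U \<inter> snd c ` fst c)"
      using U(2) c(2) chart_inv_chart[OF A c] by (metis IntI imageI)
    ultimately show ?L using U(3) by blast
  qed
  then show "eventually P (mnhds A p) \<longleftrightarrow> eventually P (filtermap (chart_inv c) (nhds (snd c p)))"
    unfolding eventually_mnhds[OF A p] eventually_filtermap eventually_nhds by simp
qed

lemma eventually_mnhds_chart:
  assumes "smooth_atlas A" "c \<in> A" "p \<in> fst c"
  shows "eventually P (mnhds A p) \<longleftrightarrow> eventually (\<lambda>x. P (chart_inv c x)) (nhds (snd c p))"
  by (simp add: mnhds_chart[OF assms] eventually_filtermap)

lemma eventually_mnhds_imp:
  assumes "smooth_atlas A" "p \<in> pts A" "eventually P (mnhds A p)"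
  shows "P p"
  using assms(3) unfolding eventually_mnhds[OF assms(1,2)] by blast

lemma eventually_eventually_mnhds:
  assumes "smooth_atlas A" "p \<in> pts A" "eventually P (mnhds A p)"
  shows "eventually (\<lambda>q. eventually P (mnhds A q)) (mnhds A p)"
proof -
  obtain W where W: "mopen A W" "p \<in> W" "\<forall>q\<in>W. P q" using assms(3) unfolding eventually_mnhds[OF assms(1,2)] by blast
  then have "eventually P (mnhds A q)" if "q \<in> W" for q
    using that W eventually_mnhds[OF assms(1), of q P] unfolding mopen_def by blast
  then show ?thesis using W unfolding eventually_mnhds[OF assms(1,2), of "\<lambda>q. eventually P (mnhds A q)"] by blast
qed

lemma eventually_mopen:
  "smooth_atlas A \<Longrightarrow> mopen A W \<Longrightarrow> p \<in> W \<Longrightarrow> eventually (\<lambda>q. q \<in> W) (mnhds A p)"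
  using eventually_mnhds[of A p "\<lambda>q. q \<in> W"] unfolding mopen_def by blast

lemma eventually_in_pts: "smooth_atlas A \<Longrightarrow> p \<in> pts A \<Longrightarrow> eventually (\<lambda>q. q \<in> pts A) (mnhds A p)"
  by (rule eventually_mopen) (auto simp: mopen_pts)

lemma eventually_nhds_chart:
  assumes "smooth_atlas A" "c \<in> A" "p \<in> fst c"
  shows "eventually (\<lambda>x. x \<in> snd c ` fst c) (nhds (snd c p))"
  using chart_open[OF assms(1,2)] assms(3) by (intro eventually_nhds_in_open) auto

lemma eventually_in_chart:
  assumes "smooth_atlas A" "c \<in> A" "p \<in> fst c"
  shows "eventually (\<lambda>q. q \<in> fst c) (mnhds A p)"
  unfolding eventually_mnhds_chart[OF assms]
  using eventually_nhds_chart[OF assms] by eventually_elim (rule chart_inv_in)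

lemma filterlim_mnhds_chart:
  assumes "smooth_atlas B" "d \<in> B" "f p \<in> fst d"
    and "eventually (\<lambda>q. f q \<in> fst d) F" "filterlim (\<lambda>q. snd d (f q)) (nhds (snd d (f p))) F"
  shows "filterlim f (mnhds B (f p)) F"
  unfolding filterlim_iff eventually_mnhds_chart[OF assms(1-3)]
proof (intro allI impI)
  fix P assume "eventually (\<lambda>x. P (chart_inv d x)) (nhds (snd d (f p)))"
  then have "eventually (\<lambda>q. P (chart_inv d (snd d (f q)))) F"
    using assms(5) by (auto simp: filterlim_iff)
  then show "eventually (\<lambda>q. P (f q)) F"
    using assms(4) by eventually_elim (simp add: chart_inv_chart[OF assms(1,2)])
qed

text \<open>Vector-valued functions are kept apart from maps into manifolds: the former are closed under
  the operations of calculus, and the latter are smooth if their coordinate expressions are.\<close>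

definition smooth_fn :: "('a, 'e::model_space) atlas \<Rightarrow> ('a \<Rightarrow> 'v::model_space) \<Rightarrow> 'a \<Rightarrow> bool" where
  "smooth_fn A \<phi> p \<longleftrightarrow> p \<in> pts A \<and> (\<forall>c\<in>A. p \<in> fst c \<longrightarrow> smooth_near (\<phi> \<circ> chart_inv c) (snd c p))"

definition smooth_at ::
  "('a, 'e::model_space) atlas \<Rightarrow> ('b, 'f::model_space) atlas \<Rightarrow> ('a \<Rightarrow> 'b) \<Rightarrow> 'a \<Rightarrow> bool" where
  "smooth_at A B f p \<longleftrightarrow> p \<in> pts A \<and> f p \<in> pts B \<and> filterlim f (mnhds B (f p)) (mnhds A p) \<and>
     (\<forall>d\<in>B. f p \<in> fst d \<longrightarrow> smooth_fn A (\<lambda>q. snd d (f q)) p)"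

text \<open>Coordinate changes are smooth, so one chart suffices.\<close>

lemma smooth_fn_chartI:
  assumes A: "smooth_atlas A" and c: "c \<in> A" "p \<in> fst c" and s: "smooth_near (\<phi> \<circ> chart_inv c) (snd c p)"
  shows "smooth_fn A \<phi> p"
  unfolding smooth_fn_def
proof (intro conjI ballI impI)
  show "p \<in> pts A" using c by (rule chart_subset_pts)
  fix d assume d: "d \<in> A" "p \<in> fst d"
  have "smooth_near (\<lambda>x. (\<phi> \<circ> chart_inv c) ((snd c \<circ> chart_inv d) x)) (snd d p)"
    by (rule smooth_near_compose[where f = "\<phi> \<circ> chart_inv c" and g = "snd c \<circ> chart_inv d"])
       (use s transition_smooth_near[OF A d(1) c(1) d(2) c(2)] chart_inv_chart[OF A d] in simp_all)
  moreover have "eventually (\<lambda>x. (\<phi> \<circ> chart_inv c) ((snd c \<circ> chart_inv d) x) = (\<phi> \<circ> chart_inv d) x) (nhds (snd d p))"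
    using eventually_in_chart[OF A c] unfolding eventually_mnhds_chart[OF A d]
    by eventually_elim (simp add: chart_inv_chart[OF A c(1)])
  ultimately show "smooth_near (\<phi> \<circ> chart_inv d) (snd d p)" by (rule smooth_near_cong)
qed

lemma smooth_fnD: "smooth_fn A \<phi> p \<Longrightarrow> c \<in> A \<Longrightarrow> p \<in> fst c \<Longrightarrow> smooth_near (\<phi> \<circ> chart_inv c) (snd c p)"
  by (simp add: smooth_fn_def)

lemma smooth_fn_pts: "smooth_fn A \<phi> p \<Longrightarrow> p \<in> pts A"
  by (simp add: smooth_fn_def)

lemma smooth_fn_cong:
  assumes "smooth_atlas A" "smooth_fn A \<phi> p" "eventually (\<lambda>q. \<phi> q = \<psi> q) (mnhds A p)"
  shows "smooth_fn A \<psi> p"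
proof -
  obtain c where c: "c \<in> A" "p \<in> fst c" using assms(2) ptsE smooth_fn_pts by metis
  have "smooth_near (\<psi> \<circ> chart_inv c) (snd c p)"
    by (rule smooth_near_cong[OF smooth_fnD[OF assms(2) c]])
       (use assms(3) in \<open>simp add: eventually_mnhds_chart[OF assms(1) c]\<close>)
  then show ?thesis by (rule smooth_fn_chartI[OF assms(1) c])
qed

lemma smooth_fn_eventually:
  assumes "smooth_atlas A" "smooth_fn A \<phi> p"
  shows "eventually (smooth_fn A \<phi>) (mnhds A p)"
proof -
  obtain c where c: "c \<in> A" "p \<in> fst c" using assms(2) ptsE smooth_fn_pts by metis
  have "eventually (smooth_near (\<phi> \<circ> chart_inv c)) (nhds (snd c p))"
    by (rule smooth_near_eventually[OF smooth_fnD[OF assms(2) c]])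
  then show ?thesis
    using eventually_nhds_chart[OF assms(1) c] unfolding eventually_mnhds_chart[OF assms(1) c]
    by eventually_elim
       (rule smooth_fn_chartI[OF assms(1) c(1)], simp_all add: chart_inv_in chart_chart_inv)
qed

lemma smooth_fn_compose_vec:
  assumes "smooth_near \<psi> (\<phi> p)" "smooth_fn A \<phi> p"  "smooth_atlas A"
  shows "smooth_fn A (\<lambda>q. \<psi> (\<phi> q)) p"
proof -
  obtain c where c: "c \<in> A" "p \<in> fst c" using assms(2) ptsE smooth_fn_pts by metis
  have "smooth_near (\<lambda>x. \<psi> ((\<phi> \<circ> chart_inv c) x)) (snd c p)"
    by (rule smooth_near_compose[OF _ smooth_fnD[OF assms(2) c]])
       (use assms(1) in \<open>simp add: chart_inv_chart[OF assms(3) c]\<close>)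
  then show ?thesis by (intro smooth_fn_chartI[OF assms(3) c]) (simp add: o_def)
qed

lemma smooth_fn_Pair:
  assumes "smooth_fn A \<phi> p" "smooth_fn A \<psi> p"
  shows "smooth_fn A (\<lambda>q. (\<phi> q, \<psi> q)) p"
  using assms by (simp add: smooth_fn_def o_def smooth_near_Pair)

lemma smooth_fn_const: "p \<in> pts A \<Longrightarrow> smooth_fn A (\<lambda>q. k) p"
  by (simp add: smooth_fn_def o_def smooth_near_const)

lemma smooth_fn_chart: 
  assumes "smooth_atlas A" "c \<in> A" "p \<in> fst c"
  shows "smooth_fn A (snd c) p"
  using transition_smooth_near[OF assms(1) _ assms(2) _ assms(3)] chart_subset_pts[OF assms(2,3)]
  by (auto simp: smooth_fn_def o_def)

lemma smooth_fn_tendsto: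
  assumes "smooth_fn A \<phi> p" "smooth_atlas A"
  shows "filterlim \<phi> (nhds (\<phi> p)) (mnhds A p)"
proof -
  obtain c where c: "c \<in> A" "p \<in> fst c" using assms(1) ptsE smooth_fn_pts by metis
  show ?thesis
    using smooth_near_tendsto[OF smooth_fnD[OF assms(1) c]] chart_inv_chart[OF assms(2) c]
    by (simp add: mnhds_chart[OF assms(2) c] filterlim_filtermap o_def)
qed

lemma smooth_fn_compose:
  assumes "smooth_atlas A" "smooth_atlas B" "smooth_at A B f p" "smooth_fn B \<phi> (f p)"
  shows "smooth_fn A (\<lambda>q. \<phi> (f q)) p"
proof -
  obtain d where d: "d \<in> B" "f p \<in> fst d" using assms(4) ptsE smooth_fn_pts by metis
  have "smooth_fn A (\<lambda>q. snd d (f q)) p" using assms(3) d by (simp add: smooth_at_def)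
  from smooth_fn_compose_vec[OF smooth_fnD[OF assms(4) d] this assms(1)]
  have "smooth_fn A (\<lambda>q. (\<phi> \<circ> chart_inv d) (snd d (f q))) p" .
  moreover have "eventually (\<lambda>q. f q \<in> fst d) (mnhds A p)"
    using eventually_in_chart[OF assms(2) d] assms(3) unfolding smooth_at_def filterlim_iff by blast
  then have "eventually (\<lambda>q. (\<phi> \<circ> chart_inv d) (snd d (f q)) = \<phi> (f q)) (mnhds A p)"
    by eventually_elim (simp add: chart_inv_chart[OF assms(2) d(1)])
  ultimately show ?thesis by (rule smooth_fn_cong[OF assms(1)])
qed

lemma smooth_at_chartI:
  assumes A: "smooth_atlas A" and B: "smooth_atlas B" and d: "d \<in> B" "f p \<in> fst d"
    and ev: "eventually (\<lambda>q. f q \<in> fst d) (mnhds A p)" and s: "smooth_fn A (\<lambda>q. snd d (f q)) p"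
  shows "smooth_at A B f p"
  unfolding smooth_at_def
proof (intro conjI ballI impI)
  show "p \<in> pts A" "f p \<in> pts B" using smooth_fn_pts[OF s] chart_subset_pts[OF d] .
  show "filterlim f (mnhds B (f p)) (mnhds A p)"
    by (rule filterlim_mnhds_chart[OF B d ev smooth_fn_tendsto[OF s A]])
  fix d' assume d': "d' \<in> B" "f p \<in> fst d'"
  have "smooth_fn A (\<lambda>q. (snd d' \<circ> chart_inv d) (snd d (f q))) p"
    by (rule smooth_fn_compose_vec[OF transition_smooth_near[OF B d(1) d'(1) d(2) d'(2)] s A])
  then show "smooth_fn A (\<lambda>q. snd d' (f q)) p"
    by (rule smooth_fn_cong[OF A])
       (use ev in \<open>eventually_elim, simp add: chart_inv_chart[OF B d(1)]\<close>)
qed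

lemma smooth_at_pts: "smooth_at A B f p \<Longrightarrow> p \<in> pts A" "smooth_at A B f p \<Longrightarrow> f p \<in> pts B"
  by (simp_all add: smooth_at_def)

lemma smooth_at_filterlim: "smooth_at A B f p \<Longrightarrow> filterlim f (mnhds B (f p)) (mnhds A p)"
  by (simp add: smooth_at_def)

lemma smooth_at_eventually_comp:
  "smooth_at A B f p \<Longrightarrow> eventually P (mnhds B (f p)) \<Longrightarrow> eventually (\<lambda>q. P (f q)) (mnhds A p)"
  by (auto simp: smooth_at_def filterlim_iff)

lemma smooth_at_fn: "smooth_at A B f p \<Longrightarrow> d \<in> B \<Longrightarrow> f p \<in> fst d \<Longrightarrow> smooth_fn A (\<lambda>q. snd d (f q)) p"
  by (simp add: smooth_at_def)

lemma smooth_at_cong: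
  assumes "smooth_atlas A" "smooth_atlas B" "smooth_at A B f p" "eventually (\<lambda>q. f q = g q) (mnhds A p)"
  shows "smooth_at A B g p"
proof -
  have p: "f p = g p" using eventually_mnhds_imp[OF assms(1) smooth_at_pts(1)[OF assms(3)] assms(4)] .
  obtain d where d: "d \<in> B" "f p \<in> fst d" using assms(3) smooth_at_pts ptsE by metis
  show ?thesis
  proof (rule smooth_at_chartI[OF assms(1,2) d(1)])
    show "g p \<in> fst d" using d p by simp
    show "\<forall>\<^sub>F q in mnhds A p. g q \<in> fst d"
      using smooth_at_eventually_comp[OF assms(3) eventually_in_chart[OF assms(2) d]] assms(4)
      by eventually_elim simp
    show "smooth_fn A (\<lambda>q. snd d (g q)) p"
      by (rule smooth_fn_cong[OF assms(1) smooth_at_fn[OF assms(3) d]])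
         (use assms(4) in \<open>eventually_elim, simp\<close>)
  qed
qed

lemma smooth_at_compose:
  assumes "smooth_atlas A" "smooth_atlas B" "smooth_at A B f p" "smooth_at B C g (f p)"
  shows "smooth_at A C (\<lambda>q. g (f q)) p"
  unfolding smooth_at_def
proof (intro conjI ballI impI)
  show "p \<in> pts A" "g (f p) \<in> pts C" using assms(3,4) smooth_at_pts by metis+
  show "filterlim (\<lambda>q. g (f q)) (mnhds C (g (f p))) (mnhds A p)"
    by (rule filterlim_compose[OF smooth_at_filterlim[OF assms(4)] smooth_at_filterlim[OF assms(3)]])
  show "smooth_fn A (\<lambda>q. snd d (g (f q))) p" if "d \<in> C" "g (f p) \<in> fst d" for d
    by (rule smooth_fn_compose[OF assms(1-3) smooth_at_fn[OF assms(4) that]])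
qed

lemma smooth_at_eventually:
  assumes "smooth_atlas A" "smooth_atlas B" "smooth_at A B f p"
  shows "eventually (smooth_at A B f) (mnhds A p)"
proof -
  obtain d where d: "d \<in> B" "f p \<in> fst d" using assms(3) smooth_at_pts ptsE by metis
  have "eventually (\<lambda>q. f q \<in> fst d) (mnhds A p)"
    by (rule smooth_at_eventually_comp[OF assms(3) eventually_in_chart[OF assms(2) d]])
  from eventually_eventually_mnhds[OF assms(1) smooth_at_pts(1)[OF assms(3)] this] this
    smooth_fn_eventually[OF assms(1) smooth_at_fn[OF assms(3) d]]
  show ?thesis by eventually_elim (rule smooth_at_chartI[OF assms(1,2) d(1)])
qed

text \<open>Smoothness on an open set, although phrased with all pairs of charts and images of whole chart
  domains, is a condition on germs.\<close>

lemma smooth_on_open_iff: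
  assumes A: "smooth_atlas A" and B: "smooth_atlas B" and W: "mopen A W"
  shows "smooth_on_open A W B f \<longleftrightarrow> (\<forall>p\<in>W. smooth_at A B f p)"
proof (intro iffI ballI)
  fix p assume f: "smooth_on_open A W B f" and p: "p \<in> W"
  obtain c where c: "c \<in> A" "p \<in> fst c" using p W ptsE[of p A] unfolding mopen_def by blast
  obtain d where d: "d \<in> B" "f p \<in> fst d"
    using p f ptsE[of "f p" B] unfolding smooth_on_open_def by blast
  define D where "D = {x \<in> W \<inter> fst c. f x \<in> fst d}"
  have D: "open (snd c ` D)" "smooth_on (snd c ` D) (snd d \<circ> f \<circ> chart_inv c)"
    using f c(1) d(1) unfolding smooth_on_open_def D_def Let_def by blast+
  have pD: "snd c p \<in> snd c ` D" using c d p by (auto simp: D_def)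
  have DW: "D \<subseteq> fst c" by (auto simp: D_def)
  show "smooth_at A B f p"
  proof (rule smooth_at_chartI[where f = f and p = p, OF A B d])
    show "\<forall>\<^sub>F q in mnhds A p. f q \<in> fst d"
      unfolding eventually_mnhds_chart[OF A c]
      using eventually_nhds_in_open[OF D(1) pD]
      by eventually_elim (use DW in \<open>auto simp: chart_inv_chart[OF A c(1)] D_def\<close>)
    have "smooth_near ((\<lambda>q. snd d (f q)) \<circ> chart_inv c) (snd c p)"
      using smooth_nearI[OF D pD] by (simp add: o_def)
    then show "smooth_fn A (\<lambda>q. snd d (f q)) p" by (rule smooth_fn_chartI[OF A c])
  qed
next
  assume f: "\<forall>p\<in>W. smooth_at A B f p"
  show "smooth_on_open A W B f"
    unfolding smooth_on_open_def Let_def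
  proof (intro conjI ballI)
    show "f ` W \<subseteq> pts B" 
    proof (rule image_subsetI)
      fix p assume "p \<in> W"
      then show "f p \<in> pts B" using f smooth_at_pts(2)[of A B f p] by simp
    qed
    fix c d assume cd: "c \<in> A" "d \<in> B"
    define D where "D = {x \<in> W \<inter> fst c. f x \<in> fst d}"
    have "eventually (\<lambda>x. x \<in> snd c ` D) (nhds (snd c p))" "smooth_near (snd d \<circ> f \<circ> chart_inv c) (snd c p)"
      if p: "p \<in> D" for p
    proof -
      have c: "c \<in> A" "p \<in> fst c" and d: "f p \<in> fst d" and fp: "smooth_at A B f p" and pW: "p \<in> W"
        using p cd f by (auto simp: D_def)
      have "eventually (\<lambda>q. q \<in> D) (mnhds A p)"
        using eventually_mopen[OF A W pW] eventually_in_chart[OF A c]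
          smooth_at_eventually_comp[OF fp eventually_in_chart[OF B cd(2) d]]
        by eventually_elim (simp add: D_def)
      then have "eventually (\<lambda>x. chart_inv c x \<in> D) (nhds (snd c p))"
        by (simp add: eventually_mnhds_chart[OF A c])
      then show "eventually (\<lambda>x. x \<in> snd c ` D) (nhds (snd c p))"
        using eventually_nhds_chart[OF A c] by eventually_elim (metis chart_chart_inv imageI)
      show "smooth_near (snd d \<circ> f \<circ> chart_inv c) (snd c p)"
        using smooth_fnD[OF smooth_at_fn[OF fp cd(2) d] c] by (simp add: o_def)
    qed
    then have ev: "\<And>x. x \<in> snd c ` D \<Longrightarrow> eventually (\<lambda>y. y \<in> snd c ` D) (nhds x)"
      and sm: "\<And>x. x \<in> snd c ` D \<Longrightarrow> smooth_near (snd d \<circ> f \<circ> chart_inv c) x" by blast+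
    have "open (snd c ` D)" using ev by (subst open_subopen) (simp add: eventually_nhds subset_eq)
    moreover have "smooth_on (snd c ` D) (snd d \<circ> f \<circ> chart_inv c)" using sm by (rule smooth_on_local)
    ultimately have "open (snd c ` D)" "smooth_on (snd c ` D) (snd d \<circ> f \<circ> chart_inv c)" .
    then show "open (snd c ` {x \<in> W \<inter> fst c. f x \<in> fst d})"
      "smooth_on (snd c ` {x \<in> W \<inter> fst c. f x \<in> fst d}) (snd d \<circ> f \<circ> chart_inv c)"
      by (simp_all add: D_def)
  qed
qed

lemma local_ext_iff:
  assumes "smooth_atlas A" "smooth_atlas B" "p \<in> pts A"
  shows "local_ext A S B f p F \<longleftrightarrow> smooth_at A B F p \<and> eventually (\<lambda>q. q \<in> S \<longrightarrow> F q = f q) (mnhds A p)"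
    (is "?L \<longleftrightarrow> ?R")
proof
  assume ?L
  then obtain W where W: "mopen A W" "p \<in> W" "smooth_on_open A W B F" "\<forall>q\<in>S \<inter> W. F q = f q"
    by (auto simp: local_ext_def)
  then show ?R
    using smooth_on_open_iff[OF assms(1,2) W(1)] unfolding eventually_mnhds[OF assms(1,3)] by blast
next
  assume R: ?R
  then have "eventually (\<lambda>q. smooth_at A B F q \<and> (q \<in> S \<longrightarrow> F q = f q)) (mnhds A p)"
    using smooth_at_eventually[OF assms(1,2)] by (intro eventually_conj) simp_all
  then obtain W where W: "mopen A W" "p \<in> W" "\<And>q. q \<in> W \<Longrightarrow> smooth_at A B F q" "\<And>q. q \<in> W \<Longrightarrow> q \<in> S \<Longrightarrow> F q = f q"
    unfolding eventually_mnhds[OF assms(1,3)] by blast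
  then show ?L unfolding local_ext_def
    using smooth_on_open_iff[OF assms(1,2) W(1)] by blast
qed

lemma smooth_map_imp_smooth_at:
  assumes "smooth_atlas A" "smooth_atlas B" "mopen A W" "smooth_map A W B f" "p \<in> W"
  shows "smooth_at A B f p"
proof -
  have p: "p \<in> pts A" using assms(3,5) by (auto simp: mopen_def)
  obtain F where "local_ext A W B f p F" using assms(4,5) by (auto simp: smooth_map_def)
  then have F: "smooth_at A B F p" "eventually (\<lambda>q. q \<in> W \<longrightarrow> F q = f q) (mnhds A p)"
    using local_ext_iff[OF assms(1,2) p] by auto
  have "eventually (\<lambda>q. F q = f q) (mnhds A p)"
    using F(2) eventually_mopen[OF assms(1,3,5)] by eventually_elim simp
  then show ?thesis by (rule smooth_at_cong[OF assms(1,2) F(1)])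
qed

lemma smooth_mapI:
  assumes "smooth_atlas A" "smooth_atlas B" "\<And>p. p \<in> S \<Longrightarrow> smooth_at A B f p"
  shows "smooth_map A S B f"
  unfolding smooth_map_def
proof
  fix p assume "p \<in> S"
  then have "smooth_at A B f p" by (rule assms(3))
  then have "local_ext A S B f p f" using local_ext_iff[OF assms(1,2), of p S f f] smooth_at_pts(1)[of A B f p] by simp
  then show "\<exists>F. local_ext A S B f p F" by blast
qed

section \<open>Velocities of curves\<close>

(* charts are pairs and should not be taken apart by the simplifier *)
declare split_paired_All [simp del] split_paired_Ex [simp del]

text \<open>The coordinates in one chart determine a tangent vector; \<open>r\<close> are its coordinates in the chart \<open>c\<close>.\<close>

definition tvec_of :: "('a, 'e::model_space) atlas \<Rightarrow> ('a, 'e) chart \<Rightarrow> 'a \<Rightarrow> 'e \<Rightarrow> ('a, 'e) tvec" where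
  "tvec_of A c p r = (\<lambda>d. if d \<in> A \<and> p \<in> fst d
     then frechet_derivative (snd d \<circ> chart_inv c) (at (snd c p)) r else 0)"

text \<open>Tangent vectors are handled as velocities at parameter 0 of curves that need only be
  differentiable there. Every differential then amounts to composing curves, and identities between
  maps on a submanifold can be differentiated by applying them to curves in the submanifold.\<close>

definition has_vel :: "('a, 'e::model_space) atlas \<Rightarrow> (real \<Rightarrow> 'a) \<Rightarrow> ('a, 'e) tvec \<Rightarrow> bool" where
  "has_vel A \<gamma> v \<longleftrightarrow> \<gamma> 0 \<in> pts A \<and> filterlim \<gamma> (mnhds A (\<gamma> 0)) (nhds 0) \<and>
     (\<forall>c. if c \<in> A \<and> \<gamma> 0 \<in> fst c then ((\<lambda>s. snd c (\<gamma> s)) has_vector_derivative v c) (at 0) else v c = 0)"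

lemma has_velD:
  assumes "has_vel A \<gamma> v"
  shows "\<gamma> 0 \<in> pts A" "filterlim \<gamma> (mnhds A (\<gamma> 0)) (nhds 0)"
    "c \<in> A \<Longrightarrow> \<gamma> 0 \<in> fst c \<Longrightarrow> ((\<lambda>s. snd c (\<gamma> s)) has_vector_derivative v c) (at 0)"
    "\<not> (c \<in> A \<and> \<gamma> 0 \<in> fst c) \<Longrightarrow> v c = 0"
  using assms unfolding has_vel_def by (auto dest: spec[of _ c])

lemma has_vel_eventually:
  assumes "has_vel A \<gamma> v" "eventually P (mnhds A (\<gamma> 0))"
  shows "eventually (\<lambda>s. P (\<gamma> s)) (nhds 0)"
  using has_velD(2)[OF assms(1)] assms(2) unfolding filterlim_iff by blast

lemma has_vector_derivative_compose_at:
  assumes "(g has_derivative g') (at (f x))" "(f has_vector_derivative v) (at x)"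
  shows "((\<lambda>s. g (f s)) has_vector_derivative g' v) (at x)"
proof -
  have "(g \<circ> f has_derivative g' \<circ> (\<lambda>s. s *\<^sub>R v)) (at x)"
    using diff_chain_at[of f "\<lambda>s. s *\<^sub>R v" x g g'] assms by (simp add: has_vector_derivative_def)
  moreover have "g' \<circ> (\<lambda>s. s *\<^sub>R v) = (\<lambda>s. s *\<^sub>R g' v)"
    using linear_scale[OF has_derivative_linear[OF assms(1)]] by (simp add: fun_eq_iff)
  ultimately show ?thesis by (simp add: has_vector_derivative_def o_def)
qed

lemma has_vector_derivative_cong_at:
  assumes "(f has_vector_derivative v) (at x)" "eventually (\<lambda>s. f s = g s) (nhds x)"
  shows "(g has_vector_derivative v) (at x)"
proof -
  obtain S where "open S" "x \<in> S" "\<And>s. s \<in> S \<Longrightarrow> f s = g s" using assms(2) unfolding eventually_nhds by blast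
  then show ?thesis using assms(1) has_vector_derivative_transform_within_open by blast
qed

lemma smooth_fn_has_vector_derivative:
  assumes A: "smooth_atlas A" and v: "has_vel A \<gamma> v" and \<phi>: "smooth_fn A \<phi> (\<gamma> 0)"
    and c: "c \<in> A" "\<gamma> 0 \<in> fst c"
  shows "((\<lambda>s. \<phi> (\<gamma> s)) has_vector_derivative frechet_derivative (\<phi> \<circ> chart_inv c) (at (snd c (\<gamma> 0))) (v c)) (at 0)"
proof -
  have "((\<lambda>s. (\<phi> \<circ> chart_inv c) (snd c (\<gamma> s))) has_vector_derivative
      frechet_derivative (\<phi> \<circ> chart_inv c) (at (snd c (\<gamma> 0))) (v c)) (at 0)"
    by (rule has_vector_derivative_compose_at[OF smooth_near_has_derivative[OF smooth_fnD[OF \<phi> c]] has_velD(3)[OF v c]])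
  moreover have "eventually (\<lambda>s. (\<phi> \<circ> chart_inv c) (snd c (\<gamma> s)) = \<phi> (\<gamma> s)) (nhds 0)"
    using has_vel_eventually[OF v eventually_in_chart[OF A c]]
    by eventually_elim (simp add: chart_inv_chart[OF A c(1)])
  ultimately show ?thesis by (rule has_vector_derivative_cong_at)
qed

lemma has_vel_unique:
  assumes "has_vel A \<gamma> u" "has_vel A \<gamma> v"
  shows "u = v"
proof
  fix c
  show "u c = v c"
  proof (cases "c \<in> A \<and> \<gamma> 0 \<in> fst c")
    case True
    then show ?thesis
      using vector_derivative_unique_at[OF has_velD(3)[OF assms(1), of c] has_velD(3)[OF assms(2), of c]] by simp
  next
    case False
    then show ?thesis using has_velD(4)[OF assms(1), of c] has_velD(4)[OF assms(2), of c] by simp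
  qed
qed

lemma has_vel_cong:
  assumes v: "has_vel A \<gamma> v" and ev: "eventually (\<lambda>s. \<gamma> s = \<delta> s) (nhds 0)"
  shows "has_vel A \<delta> v"
proof -
  have 0: "\<gamma> 0 = \<delta> 0" using eventually_nhds_x_imp_x[OF ev] .
  have "filterlim \<delta> (mnhds A (\<gamma> 0)) (nhds 0)"
    using filterlim_cong[OF refl refl ev] has_velD(2)[OF v] by blast
  moreover have "((\<lambda>s. snd c (\<delta> s)) has_vector_derivative v c) (at 0)" if c: "c \<in> A" "\<gamma> 0 \<in> fst c" for c
    by (rule has_vector_derivative_cong_at[OF has_velD(3)[OF v c]]) (use ev in \<open>eventually_elim, simp\<close>)
  ultimately show ?thesis using has_velD[OF v] by (simp add: has_vel_def 0)
qed

lemma tvec_of_transition: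
  assumes A: "smooth_atlas A" and c: "c \<in> A" "p \<in> fst c" and d: "d \<in> A" "p \<in> fst d"
    and \<gamma>: "\<gamma> 0 = p" "eventually (\<lambda>s. \<gamma> s \<in> fst c) (nhds 0)"
    and r: "((\<lambda>s. snd c (\<gamma> s)) has_vector_derivative r) (at 0)"
  shows "((\<lambda>s. snd d (\<gamma> s)) has_vector_derivative frechet_derivative (snd d \<circ> chart_inv c) (at (snd c p)) r) (at 0)"
proof -
  have "((snd d \<circ> chart_inv c) has_derivative frechet_derivative (snd d \<circ> chart_inv c) (at (snd c p))) (at (snd c (\<gamma> 0)))"
    using smooth_near_has_derivative[OF transition_smooth_near[OF A c(1) d(1) c(2) d(2)]] \<gamma>(1) by simp
  from has_vector_derivative_compose_at[where f = "\<lambda>s. snd c (\<gamma> s)", OF this r]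
  have "((\<lambda>s. (snd d \<circ> chart_inv c) (snd c (\<gamma> s))) has_vector_derivative
      frechet_derivative (snd d \<circ> chart_inv c) (at (snd c p)) r) (at 0)" .
  moreover have "eventually (\<lambda>s. (snd d \<circ> chart_inv c) (snd c (\<gamma> s)) = snd d (\<gamma> s)) (nhds 0)"
    using \<gamma>(2) by eventually_elim (simp add: chart_inv_chart[OF A c(1)])
  ultimately show ?thesis by (rule has_vector_derivative_cong_at)
qed

lemma has_vel_chartI:
  assumes A: "smooth_atlas A" and c: "c \<in> A" "\<gamma> 0 \<in> fst c"
    and ev: "eventually (\<lambda>s. \<gamma> s \<in> fst c) (nhds 0)"
    and r: "((\<lambda>s. snd c (\<gamma> s)) has_vector_derivative r) (at 0)"
  shows "has_vel A \<gamma> (tvec_of A c (\<gamma> 0) r)"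
proof -
  have "isCont (\<lambda>s. snd c (\<gamma> s)) 0" using r by (rule has_vector_derivative_continuous)
  then have "filterlim (\<lambda>s. snd c (\<gamma> s)) (nhds (snd c (\<gamma> 0))) (nhds 0)"
    using tendsto_at_iff_tendsto_nhds[of "\<lambda>s. snd c (\<gamma> s)" 0] by (simp add: isCont_def)
  then have "filterlim \<gamma> (mnhds A (\<gamma> 0)) (nhds 0)"
    by (rule filterlim_mnhds_chart[where f = \<gamma> and p = 0, OF A c ev])
  then show ?thesis
    using chart_subset_pts[OF c] tvec_of_transition[where \<gamma> = \<gamma>, OF A c _ _ refl ev r] by (simp add: has_vel_def tvec_of_def)
qed

lemma tvec_of_self: 
  assumes A: "smooth_atlas A" and c: "c \<in> A" "p \<in> fst c"
  shows "tvec_of A c p r c = r"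
proof -
  have "((\<lambda>x. x) has_derivative (\<lambda>x. x)) (at (snd c p))" by (rule has_derivative_ident)
  then have "((snd c \<circ> chart_inv c) has_derivative (\<lambda>x. x)) (at (snd c p))"
    using has_derivative_transform_within_open[of "\<lambda>x. x" "\<lambda>x. x" "snd c p" UNIV "snd c ` fst c" "snd c \<circ> chart_inv c"]
      chart_open[OF A c(1)] c(2) by (simp add: chart_chart_inv)
  then have "(\<lambda>x. x) = frechet_derivative (snd c \<circ> chart_inv c) (at (snd c p))"
    by (rule frechet_derivative_at)
  then show ?thesis using c by (simp add: tvec_of_def fun_eq_iff)
qed

lemma curve_with_vel:
  assumes A: "smooth_atlas A" and c: "c \<in> A" "p \<in> fst c"
  shows "\<exists>\<gamma>. \<gamma> 0 = p \<and> has_vel A \<gamma> (tvec_of A c p r)"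
proof -
  define \<gamma> where "\<gamma> s = chart_inv c (snd c p + s *\<^sub>R r)" for s
  have 0: "\<gamma> 0 = p" by (simp add: \<gamma>_def chart_inv_chart[OF A c])
  have d: "((\<lambda>s. snd c p + s *\<^sub>R r) has_vector_derivative r) (at 0)"
    by (auto intro!: derivative_eq_intros)
  then have "isCont (\<lambda>s. snd c p + s *\<^sub>R r) 0" by (rule has_vector_derivative_continuous)
  then have "filterlim (\<lambda>s. snd c p + s *\<^sub>R r) (nhds (snd c p)) (nhds 0)"
    using tendsto_at_iff_tendsto_nhds[of "\<lambda>s. snd c p + s *\<^sub>R r" 0] by (simp add: isCont_def)
  then have ev: "eventually (\<lambda>s. snd c p + s *\<^sub>R r \<in> snd c ` fst c) (nhds 0)"
    using eventually_nhds_chart[OF A c] unfolding filterlim_iff by blast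
  then have ev': "eventually (\<lambda>s. \<gamma> s \<in> fst c) (nhds 0)" 
    unfolding \<gamma>_def by eventually_elim (rule chart_inv_in)
  have "((\<lambda>s. snd c (\<gamma> s)) has_vector_derivative r) (at 0)"
    by (rule has_vector_derivative_cong_at[OF d])
       (use ev in \<open>unfold \<gamma>_def, eventually_elim, simp add: chart_chart_inv\<close>)
  from has_vel_chartI[where \<gamma> = \<gamma>, OF A c(1) _ ev' this] show ?thesis using 0 c(2) by auto
qed

lemma has_vel_tspace:
  assumes A: "smooth_atlas A" and v: "has_vel A \<gamma> v"
  shows "v \<in> tspace A (\<gamma> 0)"
  unfolding tspace_def
proof (intro CollectI conjI allI ballI impI)
  show "v c = 0" if "c \<notin> A \<or> \<gamma> 0 \<notin> fst c" for c using has_velD(4)[OF v, of c] that by blast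
  fix c d assume c: "c \<in> A" and d: "d \<in> A" and pc: "\<gamma> 0 \<in> fst c" and pd: "\<gamma> 0 \<in> fst d"
  have "((\<lambda>s. snd d (\<gamma> s)) has_vector_derivative frechet_derivative (snd d \<circ> chart_inv c) (at (snd c (\<gamma> 0))) (v c)) (at 0)"
    by (rule tvec_of_transition[where \<gamma> = \<gamma>, OF A c pc d pd refl has_vel_eventually[OF v eventually_in_chart[OF A c pc]] has_velD(3)[OF v c pc]])
  then show "v d = frechet_derivative (snd d \<circ> chart_inv c) (at (snd c (\<gamma> 0))) (v c)"
    by (rule vector_derivative_unique_at[OF has_velD(3)[OF v d pd]])
qed

lemma tspace_eq_tvec_of:
  assumes "v \<in> tspace A p" "c \<in> A" "p \<in> fst c"
  shows "v = tvec_of A c p (v c)"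
proof
  fix d
  have "v d = (if d \<in> A \<and> p \<in> fst d then frechet_derivative (snd d \<circ> chart_inv c) (at (snd c p)) (v c) else 0)"
  proof (cases "d \<in> A \<and> p \<in> fst d")
    case True
    then have "v d = frechet_derivative (snd d \<circ> chart_inv c) (at (snd c p)) (v c)"
      using assms unfolding tspace_def by blast
    then show ?thesis using True by simp
  next
    case False
    then have "v d = 0" using assms(1) unfolding tspace_def by blast
    then show ?thesis by (simp only: if_not_P[OF False])
  qed
  then show "v d = tvec_of A c p (v c) d" by (simp only: tvec_of_def)
qed

lemma tvec_of_in_tspace:
  assumes "smooth_atlas A" "c \<in> A" "p \<in> fst c"
  shows "tvec_of A c p r \<in> tspace A p"
proof -
  obtain \<gamma> where "\<gamma> 0 = p" "has_vel A \<gamma> (tvec_of A c p r)" using curve_with_vel[OF assms, of r] by blast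
  then show ?thesis using has_vel_tspace[OF assms(1), of \<gamma>] by simp
qed

lemma tspace_curve:
  assumes "smooth_atlas A" "p \<in> pts A" "v \<in> tspace A p"
  shows "\<exists>\<gamma>. \<gamma> 0 = p \<and> has_vel A \<gamma> v"
proof -
  obtain c where "c \<in> A" "p \<in> fst c" using ptsE[OF assms(2)] by blast
  then show ?thesis using curve_with_vel[OF assms(1), of c p "v c"] tspace_eq_tvec_of[OF assms(3), of c] by metis
qed

lemma tspace_eqI:
  assumes "u \<in> tspace A p" "v \<in> tspace A p" "c \<in> A" "p \<in> fst c" "u c = v c"
  shows "u = v"
  using tspace_eq_tvec_of[OF assms(1,3,4)] tspace_eq_tvec_of[OF assms(2,3,4)] assms(5) by metis

lemma has_vel_differential:
  assumes A: "smooth_atlas A" and B: "smooth_atlas B" and v: "has_vel A \<gamma> v" and f: "smooth_at A B f (\<gamma> 0)"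
  shows "has_vel B (\<lambda>s. f (\<gamma> s)) (differential A B f (\<gamma> 0) v)"
  unfolding has_vel_def
proof (intro conjI allI)
  show "f (\<gamma> 0) \<in> pts B" using f by (rule smooth_at_pts)
  show "filterlim (\<lambda>s. f (\<gamma> s)) (mnhds B (f (\<gamma> 0))) (nhds 0)"
    by (rule filterlim_compose[OF smooth_at_filterlim[OF f] has_velD(2)[OF v]])
  fix d
  define c where "c = (SOME c. c \<in> A \<and> \<gamma> 0 \<in> fst c)"
  have c: "c \<in> A" "\<gamma> 0 \<in> fst c"
    using someI_ex[of "\<lambda>c. c \<in> A \<and> \<gamma> 0 \<in> fst c"] ptsE[OF has_velD(1)[OF v]] unfolding c_def by blast+
  have "((\<lambda>s. snd d (f (\<gamma> s))) has_vector_derivative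
      frechet_derivative (snd d \<circ> f \<circ> chart_inv c) (at (snd c (\<gamma> 0))) (v c)) (at 0)"
    if d: "d \<in> B" "f (\<gamma> 0) \<in> fst d"
    using smooth_fn_has_vector_derivative[OF A v smooth_at_fn[OF f d] c] by (simp add: o_def)
  then show "if d \<in> B \<and> f (\<gamma> 0) \<in> fst d
      then ((\<lambda>s. snd d (f (\<gamma> s))) has_vector_derivative differential A B f (\<gamma> 0) v d) (at 0)
      else differential A B f (\<gamma> 0) v d = 0"
    by (simp add: differential_def c_def[symmetric] Let_def)
qed

lemma differential_in_tspace:
  assumes "smooth_atlas A" "smooth_atlas B" "smooth_at A B f p" "v \<in> tspace A p"
  shows "differential A B f p v \<in> tspace B (f p)"
proof -
  obtain \<gamma> where \<gamma>: "\<gamma> 0 = p" "has_vel A \<gamma> v"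
    using tspace_curve[OF assms(1) smooth_at_pts(1)[OF assms(3)] assms(4)] by blast
  have "has_vel B (\<lambda>s. f (\<gamma> s)) (differential A B f (\<gamma> 0) v)"
    by (rule has_vel_differential[OF assms(1,2) \<gamma>(2)]) (use assms(3) \<gamma> in simp)
  from has_vel_tspace[OF assms(2) this] show ?thesis using \<gamma>(1) by simp
qed

lemma differential_chart:
  assumes A: "smooth_atlas A" and B: "smooth_atlas B" and f: "smooth_at A B f p" and v: "v \<in> tspace A p"
    and c: "c \<in> A" "p \<in> fst c" and d: "d \<in> B" "f p \<in> fst d"
  shows "differential A B f p v d = frechet_derivative (\<lambda>x. snd d (f (chart_inv c x))) (at (snd c p)) (v c)"
proof -
  obtain \<gamma> where \<gamma>: "\<gamma> 0 = p" "has_vel A \<gamma> v" using tspace_curve[OF A smooth_at_pts(1)[OF f] v] by blast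
  have "((\<lambda>s. snd d (f (\<gamma> s))) has_vector_derivative frechet_derivative ((\<lambda>q. snd d (f q)) \<circ> chart_inv c) (at (snd c p)) (v c)) (at 0)"
    using smooth_fn_has_vector_derivative[OF A \<gamma>(2), of "\<lambda>q. snd d (f q)" c] smooth_at_fn[OF f d] c \<gamma>(1) by simp
  moreover have "has_vel B (\<lambda>s. f (\<gamma> s)) (differential A B f (\<gamma> 0) v)"
    by (rule has_vel_differential[OF A B \<gamma>(2)]) (use f \<gamma> in simp)
  then have "((\<lambda>s. snd d (f (\<gamma> s))) has_vector_derivative differential A B f p v d) (at 0)"
    using has_velD(3)[of B "\<lambda>s. f (\<gamma> s)" "differential A B f (\<gamma> 0) v" d] \<gamma>(1) d by simp
  ultimately show ?thesis unfolding o_def by (rule vector_derivative_unique_at[THEN sym])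
qed

lemma linear_differential:
  assumes A: "smooth_atlas A" and B: "smooth_atlas B" and f: "smooth_at A B f p"
  shows "linear (differential A B f p)"
proof -
  define c where "c = (SOME c. c \<in> A \<and> p \<in> fst c)"
  have c: "c \<in> A" "p \<in> fst c"
    using someI_ex[of "\<lambda>c. c \<in> A \<and> p \<in> fst c"] ptsE[OF smooth_at_pts(1)[OF f]] unfolding c_def by blast+
  have l: "linear (frechet_derivative (snd d \<circ> f \<circ> chart_inv c) (at (snd c p)))" if d: "d \<in> B" "f p \<in> fst d" for d
    using smooth_near_linear_derivative[OF smooth_fnD[OF smooth_at_fn[OF f d] c]] by (simp add: o_def)
  show ?thesis
    by (rule linearI)
       (auto simp: differential_def c_def[symmetric] Let_def fun_eq_iff plus_fun_def scaleR_fun_def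
          linear_add[OF l] linear_scale[OF l])
qed

lemma tvec_of_linear:
  assumes "smooth_atlas A" "c \<in> A" "p \<in> fst c"
  shows "linear (tvec_of A c p)"
proof -
  have l: "linear (frechet_derivative (snd d \<circ> chart_inv c) (at (snd c p)))" if "d \<in> A" "p \<in> fst d" for d
    by (rule smooth_near_linear_derivative[OF transition_smooth_near[OF assms(1,2) that(1) assms(3) that(2)]])
  show ?thesis
    by (rule linearI)
       (auto simp: tvec_of_def fun_eq_iff plus_fun_def scaleR_fun_def linear_add[OF l] linear_scale[OF l])
qed

lemma subspace_tspace:
  assumes "smooth_atlas A" "p \<in> pts A"
  shows "subspace (tspace A p)"
proof -
  obtain c where c: "c \<in> A" "p \<in> fst c" using ptsE[OF assms(2)] by blast
  have "tspace A p = range (tvec_of A c p)"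
  proof
    show "tspace A p \<subseteq> range (tvec_of A c p)"
      using tspace_eq_tvec_of[OF _ c] by (intro subsetI) (metis rangeI)
    show "range (tvec_of A c p) \<subseteq> tspace A p"
      by (intro image_subsetI tvec_of_in_tspace[OF assms(1) c])
  qed
  then show ?thesis using linear_subspace_image[OF tvec_of_linear[OF assms(1) c] subspace_UNIV] by simp
qed

lemma local_ext_some:
  assumes "smooth_atlas A" "smooth_atlas B" "smooth_map A S B f" "p \<in> S" "p \<in> pts A"
  shows "smooth_at A B (SOME F. local_ext A S B f p F) p"
    "eventually (\<lambda>q. q \<in> S \<longrightarrow> (SOME F. local_ext A S B f p F) q = f q) (mnhds A p)"
    "(SOME F. local_ext A S B f p F) p = f p"
proof -
  have "local_ext A S B f p (SOME F. local_ext A S B f p F)"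
    using assms(3,4) unfolding smooth_map_def by (metis someI)
  then show *: "smooth_at A B (SOME F. local_ext A S B f p F) p"
    "eventually (\<lambda>q. q \<in> S \<longrightarrow> (SOME F. local_ext A S B f p F) q = f q) (mnhds A p)"
    unfolding local_ext_iff[OF assms(1,2,5)] by simp_all
  show "(SOME F. local_ext A S B f p F) p = f p"
    using eventually_mnhds_imp[OF assms(1,5) *(2)] assms(4) by simp
qed

text \<open>A local extension enters only through its values along the curve, where it agrees with \<open>f\<close>. So
  the choice of the extension in the definition of the differential on a subset is immaterial for
  velocities of curves in the subset.\<close>

lemma has_vel_differential_on:
  assumes A: "smooth_atlas A" and B: "smooth_atlas B" and f: "smooth_map A S B f"
    and v: "has_vel A \<gamma> v" and S: "eventually (\<lambda>s. \<gamma> s \<in> S) (nhds 0)"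
  shows "has_vel B (\<lambda>s. f (\<gamma> s)) (differential_on A S B f (\<gamma> 0) v)"
proof -
  define F where "F = (SOME F. local_ext A S B f (\<gamma> 0) F)"
  have S0: "\<gamma> 0 \<in> S" using eventually_nhds_x_imp_x[OF S] .
  note F = local_ext_some[OF A B f S0 has_velD(1)[OF v], folded F_def]
  have "has_vel B (\<lambda>s. F (\<gamma> s)) (differential A B F (\<gamma> 0) v)"
    by (rule has_vel_differential[OF A B v F(1)])
  moreover have "eventually (\<lambda>s. F (\<gamma> s) = f (\<gamma> s)) (nhds 0)"
    using has_vel_eventually[OF v F(2)] S by eventually_elim simp
  ultimately show ?thesis unfolding differential_on_def F_def[symmetric] by (rule has_vel_cong)
qed

lemma linear_differential_on:
  assumes "smooth_atlas A" "smooth_atlas B" "smooth_map A S B f" "p \<in> S" "p \<in> pts A"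
  shows "linear (differential_on A S B f p)"
  unfolding differential_on_def
  by (rule linear_differential[OF assms(1,2) local_ext_some(1)[OF assms]])

lemma has_vel_const: 
  assumes A: "smooth_atlas A" and p: "p \<in> pts A"
  shows "has_vel A (\<lambda>s. p) 0"
proof -
  obtain c where c: "c \<in> A" "p \<in> fst c" using ptsE[OF p] by blast
  have "has_vel A (\<lambda>s. p) (tvec_of A c p 0)"
    by (rule has_vel_chartI[where \<gamma> = "\<lambda>s. p", OF A c]) (use c in auto)
  then show ?thesis using linear_0[OF tvec_of_linear[OF A c]] by simp
qed

lemma smooth_at_id: "smooth_atlas A \<Longrightarrow> p \<in> pts A \<Longrightarrow> smooth_at A A (\<lambda>q. q) p"
  unfolding smooth_at_def by (simp add: smooth_fn_chart filterlim_ident)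

lemma smooth_at_const: "smooth_atlas A \<Longrightarrow> smooth_atlas B \<Longrightarrow> p \<in> pts A \<Longrightarrow> b \<in> pts B \<Longrightarrow> smooth_at A B (\<lambda>q. b) p"
  using ptsE[of b B] smooth_at_chartI[where f = "\<lambda>q. b" and p = p and A = A and B = B]
    smooth_fn_const[of p A] by auto

subsection \<open>Lifting curves through submersions\<close>

lemma linear_right_inverse:
  fixes L :: "'a::real_vector \<Rightarrow> 'b::real_vector"
  assumes "linear L" "surj L"
  shows "\<exists>R. linear R \<and> (\<forall>z. L (R z) = z)"
proof -
  obtain R where "linear R" "L \<circ> R = id" using linear_surjective_right_inverse[OF assms] by blast
  then show ?thesis by (intro exI[of _ R]) (simp add: fun_eq_iff)
qed

text \<open>This covers curves in a fibre of \<open>f\<close> (constant \<open>\<eta>\<close>) as well as curves in a fibre product along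
  \<open>f\<close> (\<open>\<eta>\<close> the image of a given curve under the other map).\<close>

lemma curve_lift_submersion:
  assumes A: "smooth_atlas A" and B: "smooth_atlas B" and f: "smooth_at A B f p"
    and surj: "differential A B f p ` tspace A p = tspace B (f p)"
    and \<eta>: "has_vel B \<eta> (differential A B f p w)" "\<eta> 0 = f p" and w: "w \<in> tspace A p"
  shows "\<exists>\<gamma>. \<gamma> 0 = p \<and> has_vel A \<gamma> w \<and> eventually (\<lambda>s. f (\<gamma> s) = \<eta> s) (nhds 0)"
proof -
  obtain c where c: "c \<in> A" "p \<in> fst c" using ptsE[OF smooth_at_pts(1)[OF f]] by blast
  obtain d where d: "d \<in> B" "f p \<in> fst d" using ptsE[OF smooth_at_pts(2)[OF f]] by blast
  define \<Phi> where "\<Phi> x = snd d (f (chart_inv c x))" for x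
  define y0 where "y0 = snd c p"
  define \<Phi>' where "\<Phi>' = frechet_derivative \<Phi> (at y0)"
  have \<Phi>_near: "smooth_near \<Phi> y0"
    using smooth_fnD[OF smooth_at_fn[OF f d] c] by (simp add: o_def \<Phi>_def[abs_def] y0_def)
  note \<Phi>der = smooth_near_has_derivative[OF \<Phi>_near, folded \<Phi>'_def]
  have \<Phi>'_eq: "differential A B f p v d = \<Phi>' (v c)" if "v \<in> tspace A p" for v
    using differential_chart[OF A B f that c d] by (simp add: \<Phi>'_def \<Phi>_def[abs_def] y0_def)
  have "z \<in> range \<Phi>'" for z
  proof -
    have "tvec_of B d (f p) z \<in> differential A B f p ` tspace A p"
      unfolding surj by (rule tvec_of_in_tspace[OF B d])
    then obtain v where "v \<in> tspace A p" "tvec_of B d (f p) z = differential A B f p v" by blast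
    then show ?thesis using \<Phi>'_eq[of v] tvec_of_self[OF B d, of z] by (metis rangeI)
  qed
  then obtain R where R: "linear R" "\<And>z. \<Phi>' (R z) = z"
    using linear_right_inverse[OF has_derivative_linear[OF \<Phi>der]] by blast
  obtain U0 where U0: "open U0" "y0 \<in> U0" "smooth_on U0 \<Phi>" using \<Phi>_near by (auto simp: smooth_near_def)
  have "continuous_on U0 \<Phi>" using U0 C_diff_continuous unfolding smooth_on_def by blast
  moreover have "((\<lambda>s. snd d (\<eta> s)) has_vector_derivative \<Phi>' (w c)) (at 0)"
    using has_velD(3)[OF \<eta>(1), of d] \<eta>(2) d \<Phi>'_eq[OF w] by simp
  moreover have "snd d (\<eta> 0) = \<Phi> y0" using \<eta>(2) by (simp add: \<Phi>_def y0_def chart_inv_chart[OF A c])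
  ultimately obtain y where y: "y 0 = y0" "(y has_vector_derivative w c) (at 0)"
      "\<forall>\<^sub>F s in nhds 0. \<Phi> (y s) = snd d (\<eta> s)"
    using curve_lift[OF U0(1,2) _ \<Phi>der R, of "\<lambda>s. snd d (\<eta> s)" "w c"] by blast
  have "isCont y 0" using y(2) by (rule has_vector_derivative_continuous)
  then have yt: "filterlim y (nhds y0) (nhds 0)"
    using tendsto_at_iff_tendsto_nhds[of y 0] y(1) by (simp add: isCont_def)
  have ev1: "eventually (\<lambda>s. y s \<in> snd c ` fst c) (nhds 0)"
    using yt eventually_nhds_chart[OF A c] unfolding filterlim_iff y0_def by blast
  have "eventually (\<lambda>q. f q \<in> fst d) (mnhds A p)"
    by (rule smooth_at_eventually_comp[OF f eventually_in_chart[OF B d]])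
  then have "eventually (\<lambda>x. f (chart_inv c x) \<in> fst d) (nhds y0)"
    by (simp add: eventually_mnhds_chart[OF A c] y0_def)
  then have ev2: "eventually (\<lambda>s. f (chart_inv c (y s)) \<in> fst d) (nhds 0)"
    using yt unfolding filterlim_iff by blast
  have ev3: "eventually (\<lambda>s. \<eta> s \<in> fst d) (nhds 0)"
    using has_vel_eventually[OF \<eta>(1)] eventually_in_chart[OF B d] \<eta>(2) by simp
  define \<gamma> where "\<gamma> s = chart_inv c (y s)" for s
  have 0: "\<gamma> 0 = p" by (simp add: \<gamma>_def y(1) y0_def chart_inv_chart[OF A c])
  have "has_vel A \<gamma> (tvec_of A c (\<gamma> 0) (w c))"
  proof (rule has_vel_chartI[OF A c(1)])
    show "\<gamma> 0 \<in> fst c" using 0 c by simp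
    show "\<forall>\<^sub>F s in nhds 0. \<gamma> s \<in> fst c" using ev1 by eventually_elim (simp add: \<gamma>_def chart_inv_in)
    show "((\<lambda>s. snd c (\<gamma> s)) has_vector_derivative w c) (at 0)"
      by (rule has_vector_derivative_cong_at[OF y(2)])
         (use ev1 in \<open>eventually_elim, simp add: \<gamma>_def chart_chart_inv\<close>)
  qed
  then have "has_vel A \<gamma> w" using tspace_eq_tvec_of[OF w c] 0 by metis
  moreover have "eventually (\<lambda>s. f (\<gamma> s) = \<eta> s) (nhds 0)"
    using y(3) ev2 ev3
  proof eventually_elim
    case (elim s)
    then have "snd d (f (\<gamma> s)) = snd d (\<eta> s)" by (simp add: \<Phi>_def \<gamma>_def)
    then show ?case using elim chart_inv_chart[OF B d(1)] by (metis \<gamma>_def)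
  qed
  ultimately show ?thesis using 0 by blast
qed

section \<open>Products and tangent bundles\<close>

definition prod_chart :: "('a, 'e) chart \<Rightarrow> ('b, 'f) chart \<Rightarrow> ('a \<times> 'b, 'e \<times> 'f) chart" where
  "prod_chart c d = (fst c \<times> fst d, map_prod (snd c) (snd d))"

lemma prod_atlas_iff: "e \<in> prod_atlas A B \<longleftrightarrow> (\<exists>c\<in>A. \<exists>d\<in>B. e = prod_chart c d)"
  by (auto simp: prod_atlas_def prod_chart_def split: prod.splits)

lemma prod_chart_in: "c \<in> A \<Longrightarrow> d \<in> B \<Longrightarrow> prod_chart c d \<in> prod_atlas A B"
  by (auto simp: prod_atlas_iff)

lemma fst_prod_chart: "z \<in> fst (prod_chart c d) \<longleftrightarrow> fst z \<in> fst c \<and> snd z \<in> fst d"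
  by (cases z) (simp add: prod_chart_def)

lemma snd_prod_chart: "snd (prod_chart c d) z = (snd c (fst z), snd d (snd z))"
  by (cases z) (simp add: prod_chart_def)

lemma image_prod_chart: "snd (prod_chart c d) ` (S \<times> T) = (snd c ` S) \<times> (snd d ` T)"
  by (auto simp: snd_prod_chart image_iff)

lemma pts_prod: "pts (prod_atlas A B) = pts A \<times> pts B"
  by (auto simp: pts_def prod_atlas_def)

lemma prod_chart_inv:
  assumes A: "smooth_atlas A" and B: "smooth_atlas B" and c: "c \<in> A" and d: "d \<in> B"
    and x: "x \<in> snd c ` fst c" and y: "y \<in> snd d ` fst d"
  shows "chart_inv (prod_chart c d) (x, y) = (chart_inv c x, chart_inv d y)"
proof (rule inv_into_f_eq)
  show "inj_on (snd (prod_chart c d)) (fst (prod_chart c d))"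
    using A B c d unfolding smooth_atlas_def
    by (auto simp: prod_chart_def inj_on_def)
  show "(chart_inv c x, chart_inv d y) \<in> fst (prod_chart c d)"
    using x y by (simp add: fst_prod_chart chart_inv_in)
  show "snd (prod_chart c d) (chart_inv c x, chart_inv d y) = (x, y)"
    using x y by (simp add: snd_prod_chart chart_chart_inv)
qed

lemma smooth_near_map_prod:
  assumes "smooth_near f (fst z)" "smooth_near g (snd z)"
  shows "smooth_near (\<lambda>z. (f (fst z), g (snd z))) z"
  by (rule smooth_near_Pair[OF smooth_near_compose[where f = f and g = fst, OF assms(1) smooth_near_linear[OF linear_fst]]
        smooth_near_compose[where f = g and g = snd, OF assms(2) smooth_near_linear[OF linear_snd]]])

lemma smooth_atlas_prod:
  assumes A: "smooth_atlas A" and B: "smooth_atlas B"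
  shows "smooth_atlas (prod_atlas A B)"
proof -
  have 1: "inj_on (snd (prod_chart c d)) (fst (prod_chart c d))" "open (snd (prod_chart c d) ` fst (prod_chart c d))"
    if cd: "c \<in> A" "d \<in> B" for c d
  proof -
    have "inj_on (snd c) (fst c)" "inj_on (snd d) (fst d)" using A B cd by (simp_all add: smooth_atlas_def)
    then show "inj_on (snd (prod_chart c d)) (fst (prod_chart c d))"
      by (auto simp: prod_chart_def inj_on_def)
    have "snd (prod_chart c d) ` fst (prod_chart c d) = (snd c ` fst c) \<times> (snd d ` fst d)"
      using image_prod_chart[of c d "fst c" "fst d"] by (simp add: prod_chart_def)
    then show "open (snd (prod_chart c d) ` fst (prod_chart c d))"
      using chart_open[OF A cd(1)] chart_open[OF B cd(2)] by (simp add: open_Times)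
  qed
  have 2: "open (snd (prod_chart c d) ` (fst (prod_chart c d) \<inter> fst (prod_chart c' d')))"
    "smooth_on (snd (prod_chart c d) ` (fst (prod_chart c d) \<inter> fst (prod_chart c' d')))
       (snd (prod_chart c' d') \<circ> chart_inv (prod_chart c d))"
    if cd: "c \<in> A" "d \<in> B" "c' \<in> A" "d' \<in> B" for c d c' d'
  proof -
    let ?V = "(snd c ` (fst c \<inter> fst c')) \<times> (snd d ` (fst d \<inter> fst d'))"
    have "fst (prod_chart c d) \<inter> fst (prod_chart c' d') = (fst c \<inter> fst c') \<times> (fst d \<inter> fst d')"
      by (auto simp: prod_chart_def)
    then have V: "snd (prod_chart c d) ` (fst (prod_chart c d) \<inter> fst (prod_chart c' d')) = ?V"
      using image_prod_chart[of c d "fst c \<inter> fst c'" "fst d \<inter> fst d'"] by simp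
    have oV: "open ?V"
      using A B cd by (intro open_Times) (simp_all add: smooth_atlas_def)
    show "open (snd (prod_chart c d) ` (fst (prod_chart c d) \<inter> fst (prod_chart c' d')))" unfolding V by (rule oV)
    have "smooth_near (snd (prod_chart c' d') \<circ> chart_inv (prod_chart c d)) z" if z: "z \<in> ?V" for z
    proof -
      obtain p q where p: "p \<in> fst c" "p \<in> fst c'" "fst z = snd c p" and q: "q \<in> fst d" "q \<in> fst d'" "snd z = snd d q"
        using z unfolding mem_Times_iff by blast
      have "smooth_near (\<lambda>z. ((snd c' \<circ> chart_inv c) (fst z), (snd d' \<circ> chart_inv d) (snd z))) z"
        using transition_smooth_near[OF A cd(1,3) p(1,2)] transition_smooth_near[OF B cd(2,4) q(1,2)]
        by (intro smooth_near_map_prod) (simp_all only: p(3) q(3))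
      moreover have "eventually (\<lambda>z. z \<in> ?V) (nhds z)" using oV z by (rule eventually_nhds_in_open)
      then have "eventually (\<lambda>z. ((snd c' \<circ> chart_inv c) (fst z), (snd d' \<circ> chart_inv d) (snd z))
          = (snd (prod_chart c' d') \<circ> chart_inv (prod_chart c d)) z) (nhds z)"
      proof eventually_elim
        case (elim z)
        then have "fst z \<in> snd c ` fst c" "snd z \<in> snd d ` fst d" by auto
        from prod_chart_inv[OF A B cd(1,2) this]
        show ?case by (simp add: snd_prod_chart)
      qed
      ultimately show ?thesis by (rule smooth_near_cong)
    qed
    then show "smooth_on (snd (prod_chart c d) ` (fst (prod_chart c d) \<inter> fst (prod_chart c' d')))
       (snd (prod_chart c' d') \<circ> chart_inv (prod_chart c d))" unfolding V by (rule smooth_on_local)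
  qed
  show ?thesis
    unfolding smooth_atlas_def
  proof (intro conjI ballI)
    fix e assume "e \<in> prod_atlas A B"
    then obtain c d where "c \<in> A" "d \<in> B" "e = prod_chart c d" unfolding prod_atlas_iff by blast
    then show "inj_on (snd e) (fst e)" "open (snd e ` fst e)" using 1 by simp_all
    fix e' assume "e' \<in> prod_atlas A B"
    then obtain c' d' where "c' \<in> A" "d' \<in> B" "e' = prod_chart c' d'" unfolding prod_atlas_iff by blast
    then show "open (snd e ` (fst e \<inter> fst e'))" "smooth_on (snd e ` (fst e \<inter> fst e')) (snd e' \<circ> chart_inv e)"
      using 2 \<open>c \<in> A\<close> \<open>d \<in> B\<close> \<open>e = prod_chart c d\<close> by simp_all
  qed
qed

lemma smooth_at_fst:
  assumes A: "smooth_atlas A" and B: "smooth_atlas B" and z: "z \<in> pts (prod_atlas A B)"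
  shows "smooth_at (prod_atlas A B) A fst z"
proof -
  obtain c d where c: "c \<in> A" "fst z \<in> fst c" and d: "d \<in> B" "snd z \<in> fst d"
    using z ptsE[of "fst z" A] ptsE[of "snd z" B] by (auto simp: pts_prod)
  have e: "prod_chart c d \<in> prod_atlas A B" "z \<in> fst (prod_chart c d)"
    using c d by (simp_all add: prod_chart_in fst_prod_chart)
  note P = smooth_atlas_prod[OF A B]
  show ?thesis
  proof (rule smooth_at_chartI[where f = fst and p = z, OF P A c])
    show "\<forall>\<^sub>F q in mnhds (prod_atlas A B) z. fst q \<in> fst c"
      using eventually_in_chart[OF P e] by eventually_elim (simp add: fst_prod_chart)
    have "smooth_fn (prod_atlas A B) (\<lambda>q. fst (snd (prod_chart c d) q)) z"
      by (rule smooth_fn_compose_vec[OF smooth_near_linear[OF linear_fst] smooth_fn_chart[OF P e] P])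
    then show "smooth_fn (prod_atlas A B) (\<lambda>q. snd c (fst q)) z" by (simp add: snd_prod_chart)
  qed
qed

lemma smooth_at_snd:
  assumes A: "smooth_atlas A" and B: "smooth_atlas B" and z: "z \<in> pts (prod_atlas A B)"
  shows "smooth_at (prod_atlas A B) B snd z"
proof -
  obtain c d where c: "c \<in> A" "fst z \<in> fst c" and d: "d \<in> B" "snd z \<in> fst d"
    using z ptsE[of "fst z" A] ptsE[of "snd z" B] by (auto simp: pts_prod)
  have e: "prod_chart c d \<in> prod_atlas A B" "z \<in> fst (prod_chart c d)"
    using c d by (simp_all add: prod_chart_in fst_prod_chart)
  note P = smooth_atlas_prod[OF A B]
  show ?thesis
  proof (rule smooth_at_chartI[where f = snd and p = z, OF P B d])
    show "\<forall>\<^sub>F q in mnhds (prod_atlas A B) z. snd q \<in> fst d"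
      using eventually_in_chart[OF P e] by eventually_elim (simp add: fst_prod_chart)
    have "smooth_fn (prod_atlas A B) (\<lambda>q. snd (snd (prod_chart c d) q)) z"
      by (rule smooth_fn_compose_vec[OF smooth_near_linear[OF linear_snd] smooth_fn_chart[OF P e] P])
    then show "smooth_fn (prod_atlas A B) (\<lambda>q. snd d (snd q)) z" by (simp add: snd_prod_chart)
  qed
qed

lemma smooth_at_Pair:
  assumes Z: "smooth_atlas Z" and A: "smooth_atlas A" and B: "smooth_atlas B"
    and f: "smooth_at Z A f p" and g: "smooth_at Z B g p"
  shows "smooth_at Z (prod_atlas A B) (\<lambda>q. (f q, g q)) p"
proof -
  obtain c where c: "c \<in> A" "f p \<in> fst c" using ptsE[OF smooth_at_pts(2)[OF f]] by blast
  obtain d where d: "d \<in> B" "g p \<in> fst d" using ptsE[OF smooth_at_pts(2)[OF g]] by blast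
  show ?thesis
  proof (rule smooth_at_chartI[where f = "\<lambda>q. (f q, g q)" and p = p, OF Z smooth_atlas_prod[OF A B] prod_chart_in[OF c(1) d(1)]])
    show "(f p, g p) \<in> fst (prod_chart c d)" using c d by (simp add: fst_prod_chart)
    show "\<forall>\<^sub>F q in mnhds Z p. (f q, g q) \<in> fst (prod_chart c d)"
      using smooth_at_eventually_comp[OF f eventually_in_chart[OF A c]]
        smooth_at_eventually_comp[OF g eventually_in_chart[OF B d]]
      by eventually_elim (simp add: fst_prod_chart)
    show "smooth_fn Z (\<lambda>q. snd (prod_chart c d) (f q, g q)) p"
      using smooth_fn_Pair[OF smooth_at_fn[OF f c] smooth_at_fn[OF g d]] by (simp add: snd_prod_chart)
  qed
qed

lemma tpair_unique:
  assumes A: "smooth_atlas A" and B: "smooth_atlas B" and z: "z \<in> pts (prod_atlas A B)"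
    and w: "w \<in> tspace (prod_atlas A B) z" "w' \<in> tspace (prod_atlas A B) z"
    and "differential (prod_atlas A B) A fst z w = differential (prod_atlas A B) A fst z w'"
    and "differential (prod_atlas A B) B snd z w = differential (prod_atlas A B) B snd z w'"
  shows "w = w'"
proof -
  obtain c d where c: "c \<in> A" "fst z \<in> fst c" and d: "d \<in> B" "snd z \<in> fst d"
    using z ptsE[of "fst z" A] ptsE[of "snd z" B] by (auto simp: pts_prod)
  let ?e = "prod_chart c d"
  have e: "?e \<in> prod_atlas A B" "z \<in> fst ?e" using c d by (simp_all add: prod_chart_in fst_prod_chart)
  note P = smooth_atlas_prod[OF A B]
  have "w ?e = (differential (prod_atlas A B) A fst z w c, differential (prod_atlas A B) B snd z w d)"
    if w: "w \<in> tspace (prod_atlas A B) z" for w :: "('a \<times> 'c, 'b \<times> 'd) tvec"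
  proof -
    obtain \<zeta> where \<zeta>: "\<zeta> 0 = z" "has_vel (prod_atlas A B) \<zeta> w" using tspace_curve[OF P z w] by blast
    have D: "((\<lambda>s. snd ?e (\<zeta> s)) has_vector_derivative w ?e) (at 0)"
      using has_velD(3)[OF \<zeta>(2), of ?e] e \<zeta>(1) by simp
    have d1: "((\<lambda>s. snd c (fst (\<zeta> s))) has_vector_derivative fst (w ?e)) (at 0)"
      and d2: "((\<lambda>s. snd d (snd (\<zeta> s))) has_vector_derivative snd (w ?e)) (at 0)"
      using bounded_linear.has_vector_derivative[OF bounded_linear_fst D]
        bounded_linear.has_vector_derivative[OF bounded_linear_snd D] by (simp_all add: snd_prod_chart)
    have "has_vel A (\<lambda>s. fst (\<zeta> s)) (differential (prod_atlas A B) A fst (\<zeta> 0) w)"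
      by (rule has_vel_differential[OF P A \<zeta>(2)]) (simp add: \<zeta>(1) smooth_at_fst[OF A B z])
    then have e1: "((\<lambda>s. snd c (fst (\<zeta> s))) has_vector_derivative differential (prod_atlas A B) A fst z w c) (at 0)"
      using has_velD(3)[of A "\<lambda>s. fst (\<zeta> s)" _ c] c \<zeta>(1) by simp
    have "has_vel B (\<lambda>s. snd (\<zeta> s)) (differential (prod_atlas A B) B snd (\<zeta> 0) w)"
      by (rule has_vel_differential[OF P B \<zeta>(2)]) (simp add: \<zeta>(1) smooth_at_snd[OF A B z])
    then have e2: "((\<lambda>s. snd d (snd (\<zeta> s))) has_vector_derivative differential (prod_atlas A B) B snd z w d) (at 0)"
      using has_velD(3)[of B "\<lambda>s. snd (\<zeta> s)" _ d] d \<zeta>(1) by simp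
    show ?thesis
      using vector_derivative_unique_at[OF d1 e1] vector_derivative_unique_at[OF d2 e2] by (simp add: prod_eq_iff)
  qed
  from this[OF w(1)] this[OF w(2)] have "w ?e = w' ?e" using assms(6,7) by simp
  then show ?thesis by (rule tspace_eqI[OF w e])
qed

lemma tpair_eqI:
  assumes "smooth_atlas A" "smooth_atlas B" "z \<in> pts (prod_atlas A B)" "w \<in> tspace (prod_atlas A B) z"
    and "differential (prod_atlas A B) A fst z w = u" "differential (prod_atlas A B) B snd z w = v"
  shows "tpair A B z u v = w"
  unfolding tpair_def
  by (rule the_equality) (use assms tpair_unique[OF assms(1-3)] in auto)

lemma has_vel_tpair:
  assumes A: "smooth_atlas A" and B: "smooth_atlas B" and u: "has_vel A \<gamma> u" and v: "has_vel B \<delta> v"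
  shows "has_vel (prod_atlas A B) (\<lambda>s. (\<gamma> s, \<delta> s)) (tpair A B (\<gamma> 0, \<delta> 0) u v)"
proof -
  obtain c where c: "c \<in> A" "\<gamma> 0 \<in> fst c" using ptsE[OF has_velD(1)[OF u]] by blast
  obtain d where d: "d \<in> B" "\<delta> 0 \<in> fst d" using ptsE[OF has_velD(1)[OF v]] by blast
  note P = smooth_atlas_prod[OF A B]
  let ?\<zeta> = "\<lambda>s. (\<gamma> s, \<delta> s)" and ?e = "prod_chart c d"
  define w where "w = tvec_of (prod_atlas A B) ?e (?\<zeta> 0) (u c, v d)"
  have w: "has_vel (prod_atlas A B) ?\<zeta> w" unfolding w_def
  proof (rule has_vel_chartI[where \<gamma> = ?\<zeta>, OF P prod_chart_in[OF c(1) d(1)]])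
    show "(\<gamma> 0, \<delta> 0) \<in> fst ?e" using c d by (simp add: fst_prod_chart)
    show "\<forall>\<^sub>F s in nhds 0. (\<gamma> s, \<delta> s) \<in> fst ?e"
      using has_vel_eventually[OF u eventually_in_chart[OF A c]] has_vel_eventually[OF v eventually_in_chart[OF B d]]
      by eventually_elim (simp add: fst_prod_chart)
    show "((\<lambda>s. snd ?e (\<gamma> s, \<delta> s)) has_vector_derivative (u c, v d)) (at 0)"
      unfolding snd_prod_chart fst_conv snd_conv
      by (rule has_vector_derivative_Pair[OF has_velD(3)[OF u c] has_velD(3)[OF v d]])
  qed
  have z: "(\<gamma> 0, \<delta> 0) \<in> pts (prod_atlas A B)" using has_velD(1)[OF u] has_velD(1)[OF v] by (simp add: pts_prod)
  have "has_vel A (\<lambda>s. fst (?\<zeta> s)) (differential (prod_atlas A B) A fst (?\<zeta> 0) w)"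
    by (rule has_vel_differential[OF P A w smooth_at_fst[OF A B z]])
  then have 1: "differential (prod_atlas A B) A fst (?\<zeta> 0) w = u"
    by (rule has_vel_unique) (simp add: u)
  have "has_vel B (\<lambda>s. snd (?\<zeta> s)) (differential (prod_atlas A B) B snd (?\<zeta> 0) w)"
    by (rule has_vel_differential[OF P B w smooth_at_snd[OF A B z]])
  then have 2: "differential (prod_atlas A B) B snd (?\<zeta> 0) w = v"
    by (rule has_vel_unique) (simp add: v)
  have "tpair A B (\<gamma> 0, \<delta> 0) u v = w"
    using has_vel_tspace[OF P w] 1 2 by (intro tpair_eqI[OF A B z]) simp_all
  then show ?thesis using w by simp
qed

lemma tpair_spec:
  assumes A: "smooth_atlas A" and B: "smooth_atlas B" and p: "p \<in> pts A" and q: "q \<in> pts B"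
    and u: "u \<in> tspace A p" and v: "v \<in> tspace B q"
  shows "tpair A B (p, q) u v \<in> tspace (prod_atlas A B) (p, q)"
    "differential (prod_atlas A B) A fst (p, q) (tpair A B (p, q) u v) = u"
    "differential (prod_atlas A B) B snd (p, q) (tpair A B (p, q) u v) = v"
proof -
  obtain \<gamma> where \<gamma>: "\<gamma> 0 = p" "has_vel A \<gamma> u" using tspace_curve[OF A p u] by blast
  obtain \<delta> where \<delta>: "\<delta> 0 = q" "has_vel B \<delta> v" using tspace_curve[OF B q v] by blast
  note P = smooth_atlas_prod[OF A B]
  have z: "(p, q) \<in> pts (prod_atlas A B)" using p q by (simp add: pts_prod)
  have w: "has_vel (prod_atlas A B) (\<lambda>s. (\<gamma> s, \<delta> s)) (tpair A B (p, q) u v)"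
    using has_vel_tpair[OF A B \<gamma>(2) \<delta>(2)] \<gamma>(1) \<delta>(1) by simp
  then show "tpair A B (p, q) u v \<in> tspace (prod_atlas A B) (p, q)"
    using has_vel_tspace[OF P w] \<gamma>(1) \<delta>(1) by simp
  have "has_vel A (\<lambda>s. fst (\<gamma> s, \<delta> s)) (differential (prod_atlas A B) A fst (\<gamma> 0, \<delta> 0) (tpair A B (p, q) u v))"
    by (rule has_vel_differential[OF P A w]) (simp add: \<gamma>(1) \<delta>(1) smooth_at_fst[OF A B z])
  then show "differential (prod_atlas A B) A fst (p, q) (tpair A B (p, q) u v) = u"
    unfolding \<gamma>(1) \<delta>(1) by (rule has_vel_unique) (simp add: \<gamma>(2))
  have "has_vel B (\<lambda>s. snd (\<gamma> s, \<delta> s)) (differential (prod_atlas A B) B snd (\<gamma> 0, \<delta> 0) (tpair A B (p, q) u v))"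
    by (rule has_vel_differential[OF P B w]) (simp add: \<gamma>(1) \<delta>(1) smooth_at_snd[OF A B z])
  then show "differential (prod_atlas A B) B snd (p, q) (tpair A B (p, q) u v) = v"
    unfolding \<gamma>(1) \<delta>(1) by (rule has_vel_unique) (simp add: \<delta>(2))
qed

lemma tpair_add:
  assumes "smooth_atlas A" "smooth_atlas B" "p \<in> pts A" "q \<in> pts B"
    and "u \<in> tspace A p" "u' \<in> tspace A p" "v \<in> tspace B q" "v' \<in> tspace B q"
  shows "tpair A B (p, q) (u + u') (v + v') = tpair A B (p, q) u v + tpair A B (p, q) u' v'"
proof (rule tpair_eqI[OF assms(1,2)])
  show z: "(p, q) \<in> pts (prod_atlas A B)" using assms by (simp add: pts_prod)
  note P = smooth_atlas_prod[OF assms(1,2)]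
  note s = tpair_spec[OF assms(1-5,7)] tpair_spec[OF assms(1-4,6,8)]
  show "tpair A B (p, q) u v + tpair A B (p, q) u' v' \<in> tspace (prod_atlas A B) (p, q)"
    by (rule subspace_add[OF subspace_tspace[OF P z] s(1,4)])
  show "differential (prod_atlas A B) A fst (p, q) (tpair A B (p, q) u v + tpair A B (p, q) u' v') = u + u'"
    unfolding linear_add[OF linear_differential[OF P assms(1) smooth_at_fst[OF assms(1,2) z]]] s(2,5) ..
  show "differential (prod_atlas A B) B snd (p, q) (tpair A B (p, q) u v + tpair A B (p, q) u' v') = v + v'"
    unfolding linear_add[OF linear_differential[OF P assms(2) smooth_at_snd[OF assms(1,2) z]]] s(3,6) ..
qed

lemma smooth_at_partial:
  assumes A: "smooth_atlas A" and B: "smooth_atlas B" and G: "smooth_at (prod_atlas A B) C G (p, q)"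
  shows "smooth_at B C (\<lambda>y. G (p, y)) q"
proof -
  have pq: "p \<in> pts A" "q \<in> pts B" using smooth_at_pts(1)[OF G] by (simp_all add: pts_prod)
  have "smooth_at B (prod_atlas A B) (\<lambda>y. (p, y)) q"
    by (rule smooth_at_Pair[OF B A B smooth_at_const[OF B A pq(2,1)] smooth_at_id[OF B pq(2)]])
  from smooth_at_compose[where f = "\<lambda>y. (p, y)" and p = q, OF B smooth_atlas_prod[OF A B] this G] show ?thesis .
qed

text \<open>In charts the partial derivative of \<open>G\<close> is the total derivative applied to \<open>(0, r)\<close>, and the
  total derivative of a smooth map is smooth jointly in the point and the vector.\<close>

lemma smooth_fn_partial_differential:
  assumes Z: "smooth_atlas Z" and A: "smooth_atlas A" and B: "smooth_atlas B" and C: "smooth_atlas C"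
    and a: "smooth_at Z A a z0" and b: "smooth_at Z B b z0"
    and G: "smooth_at (prod_atlas A B) C G (a z0, b z0)"
    and d: "d \<in> B" "b z0 \<in> fst d" and e: "e \<in> C" "G (a z0, b z0) \<in> fst e"
    and v: "smooth_fn Z (\<lambda>z. v z d) z0" "eventually (\<lambda>z. v z \<in> tspace B (b z)) (mnhds Z z0)"
  shows "smooth_fn Z (\<lambda>z. differential B C (\<lambda>y. G (a z, y)) (b z) (v z) e) z0"
proof -
  obtain c where c: "c \<in> A" "a z0 \<in> fst c" using ptsE[OF smooth_at_pts(2)[OF a]] by blast
  note P = smooth_atlas_prod[OF A B]
  define \<Psi> where "\<Psi> = (\<lambda>q. snd e (G q)) \<circ> chart_inv (prod_chart c d)"
  define D where "D z = (snd c (a z), snd d (b z))" for z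
  have \<Psi>: "smooth_near \<Psi> (D z0)"
    using smooth_fnD[OF smooth_at_fn[where f = G and p = "(a z0, b z0)", OF G e] prod_chart_in[OF c(1) d(1)]] c(2) d(2)
    by (simp add: \<Psi>_def D_def fst_prod_chart snd_prod_chart)
  have Ds: "smooth_fn Z D z0"
    using smooth_fn_Pair[OF smooth_at_fn[OF a c] smooth_at_fn[OF b d]] by (simp add: D_def[abs_def])
  define L where "L y = frechet_derivative \<Psi> (at (fst y)) (0, snd y)" for y
  have "smooth_near L (D z0, v z0 d)" unfolding L_def[abs_def]
    by (rule smooth_near_derivative[where y = fst and v = "\<lambda>y. (0, snd y)"])
       (simp_all add: \<Psi> smooth_near_Pair smooth_near_const smooth_near_linear linear_fst linear_snd)
  then have "smooth_fn Z (\<lambda>z. L (D z, v z d)) z0"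
    by (rule smooth_fn_compose_vec[where \<phi> = "\<lambda>z. (D z, v z d)", OF _ smooth_fn_Pair[OF Ds v(1)] Z])
  moreover have "eventually (\<lambda>z. L (D z, v z d) = differential B C (\<lambda>y. G (a z, y)) (b z) (v z) e) (mnhds Z z0)"
  proof -
    note ab = smooth_at_Pair[OF Z A B a b]
    have 1: "eventually (\<lambda>z. smooth_near \<Psi> (D z)) (mnhds Z z0)"
      by (rule eventually_compose_filterlim[OF smooth_near_eventually[OF \<Psi>] smooth_fn_tendsto[OF Ds Z]])
    have 2: "eventually (\<lambda>z. smooth_at (prod_atlas A B) C G (a z, b z)) (mnhds Z z0)"
      by (rule smooth_at_eventually_comp[where f = "\<lambda>z. (a z, b z)" and p = z0, OF ab smooth_at_eventually[OF P C G]])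
    have 3: "eventually (\<lambda>z. G (a z, b z) \<in> fst e) (mnhds Z z0)"
      by (rule smooth_at_eventually_comp[where f = "\<lambda>z. (a z, b z)" and p = z0, OF ab
            smooth_at_eventually_comp[where f = G and p = "(a z0, b z0)", OF G eventually_in_chart[OF C e]]])
    show ?thesis
      using 1 2 3 v(2) smooth_at_eventually_comp[OF a eventually_in_chart[OF A c]]
        smooth_at_eventually_comp[OF b eventually_in_chart[OF B d]]
    proof eventually_elim
      case (elim z)
      have "(\<Psi> has_derivative frechet_derivative \<Psi> (at (D z))) (at (snd c (a z), snd d (b z)))"
        using smooth_near_has_derivative[OF elim(1)] by (simp add: D_def)
      moreover have "((\<lambda>y. (snd c (a z), y)) has_derivative (\<lambda>r. (0, r))) (at (snd d (b z)))"
        by (intro has_derivative_Pair has_derivative_const has_derivative_ident)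
      ultimately have "((\<lambda>y. \<Psi> (snd c (a z), y)) has_derivative (\<lambda>r. frechet_derivative \<Psi> (at (D z)) (0, r))) (at (snd d (b z)))"
        using diff_chain_at[of "\<lambda>y. (snd c (a z), y)" "\<lambda>r. (0, r)" "snd d (b z)" \<Psi>] by (simp add: o_def)
      then have "((\<lambda>y. snd e (G (a z, chart_inv d y))) has_derivative (\<lambda>r. frechet_derivative \<Psi> (at (D z)) (0, r))) (at (snd d (b z)))"
      proof (rule has_derivative_transform_within_open)
        show "open (snd d ` fst d)" by (rule chart_open[OF B d(1)])
        show "snd d (b z) \<in> snd d ` fst d" using elim(6) by (rule imageI)
        show "\<Psi> (snd c (a z), y) = snd e (G (a z, chart_inv d y))" if "y \<in> snd d ` fst d" for y
          using prod_chart_inv[OF A B c(1) d(1) _ that, of "snd c (a z)"] elim(5) chart_inv_chart[OF A c(1)]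
          by (simp add: \<Psi>_def)
      qed
      from frechet_derivative_at[OF this]
      have "frechet_derivative (\<lambda>y. snd e (G (a z, chart_inv d y))) (at (snd d (b z))) (v z d) = L (D z, v z d)"
        by (simp add: L_def fun_eq_iff)
      moreover have "differential B C (\<lambda>y. G (a z, y)) (b z) (v z) e
          = frechet_derivative (\<lambda>y. snd e (G (a z, chart_inv d y))) (at (snd d (b z))) (v z d)"
        by (rule differential_chart[OF B C smooth_at_partial[OF A B elim(2)] elim(4) d(1) elim(6) e(1) elim(3)])
      ultimately show ?case by simp
    qed
  qed
  ultimately show ?thesis by (rule smooth_fn_cong[OF Z])
qed

lemma smooth_fn_differential:
  assumes Z: "smooth_atlas Z" and B: "smooth_atlas B" and C: "smooth_atlas C"
    and b: "smooth_at Z B b z0" and f: "smooth_at B C f (b z0)"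
    and d: "d \<in> B" "b z0 \<in> fst d" and e: "e \<in> C" "f (b z0) \<in> fst e"
    and v: "smooth_fn Z (\<lambda>z. v z d) z0" "eventually (\<lambda>z. v z \<in> tspace B (b z)) (mnhds Z z0)"
  shows "smooth_fn Z (\<lambda>z. differential B C f (b z) (v z) e) z0"
proof -
  have "(b z0, b z0) \<in> pts (prod_atlas B B)" using smooth_at_pts(2)[OF b] by (simp add: pts_prod)
  then have "smooth_at (prod_atlas B B) C (\<lambda>q. f (snd q)) (b z0, b z0)"
    by (rule smooth_at_compose[OF smooth_atlas_prod[OF B B] B smooth_at_snd[OF B B]]) (simp add: f)
  from smooth_fn_partial_differential[where G = "\<lambda>q. f (snd q)", OF Z B B C b b this d e(1) _ v]
  show ?thesis using e(2) by simp
qed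

subsection \<open>The tangent bundle\<close>

definition tchart :: "('a, 'e::model_space) atlas \<Rightarrow> ('a, 'e) chart \<Rightarrow> ('a \<times> ('a, 'e) tvec, 'e \<times> 'e) chart" where
  "tchart A c = (Sigma (fst c) (tspace A), \<lambda>(p, v). (snd c p, v c))"

lemma tangent_atlas_eq: "tangent_atlas A = tchart A ` A"
  by (simp add: tangent_atlas_def tchart_def[abs_def])

lemma fst_tchart: "z \<in> fst (tchart A c) \<longleftrightarrow> fst z \<in> fst c \<and> snd z \<in> tspace A (fst z)"
  by (cases z) (simp add: tchart_def)

lemma snd_tchart: "snd (tchart A c) z = (snd c (fst z), snd z c)"
  by (cases z) (simp add: tchart_def)

lemma pts_tangent: "pts (tangent_atlas A) = tbundle A"
  by (auto simp: pts_def tbundle_def tangent_atlas_eq fst_tchart)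

lemma tchart_inj: "smooth_atlas A \<Longrightarrow> c \<in> A \<Longrightarrow> inj_on (snd (tchart A c)) (fst (tchart A c))"
proof (rule inj_onI)
  fix z z' assume A: "smooth_atlas A" and c: "c \<in> A" and z: "z \<in> fst (tchart A c)" "z' \<in> fst (tchart A c)"
    and eq: "snd (tchart A c) z = snd (tchart A c) z'"
  have "snd c (fst z) = snd c (fst z')" and vc: "snd z c = snd z' c" using eq by (simp_all add: snd_tchart)
  then have f: "fst z = fst z'" using z chart_inv_chart[OF A c] by (metis fst_tchart)
  then have "snd z = snd z'" using z vc tspace_eqI[of "snd z" A "fst z" "snd z'" c] c by (simp add: fst_tchart)
  then show "z = z'" using f by (simp add: prod_eq_iff)
qed

lemma tchart_inv:
  assumes A: "smooth_atlas A" and c: "c \<in> A" and x: "x \<in> snd c ` fst c"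
  shows "chart_inv (tchart A c) (x, r) = (chart_inv c x, tvec_of A c (chart_inv c x) r)"
    "(x, r) \<in> snd (tchart A c) ` fst (tchart A c)"
proof -
  let ?z = "(chart_inv c x, tvec_of A c (chart_inv c x) r)"
  have 1: "?z \<in> fst (tchart A c)"
    using x c by (simp add: fst_tchart chart_inv_in tvec_of_in_tspace[OF A c])
  have 2: "snd (tchart A c) ?z = (x, r)"
    using x c by (simp add: snd_tchart chart_chart_inv tvec_of_self[OF A c] chart_inv_in)
  show "chart_inv (tchart A c) (x, r) = ?z" by (rule inv_into_f_eq[OF tchart_inj[OF A c] 1 2])
  show "(x, r) \<in> snd (tchart A c) ` fst (tchart A c)" using 1 2 by (metis imageI)
qed

lemma image_tchart:
  assumes A: "smooth_atlas A" and c: "c \<in> A" 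
  shows "snd (tchart A c) ` (fst (tchart A c) \<inter> {z. fst z \<in> S}) = (snd c ` (fst c \<inter> S)) \<times> UNIV" (is "?L = ?R")
proof
  show "?L \<subseteq> ?R" by (auto simp: fst_tchart snd_tchart)
  show "?R \<subseteq> ?L"
  proof
    fix y assume "y \<in> ?R"
    then obtain p where "p \<in> fst c" "p \<in> S" "fst y = snd c p" unfolding mem_Times_iff by blast
    moreover define r where "r = snd y"
    ultimately have p: "p \<in> fst c" "p \<in> S" "y = (snd c p, r)" by (simp_all add: prod_eq_iff)
    let ?z = "(p, tvec_of A c p r)"
    have "?z \<in> fst (tchart A c) \<inter> {z. fst z \<in> S}" "snd (tchart A c) ?z = y"
      using p tvec_of_in_tspace[OF A c] tvec_of_self[OF A c] by (simp_all add: fst_tchart snd_tchart)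
    then show "y \<in> ?L" by (metis imageI)
  qed
qed

lemma smooth_atlas_tangent:
  assumes A: "smooth_atlas A"
  shows "smooth_atlas (tangent_atlas A)"
proof -
  have op: "open (snd (tchart A c) ` fst (tchart A c))" if c: "c \<in> A" for c
    using image_tchart[OF A c, of UNIV] chart_open[OF A c] by (simp add: open_Times)
  have tr: "open (snd (tchart A c) ` (fst (tchart A c) \<inter> fst (tchart A d)))"
    "smooth_on (snd (tchart A c) ` (fst (tchart A c) \<inter> fst (tchart A d))) (snd (tchart A d) \<circ> chart_inv (tchart A c))"
    if c: "c \<in> A" and d: "d \<in> A" for c d
  proof -
    let ?V = "(snd c ` (fst c \<inter> fst d)) \<times> (UNIV :: 'b set)"
    have "fst (tchart A c) \<inter> fst (tchart A d) = fst (tchart A c) \<inter> {z. fst z \<in> fst d}"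
      by (auto simp: fst_tchart)
    then have V: "snd (tchart A c) ` (fst (tchart A c) \<inter> fst (tchart A d)) = ?V"
      by (simp add: image_tchart[OF A c])
    have oV: "open ?V" using A c d by (intro open_Times) (simp_all add: smooth_atlas_def)
    then show "open (snd (tchart A c) ` (fst (tchart A c) \<inter> fst (tchart A d)))" by (simp add: V)
    define \<phi> where "\<phi> = snd d \<circ> chart_inv c"
    have "smooth_near (snd (tchart A d) \<circ> chart_inv (tchart A c)) z" if z: "z \<in> ?V" for z
    proof -
      obtain p where p: "p \<in> fst c" "p \<in> fst d" "fst z = snd c p"
        using z unfolding mem_Times_iff by blast
      have \<phi>: "smooth_near \<phi> (fst z)" unfolding \<phi>_def p(3) by (rule transition_smooth_near[OF A c d p(1,2)])
      have "smooth_near (\<lambda>z. (\<phi> (fst z), frechet_derivative \<phi> (at (fst z)) (snd z))) z"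
        by (rule smooth_near_Pair[OF smooth_near_compose[where g = fst and f = \<phi>, OF \<phi> smooth_near_linear[OF linear_fst]]
              smooth_near_derivative[where y = fst and v = snd, OF \<phi> smooth_near_linear[OF linear_fst] smooth_near_linear[OF linear_snd]]])
      moreover have "eventually (\<lambda>z. z \<in> ?V) (nhds z)" using oV z by (rule eventually_nhds_in_open)
      then have "eventually (\<lambda>z. (\<phi> (fst z), frechet_derivative \<phi> (at (fst z)) (snd z))
          = (snd (tchart A d) \<circ> chart_inv (tchart A c)) z) (nhds z)"
      proof eventually_elim
        case (elim z)
        then obtain p where "p \<in> fst c" "p \<in> fst d" "fst z = snd c p" unfolding mem_Times_iff by blast
        moreover define r where "r = snd z"
        ultimately have p: "p \<in> fst c" "p \<in> fst d" "z = (snd c p, r)" by (simp_all add: prod_eq_iff)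
        then show ?case
          using tchart_inv(1)[OF A c, of "snd c p" r] chart_inv_chart[OF A c p(1)] d
          by (simp add: snd_tchart \<phi>_def tvec_of_def)
      qed
      ultimately show ?thesis by (rule smooth_near_cong)
    qed
    then show "smooth_on (snd (tchart A c) ` (fst (tchart A c) \<inter> fst (tchart A d))) (snd (tchart A d) \<circ> chart_inv (tchart A c))"
      unfolding V by (rule smooth_on_local)
  qed
  show ?thesis
    unfolding smooth_atlas_def tangent_atlas_eq by (simp add: tchart_inj[OF A] op tr)
qed

lemma tchart_at:
  assumes "z \<in> tbundle A" "c \<in> A" "fst z \<in> fst c"
  shows "tchart A c \<in> tangent_atlas A" "z \<in> fst (tchart A c)"
  using assms by (auto simp: tangent_atlas_eq fst_tchart tbundle_def)

lemma smooth_at_tangent_proj: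
  assumes A: "smooth_atlas A" and z: "z \<in> tbundle A"
  shows "smooth_at (tangent_atlas A) A fst z"
proof -
  have "fst z \<in> pts A" using z by (auto simp: tbundle_def)
  then obtain c where c: "c \<in> A" "fst z \<in> fst c" using ptsE[of "fst z" A] by blast
  note T = smooth_atlas_tangent[OF A] and t = tchart_at[OF z c]
  show ?thesis
  proof (rule smooth_at_chartI[where f = fst and p = z, OF T A c])
    show "\<forall>\<^sub>F q in mnhds (tangent_atlas A) z. fst q \<in> fst c"
      using eventually_in_chart[OF T t] by eventually_elim (simp add: fst_tchart)
    have "smooth_fn (tangent_atlas A) (\<lambda>q. fst (snd (tchart A c) q)) z"
      by (rule smooth_fn_compose_vec[OF smooth_near_linear[OF linear_fst] smooth_fn_chart[OF T t] T])
    then show "smooth_fn (tangent_atlas A) (\<lambda>q. snd c (fst q)) z" by (simp add: snd_tchart)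
  qed
qed

lemma smooth_fn_tangent_component:
  assumes A: "smooth_atlas A" and z: "z \<in> tbundle A" and c: "c \<in> A" "fst z \<in> fst c"
  shows "smooth_fn (tangent_atlas A) (\<lambda>q. snd q c) z"
proof -
  note T = smooth_atlas_tangent[OF A]
  have "smooth_fn (tangent_atlas A) (\<lambda>q. snd (snd (tchart A c) q)) z"
    by (rule smooth_fn_compose_vec[OF smooth_near_linear[OF linear_snd] smooth_fn_chart[OF T tchart_at[OF z c]] T])
  then show ?thesis by (simp add: snd_tchart)
qed

text \<open>A map into the tangent bundle is smooth if its base point and its components in a single chart
  are.\<close>

lemma smooth_at_section:
  assumes Z: "smooth_atlas Z" and A: "smooth_atlas A" and a: "smooth_at Z A a z0"
    and c: "c \<in> A" "a z0 \<in> fst c"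
    and v: "smooth_fn Z (\<lambda>z. v z c) z0" "eventually (\<lambda>z. v z \<in> tspace A (a z)) (mnhds Z z0)"
  shows "smooth_at Z (tangent_atlas A) (\<lambda>z. (a z, v z)) z0"
proof (rule smooth_at_chartI[where f = "\<lambda>z. (a z, v z)" and p = z0 and d = "tchart A c", OF Z smooth_atlas_tangent[OF A]])
  show "tchart A c \<in> tangent_atlas A" using c by (simp add: tangent_atlas_eq)
  have "v z0 \<in> tspace A (a z0)" using eventually_mnhds_imp[OF Z smooth_at_pts(1)[OF a] v(2)] .
  then show "(a z0, v z0) \<in> fst (tchart A c)" using c by (simp add: fst_tchart)
  show "\<forall>\<^sub>F z in mnhds Z z0. (a z, v z) \<in> fst (tchart A c)"
    using v(2) smooth_at_eventually_comp[OF a eventually_in_chart[OF A c]]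
    by eventually_elim (simp add: fst_tchart)
  show "smooth_fn Z (\<lambda>z. snd (tchart A c) (a z, v z)) z0"
    using smooth_fn_Pair[OF smooth_at_fn[OF a c] v(1)] by (simp add: snd_tchart)
qed

lemma smooth_at_tangent_component:
  assumes Z: "smooth_atlas Z" and A: "smooth_atlas A" and F: "smooth_at Z (tangent_atlas A) F z0"
    and c: "c \<in> A" "fst (F z0) \<in> fst c"
  shows "smooth_fn Z (\<lambda>z. snd (F z) c) z0"
proof -
  have "F z0 \<in> tbundle A" using smooth_at_pts(2)[OF F] by (simp add: pts_tangent)
  from smooth_fn_compose[OF Z smooth_atlas_tangent[OF A] F smooth_fn_tangent_component[OF A this c]]
  show ?thesis .
qed

section \<open>Principal bundles with a connection on the groupoid\<close>

lemma smooth_map_pts: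
  assumes "smooth_atlas A" "smooth_atlas B" "smooth_map A S B f" "p \<in> S" "p \<in> pts A"
  shows "f p \<in> pts B"
  using smooth_at_pts(2)[OF local_ext_some(1)[OF assms]] local_ext_some(3)[OF assms] by simp

lemma smooth_map_compose:
  assumes A: "smooth_atlas A" and B: "smooth_atlas B" and C: "smooth_atlas C"
    and \<phi>: "\<And>p. p \<in> S \<Longrightarrow> smooth_at A B \<phi> p" "\<And>p. p \<in> S \<Longrightarrow> \<phi> p \<in> S'" and f: "smooth_map B S' C f"
  shows "smooth_map A S C (\<lambda>p. f (\<phi> p))"
  unfolding smooth_map_def
proof
  fix p assume p: "p \<in> S"
  define F where "F = (SOME F. local_ext B S' C f (\<phi> p) F)"
  note F = local_ext_some[OF B C f \<phi>(2)[OF p] smooth_at_pts(2)[OF \<phi>(1)[OF p]], folded F_def]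
  have "smooth_at A C (\<lambda>q. F (\<phi> q)) p" by (rule smooth_at_compose[OF A B \<phi>(1)[OF p] F(1)])
  moreover have "eventually (\<lambda>q. q \<in> S \<longrightarrow> F (\<phi> q) = f (\<phi> q)) (mnhds A p)"
    using smooth_at_eventually_comp[OF \<phi>(1)[OF p] F(2)] by eventually_elim (simp add: \<phi>(2))
  ultimately have "local_ext A S C (\<lambda>p. f (\<phi> p)) p (\<lambda>q. F (\<phi> q))"
    using local_ext_iff[OF A C smooth_at_pts(1)[OF \<phi>(1)[OF p]]] by simp
  then show "\<exists>F. local_ext A S C (\<lambda>p. f (\<phi> p)) p F" by blast
qed

lemma smooth_subbundle_fibre:
  assumes "smooth_subbundle A H" "p \<in> pts A"
  shows "subspace (H `` {p})" "H `` {p} \<subseteq> tspace A p"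
proof -
  obtain W k X where "p \<in> W" "\<forall>q\<in>W. span ((\<lambda>i. X i q) ` {..<k::nat}) = H `` {q}"
    using assms unfolding smooth_subbundle_def by metis
  then have "span ((\<lambda>i. X i p) ` {..<k}) = H `` {p}" by blast
  then show "subspace (H `` {p})" using subspace_span by metis
  show "H `` {p} \<subseteq> tspace A p" using assms(1) by (auto simp: smooth_subbundle_def tbundle_def)
qed

text \<open>The complement \<open>U\<close> of the kernel of \<open>L\<close> is mapped bijectively onto the image of \<open>L\<close>; this yields
  horizontal lifts.\<close>

lemma direct_sum_complement:
  assumes ds: "direct_sum V U {v \<in> V. L v = 0}" and L: "linear L" and U: "subspace U" "U \<subseteq> V"
  shows "v \<in> V \<Longrightarrow> \<exists>u\<in>U. L u = L v" "u \<in> U \<Longrightarrow> u' \<in> U \<Longrightarrow> L u = L u' \<Longrightarrow> u = u'"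
proof -
  assume "v \<in> V"
  then obtain u w where "v = u + w" "u \<in> U" "L w = 0" using ds unfolding direct_sum_def by blast
  then show "\<exists>u\<in>U. L u = L v" using linear_add[OF L] by auto
next
  assume u: "u \<in> U" "u' \<in> U" "L u = L u'"
  have "u - u' \<in> U" using u U(1) by (simp add: subspace_diff)
  moreover have "L (u - u') = 0" using u linear_diff[OF L] by simp
  ultimately have "u - u' \<in> U \<inter> {v \<in> V. L v = 0}" using U(2) by blast
  then show "u = u'" using ds unfolding direct_sum_def by simp
qed

locale principal_connection =
  fixes X :: "('x, 'e::model_space, 'g, 'f::model_space) groupoid_data"
    and E :: "('g \<times> ('g, 'f) tvec) set"
    and P :: "('p, 'q::model_space, 'm, 'n::model_space, 'g, 'x) bundle_data"
  assumes groupoid: "lie_groupoid X"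
    and principal: "principal_bundle X P"
    and connection: "ehresmann_connection X E"
begin

abbreviation "dsrc g \<equiv> differential (Ar X) (Ob X) (src X) g"
abbreviation "dproj p \<equiv> differential (Tot P) (Base P) (proj P) p"
abbreviation "danch p \<equiv> differential (Tot P) (Ob X) (anchor P) p"
abbreviation "dinv g \<equiv> differential (Ar X) (Ar X) (ginv X) g"

lemma atlases:
  "smooth_atlas (Ob X)" "smooth_atlas (Ar X)" "smooth_atlas (Tot P)" "smooth_atlas (Base P)"
  using groupoid principal unfolding lie_groupoid_def principal_bundle_def manifold_def by blast+

lemmas O = atlases(1) and R = atlases(2) and T = atlases(3) and M = atlases(4)
lemmas RR = smooth_atlas_prod[OF R R] and TR = smooth_atlas_prod[OF T R] and TT = smooth_atlas_prod[OF T T]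

lemma submersion_smooth_at:
  assumes "submersion A B f" "smooth_atlas A" "smooth_atlas B" "p \<in> pts A"
  shows "smooth_at A B f p" "differential A B f p ` tspace A p = tspace B (f p)"
  using assms(1,4) smooth_map_imp_smooth_at[OF assms(2,3) mopen_pts[OF assms(2)] _ assms(4)]
  unfolding submersion_def by blast+

lemma src_smooth: "g \<in> pts (Ar X) \<Longrightarrow> smooth_at (Ar X) (Ob X) (src X) g"
  and src_surj: "g \<in> pts (Ar X) \<Longrightarrow> dsrc g ` tspace (Ar X) g = tspace (Ob X) (src X g)"
  and tgt_smooth: "g \<in> pts (Ar X) \<Longrightarrow> smooth_at (Ar X) (Ob X) (tgt X) g"
  using groupoid submersion_smooth_at[OF _ R O] unfolding lie_groupoid_def by blast+

lemma proj_smooth: "p \<in> pts (Tot P) \<Longrightarrow> smooth_at (Tot P) (Base P) (proj P) p"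
  and proj_surj: "p \<in> pts (Tot P) \<Longrightarrow> dproj p ` tspace (Tot P) p = tspace (Base P) (proj P p)"
  using principal submersion_smooth_at[OF _ T M] unfolding principal_bundle_def by blast+

lemma unit_smooth: "x \<in> pts (Ob X) \<Longrightarrow> smooth_at (Ob X) (Ar X) (gunit X) x"
  using groupoid smooth_map_imp_smooth_at[OF O R mopen_pts[OF O]] unfolding lie_groupoid_def by blast

lemma inv_smooth: "g \<in> pts (Ar X) \<Longrightarrow> smooth_at (Ar X) (Ar X) (ginv X) g"
  using groupoid smooth_map_imp_smooth_at[OF R R mopen_pts[OF R]] unfolding lie_groupoid_def by blast

lemma anchor_smooth: "p \<in> pts (Tot P) \<Longrightarrow> smooth_at (Tot P) (Ob X) (anchor P) p"
  using principal smooth_map_imp_smooth_at[OF T O mopen_pts[OF T]]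
  unfolding principal_bundle_def right_action_def by blast

lemma mul_smooth_map: "smooth_map (prod_atlas (Ar X) (Ar X)) (composable X) (Ar X) (\<lambda>(g, h). mul X g h)"
  using groupoid unfolding lie_groupoid_def by blast

lemma act_smooth_map: "smooth_map (prod_atlas (Tot P) (Ar X)) (act_dom X P) (Tot P) (\<lambda>(p, g). act P p g)"
  using principal unfolding principal_bundle_def right_action_def by blast

lemma in_pts [simp]:
  "g \<in> pts (Ar X) \<Longrightarrow> src X g \<in> pts (Ob X)" "g \<in> pts (Ar X) \<Longrightarrow> tgt X g \<in> pts (Ob X)"
  "g \<in> pts (Ar X) \<Longrightarrow> ginv X g \<in> pts (Ar X)" "x \<in> pts (Ob X) \<Longrightarrow> gunit X x \<in> pts (Ar X)"
  "p \<in> pts (Tot P) \<Longrightarrow> anchor P p \<in> pts (Ob X)" "p \<in> pts (Tot P) \<Longrightarrow> proj P p \<in> pts (Base P)"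
  using smooth_at_pts(2)[OF src_smooth] smooth_at_pts(2)[OF tgt_smooth] smooth_at_pts(2)[OF inv_smooth]
    smooth_at_pts(2)[OF unit_smooth] smooth_at_pts(2)[OF anchor_smooth] smooth_at_pts(2)[OF proj_smooth]
  by simp_all

lemma composable_iff: "(g, h) \<in> composable X \<longleftrightarrow> g \<in> pts (Ar X) \<and> h \<in> pts (Ar X) \<and> src X g = tgt X h"
  by (simp add: composable_def)

lemma act_dom_iff: "(p, g) \<in> act_dom X P \<longleftrightarrow> p \<in> pts (Tot P) \<and> g \<in> pts (Ar X) \<and> anchor P p = tgt X g"
  by (simp add: act_dom_def)

lemma mul_in [simp]: "(g, h) \<in> composable X \<Longrightarrow> mul X g h \<in> pts (Ar X)"
  using smooth_map_pts[OF RR R mul_smooth_map, of "(g, h)"] by (simp add: pts_prod composable_iff)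

lemma act_in [simp]: "(p, g) \<in> act_dom X P \<Longrightarrow> act P p g \<in> pts (Tot P)"
  using smooth_map_pts[OF TR T act_smooth_map, of "(p, g)"] by (simp add: pts_prod act_dom_iff)

lemma src_tgt [simp]:
  "(g, h) \<in> composable X \<Longrightarrow> src X (mul X g h) = src X h" "(g, h) \<in> composable X \<Longrightarrow> tgt X (mul X g h) = tgt X g"
  "x \<in> pts (Ob X) \<Longrightarrow> src X (gunit X x) = x" "x \<in> pts (Ob X) \<Longrightarrow> tgt X (gunit X x) = x"
  "g \<in> pts (Ar X) \<Longrightarrow> src X (ginv X g) = tgt X g" "g \<in> pts (Ar X) \<Longrightarrow> tgt X (ginv X g) = src X g"
  using groupoid unfolding lie_groupoid_def by (blast, blast, blast, blast, blast, blast)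

lemma mul_assoc:
  "(g, h) \<in> composable X \<Longrightarrow> (h, k) \<in> composable X \<Longrightarrow> mul X (mul X g h) k = mul X g (mul X h k)"
  using groupoid unfolding lie_groupoid_def by blast

lemma mul_unit [simp]:
  "g \<in> pts (Ar X) \<Longrightarrow> src X g = x \<Longrightarrow> mul X g (gunit X x) = g"
  "g \<in> pts (Ar X) \<Longrightarrow> tgt X g = x \<Longrightarrow> mul X (gunit X x) g = g"
  "g \<in> pts (Ar X) \<Longrightarrow> mul X g (ginv X g) = gunit X (tgt X g)"
  "g \<in> pts (Ar X) \<Longrightarrow> mul X (ginv X g) g = gunit X (src X g)"
  using groupoid unfolding lie_groupoid_def by (blast, blast, blast, blast)

lemma inverse_unique:
  assumes "(x, y) \<in> composable X" "mul X x y = gunit X (tgt X x)"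
  shows "ginv X x = y"
proof -
  have "mul X (ginv X x) (mul X x y) = mul X (mul X (ginv X x) x) y"
    using assms(1) by (intro mul_assoc[symmetric]) (simp_all add: composable_iff)
  then show ?thesis using assms by (simp add: composable_iff)
qed

lemma inv_inv [simp]: "g \<in> pts (Ar X) \<Longrightarrow> ginv X (ginv X g) = g"
  by (rule inverse_unique) (simp_all add: composable_iff)

lemma inv_unit [simp]: "x \<in> pts (Ob X) \<Longrightarrow> ginv X (gunit X x) = gunit X x"
  by (rule inverse_unique) (simp_all add: composable_iff)

lemma inv_mul:
  assumes "(g, h) \<in> composable X"
  shows "ginv X (mul X g h) = mul X (ginv X h) (ginv X g)"
proof (rule inverse_unique)
  have gh: "g \<in> pts (Ar X)" "h \<in> pts (Ar X)" "src X g = tgt X h" using assms by (simp_all add: composable_iff)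
  have c: "(ginv X h, ginv X g) \<in> composable X" using gh by (simp add: composable_iff)
  then show "(mul X g h, mul X (ginv X h) (ginv X g)) \<in> composable X"
    using assms gh by (simp add: composable_iff[of "mul X g h"])
  have "mul X (mul X g h) (mul X (ginv X h) (ginv X g)) = mul X g (mul X h (mul X (ginv X h) (ginv X g)))"
    using assms gh c by (intro mul_assoc) (simp_all add: composable_iff[of h])
  also have "mul X h (mul X (ginv X h) (ginv X g)) = mul X (mul X h (ginv X h)) (ginv X g)"
    using c gh by (intro mul_assoc[symmetric]) (simp_all add: composable_iff)
  also have "\<dots> = ginv X g" using gh by simp
  finally show "mul X (mul X g h) (mul X (ginv X h) (ginv X g)) = gunit X (tgt X (mul X g h))"
    using assms gh by simp
qed

lemma act_anchor [simp]: "(p, g) \<in> act_dom X P \<Longrightarrow> anchor P (act P p g) = src X g"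
  and act_act: "(p, g) \<in> act_dom X P \<Longrightarrow> (g, h) \<in> composable X \<Longrightarrow> act P (act P p g) h = act P p (mul X g h)"
  and act_unit [simp]: "p \<in> pts (Tot P) \<Longrightarrow> act P p (gunit X (anchor P p)) = p"
  and act_proj [simp]: "(p, g) \<in> act_dom X P \<Longrightarrow> proj P (act P p g) = proj P p"
  using principal unfolding principal_bundle_def right_action_def by (blast, blast, blast, blast)

lemma src_fibre_iff: "h \<in> src_fibre X x \<longleftrightarrow> h \<in> pts (Ar X) \<and> src X h = x"
  by (simp add: src_fibre_def)

subsection \<open>The infinitesimal structure in terms of curves\<close>

lemma algebroid_curve:
  assumes x: "x \<in> pts (Ob X)" and \<alpha>: "\<alpha> \<in> algebroid X x"
  shows "\<exists>h. h 0 = gunit X x \<and> has_vel (Ar X) h \<alpha> \<and> eventually (\<lambda>s. h s \<in> src_fibre X x) (nhds 0)"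
proof -
  have u: "gunit X x \<in> pts (Ar X)" using x by simp
  have \<alpha>': "\<alpha> \<in> tspace (Ar X) (gunit X x)" "dsrc (gunit X x) \<alpha> = 0" using \<alpha> by (simp_all add: algebroid_def tker_def)
  have "has_vel (Ob X) (\<lambda>s. x) (dsrc (gunit X x) \<alpha>)" using has_vel_const[OF O x] \<alpha>'(2) by simp
  then obtain h where h: "h 0 = gunit X x" "has_vel (Ar X) h \<alpha>" "eventually (\<lambda>s. src X (h s) = x) (nhds 0)"
    using curve_lift_submersion[OF R O src_smooth[OF u] src_surj[OF u], of "\<lambda>s. x" \<alpha>] \<alpha>'(1) x by auto
  have "eventually (\<lambda>s. h s \<in> pts (Ar X)) (nhds 0)"
    by (rule has_vel_eventually[OF h(2) eventually_in_pts[OF R has_velD(1)[OF h(2)]]])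
  then have "eventually (\<lambda>s. h s \<in> src_fibre X x) (nhds 0)"
    using h(3) by eventually_elim (simp add: src_fibre_iff)
  then show ?thesis using h by blast
qed

lemma differential_along_curve:
  assumes "smooth_atlas A" "smooth_atlas B" "has_vel A \<gamma> v" "smooth_at A B f (\<gamma> 0)"
    and "eventually (\<lambda>s. f (\<gamma> s) = \<delta> s) (nhds 0)" "has_vel B \<delta> w"
  shows "differential A B f (\<gamma> 0) v = w"
  using has_vel_unique[OF has_vel_cong[OF has_vel_differential[OF assms(1-4)] assms(5)] assms(6)] .

lemma algebroidI:
  assumes x: "x \<in> pts (Ob X)" and h: "has_vel (Ar X) h \<alpha>" "h 0 = gunit X x" "eventually (\<lambda>s. h s \<in> src_fibre X x) (nhds 0)"
  shows "\<alpha> \<in> algebroid X x"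
proof -
  have "dsrc (h 0) \<alpha> = 0"
  proof (rule differential_along_curve[OF R O h(1) src_smooth _ has_vel_const[OF O x]])
    show "h 0 \<in> pts (Ar X)" using has_velD(1)[OF h(1)] .
    show "\<forall>\<^sub>F s in nhds 0. src X (h s) = x" using h(3) by eventually_elim (simp add: src_fibre_iff)
  qed
  then show ?thesis using has_vel_tspace[OF R h(1)] h(2) by (simp add: algebroid_def tker_def)
qed

lemma subspace_algebroid: "x \<in> pts (Ob X) \<Longrightarrow> subspace (algebroid X x)"
proof -
  assume x: "x \<in> pts (Ob X)"
  then have u: "gunit X x \<in> pts (Ar X)" by simp
  note L = linear_differential[OF R O src_smooth[OF u]]
  have "algebroid X x = tspace (Ar X) (gunit X x) \<inter> {v. dsrc (gunit X x) v = 0}"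
    by (auto simp: algebroid_def tker_def)
  then show ?thesis using subspace_inter[OF subspace_tspace[OF R u] linear_subspace_kernel[OF L]] by simp
qed

lemma rtrans_smooth_map:
  assumes g: "g \<in> pts (Ar X)"
  shows "smooth_map (Ar X) (src_fibre X (tgt X g)) (Ar X) (\<lambda>h. mul X h g)"
proof -
  have "smooth_map (Ar X) (src_fibre X (tgt X g)) (Ar X) (\<lambda>h. (\<lambda>(g, h). mul X g h) (h, g))"
  proof (rule smooth_map_compose[where \<phi> = "\<lambda>h. (h, g)", OF R RR R _ _ mul_smooth_map])
    show "smooth_at (Ar X) (prod_atlas (Ar X) (Ar X)) (\<lambda>h. (h, g)) h" if "h \<in> src_fibre X (tgt X g)" for h
      using that g by (intro smooth_at_Pair[OF R R R] smooth_at_id[OF R] smooth_at_const[OF R R]) (simp_all add: src_fibre_iff)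
    show "(h, g) \<in> composable X" if "h \<in> src_fibre X (tgt X g)" for h
      using that g by (simp add: src_fibre_iff composable_iff)
  qed
  then show ?thesis by simp
qed

lemma inv_Pair_smooth:
  assumes "smooth_atlas A" "a \<in> pts A" "h \<in> pts (Ar X)"
  shows "smooth_at (Ar X) (prod_atlas A (Ar X)) (\<lambda>h. (a, ginv X h)) h"
  by (rule smooth_at_Pair[OF R assms(1) R smooth_at_const[OF R assms(1,3,2)] inv_smooth[OF assms(3)]])

lemma ltrans_smooth_map:
  assumes g: "g \<in> pts (Ar X)"
  shows "smooth_map (Ar X) (src_fibre X (src X g)) (Ar X) (\<lambda>h. mul X g (ginv X h))"
proof -
  have "smooth_map (Ar X) (src_fibre X (src X g)) (Ar X) (\<lambda>h. (\<lambda>(g, h). mul X g h) (g, ginv X h))"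
    by (rule smooth_map_compose[where \<phi> = "\<lambda>h. (g, ginv X h)", OF R RR R _ _ mul_smooth_map])
       (use g in \<open>simp_all add: src_fibre_iff composable_iff inv_Pair_smooth[OF R]\<close>)
  then show ?thesis by simp
qed

lemma fund_smooth_map:
  assumes p: "p \<in> pts (Tot P)"
  shows "smooth_map (Ar X) (src_fibre X (anchor P p)) (Tot P) (\<lambda>h. act P p (ginv X h))"
proof -
  have "smooth_map (Ar X) (src_fibre X (anchor P p)) (Tot P) (\<lambda>h. (\<lambda>(p, g). act P p g) (p, ginv X h))"
    by (rule smooth_map_compose[where \<phi> = "\<lambda>h. (p, ginv X h)", OF R TR T _ _ act_smooth_map])
       (use p in \<open>simp_all add: src_fibre_iff act_dom_iff inv_Pair_smooth[OF T]\<close>)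
  then show ?thesis by simp
qed

lemma has_vel_rtrans:
  assumes g: "g \<in> pts (Ar X)" and h: "has_vel (Ar X) h \<alpha>" "h 0 = gunit X (tgt X g)"
    "eventually (\<lambda>s. h s \<in> src_fibre X (tgt X g)) (nhds 0)"
  shows "has_vel (Ar X) (\<lambda>s. mul X (h s) g) (rtrans X g \<alpha>)"
  using has_vel_differential_on[OF R R rtrans_smooth_map[OF g] h(1,3)] h(2) by (simp add: rtrans_def)

lemma has_vel_ltrans:
  assumes g: "g \<in> pts (Ar X)" and h: "has_vel (Ar X) h \<alpha>" "h 0 = gunit X (src X g)"
    "eventually (\<lambda>s. h s \<in> src_fibre X (src X g)) (nhds 0)"
  shows "has_vel (Ar X) (\<lambda>s. mul X g (ginv X (h s))) (ltrans X g \<alpha>)"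
  using has_vel_differential_on[OF R R ltrans_smooth_map[OF g] h(1,3)] h(2) by (simp add: ltrans_def)

lemma has_vel_fund:
  assumes p: "p \<in> pts (Tot P)" and h: "has_vel (Ar X) h \<alpha>" "h 0 = gunit X (anchor P p)"
    "eventually (\<lambda>s. h s \<in> src_fibre X (anchor P p)) (nhds 0)"
  shows "has_vel (Tot P) (\<lambda>s. act P p (ginv X (h s))) (fund X P p \<alpha>)"
  using has_vel_differential_on[OF R T fund_smooth_map[OF p] h(1,3)] h(2) by (simp add: fund_def)

lemma has_vel_dact:
  assumes "has_vel (Tot P) p u" "has_vel (Ar X) g \<beta>" "eventually (\<lambda>s. (p s, g s) \<in> act_dom X P) (nhds 0)"
  shows "has_vel (Tot P) (\<lambda>s. act P (p s) (g s)) (dact X P (p 0) (g 0) u \<beta>)"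
  using has_vel_differential_on[OF TR T act_smooth_map has_vel_tpair[OF T R assms(1,2)] assms(3)]
  by (simp add: dact_def)

lemma linear_rtrans: "g \<in> pts (Ar X) \<Longrightarrow> linear (rtrans X g)"
  unfolding rtrans_def
  by (rule linear_differential_on[OF R R rtrans_smooth_map]) (simp_all add: src_fibre_iff)

lemma linear_fund: "p \<in> pts (Tot P) \<Longrightarrow> linear (fund X P p)"
  unfolding fund_def
  by (rule linear_differential_on[OF R T fund_smooth_map]) (simp_all add: src_fibre_iff)

lemma dact_add:
  assumes "(p, g) \<in> act_dom X P" "u \<in> tspace (Tot P) p" "u' \<in> tspace (Tot P) p"
    "\<beta> \<in> tspace (Ar X) g" "\<beta>' \<in> tspace (Ar X) g"
  shows "dact X P p g (u + u') (\<beta> + \<beta>') = dact X P p g u \<beta> + dact X P p g u' \<beta>'"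
proof -
  have pg: "p \<in> pts (Tot P)" "g \<in> pts (Ar X)" using assms(1) by (simp_all add: act_dom_iff)
  have "linear (differential_on (prod_atlas (Tot P) (Ar X)) (act_dom X P) (Tot P) (\<lambda>(p, g). act P p g) (p, g))"
    by (rule linear_differential_on[OF TR T act_smooth_map assms(1)]) (use pg in \<open>simp add: pts_prod\<close>)
  from linear_add[OF this] show ?thesis
    by (simp add: dact_def tpair_add[OF T R pg assms(2-5)])
qed

text \<open>Right translation by the inverse of \<open>g\<close> inverts right translation by \<open>g\<close>.\<close>

lemma rtrans_inverse:
  assumes g: "g \<in> pts (Ar X)"
  shows "\<exists>D. (\<forall>\<alpha>\<in>algebroid X (tgt X g). D (rtrans X g \<alpha>) = \<alpha>) \<and>
    (\<forall>\<beta>\<in>tker (Ar X) (Ob X) (src X) g. D \<beta> \<in> algebroid X (tgt X g) \<and> rtrans X g (D \<beta>) = \<beta>)"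
proof -
  define D where "D = differential_on (Ar X) (src_fibre X (src X g)) (Ar X) (\<lambda>h. mul X h (ginv X g)) g"
  have sm: "smooth_map (Ar X) (src_fibre X (src X g)) (Ar X) (\<lambda>h. mul X h (ginv X g))"
    using rtrans_smooth_map[of "ginv X g"] g by simp
  have mm: "mul X (mul X k g) (ginv X g) = k" if "k \<in> src_fibre X (tgt X g)" for k
    using that g mul_assoc[of k g "ginv X g"] by (simp add: src_fibre_iff composable_iff)
  have mm': "mul X (mul X k (ginv X g)) g = k" if "k \<in> src_fibre X (src X g)" for k
    using that g mul_assoc[of k "ginv X g" g] by (simp add: src_fibre_iff composable_iff)
  have 1: "D (rtrans X g \<alpha>) = \<alpha>" if \<alpha>: "\<alpha> \<in> algebroid X (tgt X g)" for \<alpha>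
  proof -
    obtain h where h: "h 0 = gunit X (tgt X g)" "has_vel (Ar X) h \<alpha>"
      "eventually (\<lambda>s. h s \<in> src_fibre X (tgt X g)) (nhds 0)" using algebroid_curve[OF _ \<alpha>] g by auto
    have "eventually (\<lambda>s. mul X (h s) g \<in> src_fibre X (src X g)) (nhds 0)"
      using h(3) by eventually_elim (use g in \<open>simp add: src_fibre_iff composable_iff\<close>)
    from has_vel_differential_on[OF R R sm has_vel_rtrans[OF g h(2,1,3)] this]
    have "has_vel (Ar X) (\<lambda>s. mul X (mul X (h s) g) (ginv X g)) (D (rtrans X g \<alpha>))"
      using h(1) g by (simp add: D_def)
    moreover have "eventually (\<lambda>s. mul X (mul X (h s) g) (ginv X g) = h s) (nhds 0)"
      using h(3) by eventually_elim (rule mm)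
    ultimately show ?thesis by (rule has_vel_unique[OF has_vel_cong h(2)])
  qed
  have 2: "D \<beta> \<in> algebroid X (tgt X g) \<and> rtrans X g (D \<beta>) = \<beta>" if \<beta>: "\<beta> \<in> tker (Ar X) (Ob X) (src X) g" for \<beta>
  proof -
    have \<beta>': "\<beta> \<in> tspace (Ar X) g" "dsrc g \<beta> = 0" using \<beta> by (simp_all add: tker_def)
    have "has_vel (Ob X) (\<lambda>s. src X g) (dsrc g \<beta>)" using has_vel_const[OF O, of "src X g"] g \<beta>'(2) by simp
    then obtain k where k: "k 0 = g" "has_vel (Ar X) k \<beta>" "eventually (\<lambda>s. src X (k s) = src X g) (nhds 0)"
      using curve_lift_submersion[OF R O src_smooth[OF g] src_surj[OF g], of "\<lambda>s. src X g" \<beta>] \<beta>'(1) by auto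
    have "eventually (\<lambda>s. k s \<in> pts (Ar X)) (nhds 0)"
      by (rule has_vel_eventually[OF k(2) eventually_in_pts[OF R has_velD(1)[OF k(2)]]])
    then have ks: "eventually (\<lambda>s. k s \<in> src_fibre X (src X g)) (nhds 0)"
      using k(3) by eventually_elim (simp add: src_fibre_iff)
    have v: "has_vel (Ar X) (\<lambda>s. mul X (k s) (ginv X g)) (D \<beta>)"
      using has_vel_differential_on[OF R R sm k(2) ks] k(1) by (simp add: D_def)
    have v0: "mul X (k 0) (ginv X g) = gunit X (tgt X g)" using k(1) g by simp
    have vs: "eventually (\<lambda>s. mul X (k s) (ginv X g) \<in> src_fibre X (tgt X g)) (nhds 0)"
      using ks by eventually_elim (use g in \<open>simp add: src_fibre_iff composable_iff\<close>)
    have "D \<beta> \<in> algebroid X (tgt X g)" by (rule algebroidI[OF _ v v0 vs]) (use g in simp)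
    moreover have "has_vel (Ar X) (\<lambda>s. mul X (mul X (k s) (ginv X g)) g) (rtrans X g (D \<beta>))"
      by (rule has_vel_rtrans[OF g v v0 vs])
    moreover have "eventually (\<lambda>s. mul X (mul X (k s) (ginv X g)) g = k s) (nhds 0)"
      using ks by eventually_elim (rule mm')
    ultimately show ?thesis using has_vel_unique[OF has_vel_cong k(2)] by blast
  qed
  show ?thesis using 1 2 by blast
qed

lemma E_fibre:
  assumes "g \<in> pts (Ar X)"
  shows "subspace (E `` {g})" "E `` {g} \<subseteq> tspace (Ar X) g"
    "direct_sum (tspace (Ar X) g) (E `` {g}) {v \<in> tspace (Ar X) g. dsrc g v = 0}"
  using connection smooth_subbundle_fibre[of "Ar X" E g] assms
  unfolding ehresmann_connection_def tker_def by blast+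

lemma sigma_eqI:
  assumes "g \<in> pts (Ar X)" "w \<in> E `` {g}" "dsrc g w = v"
  shows "sigma X E g v = w"
  unfolding sigma_def
proof (rule the_equality)
  note E = E_fibre[OF assms(1)] and L = linear_differential[OF R O src_smooth[OF assms(1)]]
  show "w' = w" if "w' \<in> E `` {g} \<and> dsrc g w' = v" for w'
    using direct_sum_complement(2)[OF E(3) L E(1,2)] that assms(2,3) by blast
qed (use assms in simp)

lemma sigma_spec:
  assumes g: "g \<in> pts (Ar X)" and v: "v \<in> tspace (Ob X) (src X g)"
  shows "sigma X E g v \<in> E `` {g}" "dsrc g (sigma X E g v) = v"
proof -
  note E = E_fibre[OF g] and L = linear_differential[OF R O src_smooth[OF g]]
  obtain v' where "v' \<in> tspace (Ar X) g" "v = dsrc g v'" using v src_surj[OF g] by blast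
  then obtain w where w: "w \<in> E `` {g}" "dsrc g w = v" using direct_sum_complement(1)[OF E(3) L E(1,2)] by metis
  then show "sigma X E g v \<in> E `` {g}" "dsrc g (sigma X E g v) = v" using sigma_eqI[OF g w] by simp_all
qed

lemma sigma_add:
  assumes g: "g \<in> pts (Ar X)" and v: "v \<in> tspace (Ob X) (src X g)" "v' \<in> tspace (Ob X) (src X g)"
  shows "sigma X E g (v + v') = sigma X E g v + sigma X E g v'"
  using sigma_spec[OF g v(1)] sigma_spec[OF g v(2)] subspace_add[OF E_fibre(1)[OF g]]
    linear_add[OF linear_differential[OF R O src_smooth[OF g]]]
  by (intro sigma_eqI[OF g]) simp_all

text \<open>As \<open>\<lambda>\<^sub>g = - \<psi>\<^sub>g l\<^sub>g\<close>, the second statement is the defining equation of \<open>\<psi>\<close> at the vector \<open>l\<^sub>g \<alpha>\<close>,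
  solved for its horizontal part.\<close>

lemma lambda_spec:
  assumes g: "g \<in> pts (Ar X)" and l: "ltrans X g \<alpha> \<in> tspace (Ar X) g"
  shows "lambda X E g \<alpha> \<in> algebroid X (tgt X g)"
    "sigma X E g (dsrc g (ltrans X g \<alpha>)) = ltrans X g \<alpha> + rtrans X g (lambda X E g \<alpha>)"
proof -
  define v where "v = ltrans X g \<alpha>"
  define w where "w = sigma X E g (dsrc g v)"
  have v: "v \<in> tspace (Ar X) g" using l by (simp add: v_def)
  note L = linear_differential[OF R O src_smooth[OF g]]
  have "dsrc g v \<in> tspace (Ob X) (src X g)" by (rule differential_in_tspace[OF R O src_smooth[OF g] v])
  note s = sigma_spec[OF g this, folded w_def]
  have w: "w \<in> tspace (Ar X) g" using s(1) E_fibre(2)[OF g] by blast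
  have "v - w \<in> tspace (Ar X) g" using subspace_diff[OF subspace_tspace[OF R g] v w] .
  then have ker: "v - w \<in> tker (Ar X) (Ob X) (src X) g" using s(2) linear_diff[OF L] by (simp add: tker_def)
  obtain D where D: "\<And>\<alpha>. \<alpha> \<in> algebroid X (tgt X g) \<Longrightarrow> D (rtrans X g \<alpha>) = \<alpha>"
    "D (v - w) \<in> algebroid X (tgt X g)" "rtrans X g (D (v - w)) = v - w"
    using rtrans_inverse[OF g] ker by blast
  have "psi X E g v = D (v - w)"
    unfolding psi_def w_def[symmetric]
  proof (rule the_equality)
    show "D (v - w) \<in> algebroid X (tgt X g) \<and> rtrans X g (D (v - w)) + w = v" using D(2,3) by simp
    show "\<beta> = D (v - w)" if \<beta>: "\<beta> \<in> algebroid X (tgt X g) \<and> rtrans X g \<beta> + w = v" for \<beta>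
    proof -
      have "rtrans X g \<beta> = v - w" using \<beta> by (metis add_diff_cancel)
      then show ?thesis using D(1)[of \<beta>] \<beta> by simp
    qed
  qed
  then have lam: "lambda X E g \<alpha> = - D (v - w)" by (simp add: lambda_def v_def)
  show "lambda X E g \<alpha> \<in> algebroid X (tgt X g)"
    unfolding lam using D(2) subspace_algebroid g by (simp add: subspace_neg)
  have "v + rtrans X g (- D (v - w)) = w" using linear_neg[OF linear_rtrans[OF g]] D(3) by simp
  then show "sigma X E g (dsrc g (ltrans X g \<alpha>)) = ltrans X g \<alpha> + rtrans X g (lambda X E g \<alpha>)"
    by (simp add: lam v_def[symmetric] w_def[symmetric])
qed

subsection \<open>The quasi action on tangent vectors\<close>

text \<open>The vector \<open>\<tau>\<^sub>g u\<close> is the velocity of a product \<open>\<gamma> k\<^sup>-\<^sup>1\<close>, where \<open>\<gamma>\<close> has velocity \<open>u\<close> and \<open>k\<close> starts at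
  \<open>g\<^sup>-\<^sup>1\<close> with horizontal velocity. The curve \<open>k\<close> is lifted through the source map, so that the source
  of \<open>k\<close> follows the anchor of \<open>\<gamma>\<close> and the product is defined for all parameters near 0.\<close>

lemma tau_curve:
  assumes pg: "(p, g) \<in> act_dom X P" and u: "u \<in> tspace (Tot P) p"
  shows "\<exists>\<gamma> k. \<gamma> 0 = p \<and> has_vel (Tot P) \<gamma> u \<and> k 0 = ginv X g \<and>
    eventually (\<lambda>s. (\<gamma> s, ginv X (k s)) \<in> act_dom X P) (nhds 0) \<and>
    has_vel (Tot P) (\<lambda>s. act P (\<gamma> s) (ginv X (k s))) (tau X E P p g u)"
proof -
  have p: "p \<in> pts (Tot P)" and g: "g \<in> pts (Ar X)" and a: "anchor P p = tgt X g" using pg by (simp_all add: act_dom_iff)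
  let ?k = "ginv X g"
  have k: "?k \<in> pts (Ar X)" and sk: "src X ?k = anchor P p" using g a by simp_all
  obtain \<gamma> where \<gamma>: "\<gamma> 0 = p" "has_vel (Tot P) \<gamma> u" using tspace_curve[OF T p u] by blast
  define \<xi> where "\<xi> = sigma X E ?k (danch p u)"
  have "danch p u \<in> tspace (Ob X) (src X ?k)" unfolding sk by (rule differential_in_tspace[OF T O anchor_smooth[OF p] u])
  note \<xi> = sigma_spec[OF k this, folded \<xi>_def]
  have \<xi>t: "\<xi> \<in> tspace (Ar X) ?k" using \<xi>(1) E_fibre(2)[OF k] by blast
  have "has_vel (Ob X) (\<lambda>s. anchor P (\<gamma> s)) (dsrc ?k \<xi>)"
    using has_vel_differential[OF T O \<gamma>(2), of "anchor P"] anchor_smooth[OF p] \<gamma>(1) \<xi>(2) by simp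
  then obtain \<kappa> where \<kappa>: "\<kappa> 0 = ?k" "has_vel (Ar X) \<kappa> \<xi>" "eventually (\<lambda>s. src X (\<kappa> s) = anchor P (\<gamma> s)) (nhds 0)"
    using curve_lift_submersion[OF R O src_smooth[OF k] src_surj[OF k], of "\<lambda>s. anchor P (\<gamma> s)" \<xi>] \<xi>t \<gamma>(1) sk by auto
  have i: "has_vel (Ar X) (\<lambda>s. ginv X (\<kappa> s)) (dinv ?k \<xi>)"
    using has_vel_differential[OF R R \<kappa>(2), of "ginv X"] inv_smooth[OF k] \<kappa>(1) by simp
  have ev: "eventually (\<lambda>s. (\<gamma> s, ginv X (\<kappa> s)) \<in> act_dom X P) (nhds 0)"
    using has_vel_eventually[OF \<gamma>(2) eventually_in_pts[OF T has_velD(1)[OF \<gamma>(2)]]]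
      has_vel_eventually[OF \<kappa>(2) eventually_in_pts[OF R has_velD(1)[OF \<kappa>(2)]]] \<kappa>(3)
    by eventually_elim (simp add: act_dom_iff)
  have "has_vel (Tot P) (\<lambda>s. act P (\<gamma> s) (ginv X (\<kappa> s))) (tau X E P p g u)"
    using has_vel_dact[OF \<gamma>(2) i ev] \<gamma>(1) \<kappa>(1) g by (simp add: tau_def \<xi>_def)
  then show ?thesis using \<gamma> \<kappa>(1) ev by blast
qed

lemma tau_props:
  assumes pg: "(p, g) \<in> act_dom X P" and u: "u \<in> tspace (Tot P) p"
  shows "tau X E P p g u \<in> tspace (Tot P) (act P p g)" "dproj (act P p g) (tau X E P p g u) = dproj p u"
proof -
  have p: "p \<in> pts (Tot P)" and g: "g \<in> pts (Ar X)" using pg by (simp_all add: act_dom_iff)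
  obtain \<gamma> k where \<gamma>: "\<gamma> 0 = p" "has_vel (Tot P) \<gamma> u" "k 0 = ginv X g"
    and ev: "eventually (\<lambda>s. (\<gamma> s, ginv X (k s)) \<in> act_dom X P) (nhds 0)"
    and v: "has_vel (Tot P) (\<lambda>s. act P (\<gamma> s) (ginv X (k s))) (tau X E P p g u)"
    using tau_curve[OF assms] by blast
  have 0: "act P (\<gamma> 0) (ginv X (k 0)) = act P p g" using \<gamma> g by simp
  show "tau X E P p g u \<in> tspace (Tot P) (act P p g)" using has_vel_tspace[OF T v] 0 by simp
  have "has_vel (Base P) (\<lambda>s. proj P (\<gamma> s)) (dproj p u)"
    using has_vel_differential[OF T M \<gamma>(2), of "proj P"] proj_smooth[OF p] \<gamma>(1) by simp
  moreover have "eventually (\<lambda>s. proj P (act P (\<gamma> s) (ginv X (k s))) = proj P (\<gamma> s)) (nhds 0)"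
    using ev by eventually_elim simp
  ultimately have "dproj (act P (\<gamma> 0) (ginv X (k 0))) (tau X E P p g u) = dproj p u"
    using proj_smooth[of "act P p g"] pg 0
    by (intro differential_along_curve[OF T M v]) simp_all
  then show "dproj (act P p g) (tau X E P p g u) = dproj p u" by (simp only: 0)
qed

lemma tau_add:
  assumes pg: "(p, g) \<in> act_dom X P" and u: "u \<in> tspace (Tot P) p" "u' \<in> tspace (Tot P) p"
  shows "tau X E P p g (u + u') = tau X E P p g u + tau X E P p g u'"
proof -
  have p: "p \<in> pts (Tot P)" and g: "g \<in> pts (Ar X)" and a: "anchor P p = tgt X g" using pg by (simp_all add: act_dom_iff)
  let ?k = "ginv X g"
  have k: "?k \<in> pts (Ar X)" and sk: "src X ?k = anchor P p" using g a by simp_all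
  have t: "danch p u \<in> tspace (Ob X) (src X ?k)" "danch p u' \<in> tspace (Ob X) (src X ?k)"
    unfolding sk using differential_in_tspace[OF T O anchor_smooth[OF p]] u by simp_all
  have i: "dinv ?k (sigma X E ?k w) \<in> tspace (Ar X) g" if "w \<in> tspace (Ob X) (src X ?k)" for w
    using differential_in_tspace[OF R R inv_smooth[OF k], of "sigma X E ?k w"] sigma_spec(1)[OF k that] E_fibre(2)[OF k] g
    by auto
  show ?thesis
    unfolding tau_def linear_add[OF linear_differential[OF T O anchor_smooth[OF p]]] sigma_add[OF k t]
      linear_add[OF linear_differential[OF R R inv_smooth[OF k]]]
    by (rule dact_add[OF pg u i[OF t(1)] i[OF t(2)]])
qed

text \<open>Write \<open>k\<close> for the inverse of \<open>g\<close> and let \<open>h\<close> run through the source fibre at the unit. The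
  horizontal lift at \<open>k\<close> of the velocity of \<open>t h\<close> is \<open>l\<^sub>k \<alpha> + r\<^sub>k (\<lambda>\<^sub>k \<alpha>)\<close>. Its first term contributes
  the curve \<open>(p h\<^sup>-\<^sup>1) (k h\<^sup>-\<^sup>1)\<^sup>-\<^sup>1 = p g\<close>, which is constant; its second term contributes the curves
  \<open>p (h' k)\<^sup>-\<^sup>1 = (p g) h'\<^sup>-\<^sup>1\<close> that define fundamental vectors at \<open>p g\<close>.\<close>

lemma tau_fund:
  assumes pg: "(p, g) \<in> act_dom X P" and \<alpha>: "\<alpha> \<in> algebroid X (anchor P p)"
  shows "tau X E P p g (fund X P p \<alpha>) = fund X P (act P p g) (lambda X E (ginv X g) \<alpha>)"
    and "lambda X E (ginv X g) \<alpha> \<in> algebroid X (anchor P (act P p g))"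
proof -
  have p: "p \<in> pts (Tot P)" and g: "g \<in> pts (Ar X)" and a: "anchor P p = tgt X g" using pg by (simp_all add: act_dom_iff)
  define k where "k = ginv X g"
  have k: "k \<in> pts (Ar X)" and sk: "src X k = anchor P p" and tk: "tgt X k = src X g" and ik: "ginv X k = g"
    using g a by (simp_all add: k_def)
  have x: "anchor P p \<in> pts (Ob X)" using p by simp
  obtain h where h: "h 0 = gunit X (anchor P p)" "has_vel (Ar X) h \<alpha>"
    "eventually (\<lambda>s. h s \<in> src_fibre X (anchor P p)) (nhds 0)" using algebroid_curve[OF x \<alpha>] by blast
  have f: "has_vel (Tot P) (\<lambda>s. act P p (ginv X (h s))) (fund X P p \<alpha>)" by (rule has_vel_fund[OF p h(2,1,3)])
  have f0: "act P p (ginv X (h 0)) = p" using h(1) p by simp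
  have l: "has_vel (Ar X) (\<lambda>s. mul X k (ginv X (h s))) (ltrans X k \<alpha>)"
    by (rule has_vel_ltrans[OF k h(2)]) (use h sk in simp_all)
  have l0: "mul X k (ginv X (h 0)) = k" using h(1) k sk x by simp
  have lt: "ltrans X k \<alpha> \<in> tspace (Ar X) k" using has_vel_tspace[OF R l] l0 by simp
  note lam = lambda_spec[OF k lt]
  have t: "has_vel (Ob X) (\<lambda>s. tgt X (h s)) (differential (Ar X) (Ob X) (tgt X) (h 0) \<alpha>)"
    by (rule has_vel_differential[OF R O h(2) tgt_smooth[OF has_velD(1)[OF h(2)]]])
  have "danch (act P p (ginv X (h 0))) (fund X P p \<alpha>) = differential (Ar X) (Ob X) (tgt X) (h 0) \<alpha>"
  proof (rule differential_along_curve[OF T O f anchor_smooth _ t])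
    show "act P p (ginv X (h 0)) \<in> pts (Tot P)" using p f0 by simp
    show "\<forall>\<^sub>F s in nhds 0. anchor P (act P p (ginv X (h s))) = tgt X (h s)"
      using h(3) by eventually_elim (use p in \<open>simp add: src_fibre_iff act_dom_iff\<close>)
  qed
  moreover have "dsrc (mul X k (ginv X (h 0))) (ltrans X k \<alpha>) = differential (Ar X) (Ob X) (tgt X) (h 0) \<alpha>"
  proof (rule differential_along_curve[OF R O l src_smooth _ t])
    show "mul X k (ginv X (h 0)) \<in> pts (Ar X)" using k l0 by simp
    show "\<forall>\<^sub>F s in nhds 0. src X (mul X k (ginv X (h s))) = tgt X (h s)"
      using h(3) by eventually_elim (use k sk in \<open>simp add: src_fibre_iff composable_iff\<close>)
  qed
  ultimately have "danch p (fund X P p \<alpha>) = dsrc k (ltrans X k \<alpha>)" by (simp only: f0 l0)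
  then have \<xi>: "sigma X E k (danch p (fund X P p \<alpha>)) = ltrans X k \<alpha> + rtrans X k (lambda X E k \<alpha>)"
    using lam(2) by simp

  define \<beta> where "\<beta> = lambda X E k \<alpha>"
  have \<beta>: "\<beta> \<in> algebroid X (tgt X k)" using lam(1) by (simp add: \<beta>_def)
  then show "lambda X E (ginv X g) \<alpha> \<in> algebroid X (anchor P (act P p g))"
    using pg tk by (simp add: \<beta>_def k_def)
  obtain h' where h': "h' 0 = gunit X (tgt X k)" "has_vel (Ar X) h' \<beta>"
    "eventually (\<lambda>s. h' s \<in> src_fibre X (tgt X k)) (nhds 0)" using algebroid_curve[OF _ \<beta>] k by auto
  have r: "has_vel (Ar X) (\<lambda>s. mul X (h' s) k) (rtrans X k \<beta>)" by (rule has_vel_rtrans[OF k h'(2,1,3)])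
  have r0: "mul X (h' 0) k = k" using h'(1) k by simp
  have il: "has_vel (Ar X) (\<lambda>s. ginv X (mul X k (ginv X (h s)))) (dinv k (ltrans X k \<alpha>))"
    using has_vel_differential[OF R R l, of "ginv X"] inv_smooth[OF k] l0 by simp
  have ir: "has_vel (Ar X) (\<lambda>s. ginv X (mul X (h' s) k)) (dinv k (rtrans X k \<beta>))"
    using has_vel_differential[OF R R r, of "ginv X"] inv_smooth[OF k] r0 by simp
  have ilt: "dinv k (ltrans X k \<alpha>) \<in> tspace (Ar X) g" and irt: "dinv k (rtrans X k \<beta>) \<in> tspace (Ar X) g"
    using has_vel_tspace[OF R il] has_vel_tspace[OF R ir] l0 r0 ik by simp_all
  have ft: "fund X P p \<alpha> \<in> tspace (Tot P) p" using has_vel_tspace[OF T f] f0 by simp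

  have inv1: "(act P p (ginv X y), ginv X (mul X k (ginv X y))) \<in> act_dom X P \<and>
      act P (act P p (ginv X y)) (ginv X (mul X k (ginv X y))) = act P p g"
    if "y \<in> src_fibre X (anchor P p)" for y
  proof -
    have y: "y \<in> pts (Ar X)" "src X y = anchor P p" using that by (simp_all add: src_fibre_iff)
    have c: "(k, ginv X y) \<in> composable X" using k sk y by (simp add: composable_iff)
    have py: "(p, ginv X y) \<in> act_dom X P" using p y by (simp add: act_dom_iff)
    have yg: "(y, g) \<in> composable X" using y g a by (simp add: composable_iff)
    have "ginv X (mul X k (ginv X y)) = mul X y g" using inv_mul[OF c] y ik by simp
    moreover have "mul X (ginv X y) (mul X y g) = g"
      using mul_assoc[of "ginv X y" y g] y yg g a by (simp add: composable_iff)
    moreover have "act P (act P p (ginv X y)) (mul X y g) = act P p (mul X (ginv X y) (mul X y g))"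
      using py yg y by (intro act_act) (simp_all add: composable_iff[of "ginv X y"])
    moreover have "(act P p (ginv X y), mul X y g) \<in> act_dom X P" using py yg y by (simp add: act_dom_iff[of "act P p (ginv X y)"])
    ultimately show ?thesis by simp
  qed
  have inv2: "(p, ginv X (mul X y k)) \<in> act_dom X P \<and>
      act P p (ginv X (mul X y k)) = act P (act P p g) (ginv X y)"
    if "y \<in> src_fibre X (tgt X k)" for y
  proof -
    have y: "y \<in> pts (Ar X)" "src X y = tgt X k" using that by (simp_all add: src_fibre_iff)
    have c: "(y, k) \<in> composable X" using k y by (simp add: composable_iff)
    have gy: "(g, ginv X y) \<in> composable X" using g y tk by (simp add: composable_iff)
    have "ginv X (mul X y k) = mul X g (ginv X y)" using inv_mul[OF c] ik by simp
    then show ?thesis using act_act[OF pg gy] gy p g a by (simp add: act_dom_iff)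
  qed
  have "has_vel (Tot P) (\<lambda>s. act P (act P p (ginv X (h s))) (ginv X (mul X k (ginv X (h s)))))
      (dact X P (act P p (ginv X (h 0))) (ginv X (mul X k (ginv X (h 0)))) (fund X P p \<alpha>) (dinv k (ltrans X k \<alpha>)))"
    by (rule has_vel_dact[OF f il]) (use h(3) in \<open>eventually_elim, simp add: inv1\<close>)
  then have "has_vel (Tot P) (\<lambda>s. act P p g) (dact X P p g (fund X P p \<alpha>) (dinv k (ltrans X k \<alpha>)))"
    unfolding f0 l0 ik by (rule has_vel_cong) (use h(3) in \<open>eventually_elim, simp add: inv1\<close>)
  then have 1: "dact X P p g (fund X P p \<alpha>) (dinv k (ltrans X k \<alpha>)) = 0"
    by (rule has_vel_unique) (rule has_vel_const[OF T act_in[OF pg]])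
  have ap: "anchor P (act P p g) = tgt X k" using pg tk by simp
  have "has_vel (Tot P) (\<lambda>s. act P p (ginv X (mul X (h' s) k)))
      (dact X P p (ginv X (mul X (h' 0) k)) 0 (dinv k (rtrans X k \<beta>)))"
    by (rule has_vel_dact[OF has_vel_const[OF T p] ir]) (use h'(3) in \<open>eventually_elim, simp add: inv2\<close>)
  then have "has_vel (Tot P) (\<lambda>s. act P (act P p g) (ginv X (h' s))) (dact X P p g 0 (dinv k (rtrans X k \<beta>)))"
    unfolding r0 ik by (rule has_vel_cong) (use h'(3) in \<open>eventually_elim, simp add: inv2\<close>)
  moreover have "has_vel (Tot P) (\<lambda>s. act P (act P p g) (ginv X (h' s))) (fund X P (act P p g) \<beta>)"
    by (rule has_vel_fund[OF act_in[OF pg] h'(2)]) (use h' ap in simp_all)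
  ultimately have 2: "dact X P p g 0 (dinv k (rtrans X k \<beta>)) = fund X P (act P p g) \<beta>" by (rule has_vel_unique)
  have "tau X E P p g (fund X P p \<alpha>) = dact X P p g (fund X P p \<alpha> + 0) (dinv k (ltrans X k \<alpha>) + dinv k (rtrans X k \<beta>))"
    by (simp add: tau_def k_def[symmetric] \<xi> \<beta>_def linear_add[OF linear_differential[OF R R inv_smooth[OF k]]])
  also have "\<dots> = dact X P p g (fund X P p \<alpha>) (dinv k (ltrans X k \<alpha>)) + dact X P p g 0 (dinv k (rtrans X k \<beta>))"
    by (rule dact_add[OF pg ft _ ilt irt]) (simp add: subspace_0[OF subspace_tspace[OF T p]])
  also have "\<dots> = fund X P (act P p g) \<beta>" by (simp add: 1 2)
  finally show "tau X E P p g (fund X P p \<alpha>) = fund X P (act P p g) (lambda X E (ginv X g) \<alpha>)"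
    by (simp add: \<beta>_def k_def)
qed

subsection \<open>Division in the fibres and fundamental vectors\<close>

abbreviation "fibre_pairs \<equiv> {(p, q). p \<in> pts (Tot P) \<and> q \<in> pts (Tot P) \<and> proj P p = proj P q}"

text \<open>The arrow \<open>h\<close> with \<open>q = p h\<^sup>-\<^sup>1\<close>. The inverse matches the convention in the fundamental vector map,
  so that the quotient map for fixed \<open>p\<close> is a left inverse of \<open>h \<mapsto> p h\<^sup>-\<^sup>1\<close>.\<close>

definition quotient :: "'p \<times> 'p \<Rightarrow> 'g" where
  "quotient z = ginv X (snd (inv_into (act_dom X P) (\<lambda>(p, g). (p, act P p g)) z))"

lemma division:
  "bij_betw (\<lambda>(p, g). (p, act P p g)) (act_dom X P) fibre_pairs"
  "smooth_map (prod_atlas (Tot P) (Tot P)) fibre_pairs (prod_atlas (Tot P) (Ar X))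
     (inv_into (act_dom X P) (\<lambda>(p, g). (p, act P p g)))"
  using principal unfolding principal_bundle_def diffeo_def by blast+

lemma quotient_act:
  assumes p: "p \<in> pts (Tot P)" and h: "h \<in> src_fibre X (anchor P p)"
  shows "quotient (p, act P p (ginv X h)) = h"
proof -
  have ph: "(p, ginv X h) \<in> act_dom X P" using p h by (simp add: act_dom_iff src_fibre_iff)
  have "inv_into (act_dom X P) (\<lambda>(p, g). (p, act P p g)) ((\<lambda>(p, g). (p, act P p g)) (p, ginv X h)) = (p, ginv X h)"
    by (rule inv_into_f_f[OF bij_betw_imp_inj_on[OF division(1)] ph])
  then show ?thesis using h by (simp add: quotient_def src_fibre_iff)
qed

lemma act_quotient:
  assumes "p \<in> pts (Tot P)" "q \<in> pts (Tot P)" "proj P p = proj P q"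
  shows "quotient (p, q) \<in> src_fibre X (anchor P p)" "act P p (ginv X (quotient (p, q))) = q"
proof -
  have "(p, q) \<in> (\<lambda>(p, g). (p, act P p g)) ` act_dom X P"
    using assms bij_betw_imp_surj_on[OF division(1)] by simp
  then obtain g where g: "(p, g) \<in> act_dom X P" "q = act P p g" by auto
  define h where "h = ginv X g"
  have h: "h \<in> src_fibre X (anchor P p)" "g = ginv X h" using g by (simp_all add: h_def act_dom_iff src_fibre_iff)
  then have "quotient (p, q) = h" using quotient_act[OF assms(1)] g(2) by simp
  then show "quotient (p, q) \<in> src_fibre X (anchor P p)" "act P p (ginv X (quotient (p, q))) = q"
    using h g by simp_all
qed

lemma quotient_smooth_map:
  "smooth_map (prod_atlas (Tot P) (Tot P)) fibre_pairs (Ar X) quotient"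
proof -
  define \<Phi> where "\<Phi> = inv_into (act_dom X P) (\<lambda>(p, g). (p, act P p g))"
  show ?thesis
    unfolding smooth_map_def
  proof
    fix z assume z: "z \<in> fibre_pairs"
    then have zp: "z \<in> pts (prod_atlas (Tot P) (Tot P))" by (auto simp: pts_prod)
    define F where "F = (SOME F. local_ext (prod_atlas (Tot P) (Tot P)) fibre_pairs (prod_atlas (Tot P) (Ar X)) \<Phi> z F)"
    note F = local_ext_some[OF TT TR division(2)[folded \<Phi>_def] z zp, folded F_def]
    have 1: "smooth_at (prod_atlas (Tot P) (Tot P)) (Ar X) (\<lambda>z. snd (F z)) z"
      by (rule smooth_at_compose[OF TT TR F(1) smooth_at_snd[OF T R smooth_at_pts(2)[OF F(1)]]])
    have 2: "smooth_at (prod_atlas (Tot P) (Tot P)) (Ar X) (\<lambda>z. ginv X (snd (F z))) z"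
      by (rule smooth_at_compose[where f = "\<lambda>z. snd (F z)" and p = z, OF TT R 1 inv_smooth[OF smooth_at_pts(2)[OF 1]]])
    have 3: "eventually (\<lambda>q. q \<in> fibre_pairs \<longrightarrow> ginv X (snd (F q)) = quotient q) (mnhds (prod_atlas (Tot P) (Tot P)) z)"
      using F(2) by eventually_elim (simp add: quotient_def \<Phi>_def)
    then have "local_ext (prod_atlas (Tot P) (Tot P)) fibre_pairs (Ar X) quotient z (\<lambda>z. ginv X (snd (F z)))"
      using local_ext_iff[OF TT R zp] 2 by simp
    then show "\<exists>F. local_ext (prod_atlas (Tot P) (Tot P)) fibre_pairs (Ar X) quotient z F" by blast
  qed
qed

lemma fund_in_ker:
  assumes p: "p \<in> pts (Tot P)" and \<alpha>: "\<alpha> \<in> algebroid X (anchor P p)"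
  shows "fund X P p \<alpha> \<in> tspace (Tot P) p" "dproj p (fund X P p \<alpha>) = 0"
proof -
  obtain h where h: "h 0 = gunit X (anchor P p)" "has_vel (Ar X) h \<alpha>"
    "eventually (\<lambda>s. h s \<in> src_fibre X (anchor P p)) (nhds 0)" using algebroid_curve[OF _ \<alpha>] p by auto
  have f: "has_vel (Tot P) (\<lambda>s. act P p (ginv X (h s))) (fund X P p \<alpha>)" by (rule has_vel_fund[OF p h(2,1,3)])
  have f0: "act P p (ginv X (h 0)) = p" using h(1) p by simp
  show "fund X P p \<alpha> \<in> tspace (Tot P) p" using has_vel_tspace[OF T f] f0 by simp
  have "dproj (act P p (ginv X (h 0))) (fund X P p \<alpha>) = 0"
  proof (rule differential_along_curve[OF T M f proj_smooth _ has_vel_const[OF M]])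
    show "act P p (ginv X (h 0)) \<in> pts (Tot P)" "proj P p \<in> pts (Base P)" using p f0 by simp_all
    show "\<forall>\<^sub>F s in nhds 0. proj P (act P p (ginv X (h s))) = proj P p"
      using h(3) by eventually_elim (use p in \<open>simp add: src_fibre_iff act_dom_iff\<close>)
  qed
  then show "dproj p (fund X P p \<alpha>) = 0" by (simp only: f0)
qed

text \<open>The map \<open>G\<close> is any extension of the quotient map \<open>q \<mapsto> quotient (p, q)\<close> to a neighbourhood of
  \<open>p\<close>; apply it to the curve \<open>p h\<^sup>-\<^sup>1\<close> in the fibre.\<close>

lemma quotient_fund:
  assumes p: "p \<in> pts (Tot P)" and \<alpha>: "\<alpha> \<in> algebroid X (anchor P p)"
    and G: "smooth_at (Tot P) (Ar X) G p"
      "eventually (\<lambda>q. proj P p = proj P q \<longrightarrow> G q = quotient (p, q)) (mnhds (Tot P) p)"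
  shows "differential (Tot P) (Ar X) G p (fund X P p \<alpha>) = \<alpha>"
proof -
  obtain h where h: "h 0 = gunit X (anchor P p)" "has_vel (Ar X) h \<alpha>"
    "eventually (\<lambda>s. h s \<in> src_fibre X (anchor P p)) (nhds 0)" using algebroid_curve[OF _ \<alpha>] p by auto
  have f: "has_vel (Tot P) (\<lambda>s. act P p (ginv X (h s))) (fund X P p \<alpha>)" by (rule has_vel_fund[OF p h(2,1,3)])
  have f0: "act P p (ginv X (h 0)) = p" using h(1) p by simp
  have e: "\<forall>\<^sub>F s in nhds 0. proj P p = proj P (act P p (ginv X (h s))) \<longrightarrow> G (act P p (ginv X (h s))) = quotient (p, act P p (ginv X (h s)))"
    by (rule has_vel_eventually[OF f]) (use G(2) f0 in simp)
  have "differential (Tot P) (Ar X) G (act P p (ginv X (h 0))) (fund X P p \<alpha>) = \<alpha>"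
  proof (rule differential_along_curve[OF T R f _ _ h(2)])
    show "smooth_at (Tot P) (Ar X) G (act P p (ginv X (h 0)))" using G(1) f0 by simp
    show "\<forall>\<^sub>F s in nhds 0. G (act P p (ginv X (h s))) = h s"
      using e h(3) by eventually_elim (use p in \<open>simp add: quotient_act src_fibre_iff act_dom_iff\<close>)
  qed
  then show ?thesis by (simp only: f0)
qed

lemma quotient_ext:
  assumes p: "p \<in> pts (Tot P)"
  shows "\<exists>G. smooth_at (prod_atlas (Tot P) (Tot P)) (Ar X) G (p, p) \<and>
    eventually (\<lambda>z. z \<in> fibre_pairs \<longrightarrow> G z = quotient z) (mnhds (prod_atlas (Tot P) (Tot P)) (p, p))"
proof -
  have "(p, p) \<in> fibre_pairs" "(p, p) \<in> pts (prod_atlas (Tot P) (Tot P))" using p by (simp_all add: pts_prod)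
  from local_ext_some(1,2)[OF TT R quotient_smooth_map this] show ?thesis by blast
qed

lemma quotient_slice:
  assumes q: "q \<in> pts (Tot P)" and G: "smooth_at (prod_atlas (Tot P) (Tot P)) (Ar X) G (q, q)"
    "eventually (\<lambda>z. z \<in> fibre_pairs \<longrightarrow> G z = quotient z) (mnhds (prod_atlas (Tot P) (Tot P)) (q, q))"
  shows "smooth_at (Tot P) (Ar X) (\<lambda>y. G (q, y)) q"
    "eventually (\<lambda>y. proj P q = proj P y \<longrightarrow> G (q, y) = quotient (q, y)) (mnhds (Tot P) q)"
proof -
  show "smooth_at (Tot P) (Ar X) (\<lambda>y. G (q, y)) q" by (rule smooth_at_partial[OF T T G(1)])
  have "smooth_at (Tot P) (prod_atlas (Tot P) (Tot P)) (\<lambda>y. (q, y)) q"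
    by (rule smooth_at_Pair[OF T T T smooth_at_const[OF T T q q] smooth_at_id[OF T q]])
  from smooth_at_eventually_comp[where f = "\<lambda>y. (q, y)" and p = q, OF this G(2)] eventually_in_pts[OF T q]
  show "eventually (\<lambda>y. proj P q = proj P y \<longrightarrow> G (q, y) = quotient (q, y)) (mnhds (Tot P) q)"
    by eventually_elim (use q in simp)
qed

text \<open>A vertical vector \<open>v\<close> is the velocity of a curve \<open>\<gamma>\<close> in the fibre, and \<open>\<gamma> = p h\<^sup>-\<^sup>1\<close> for the curve
  \<open>h\<close> of quotients of \<open>\<gamma>\<close> by \<open>p\<close>.\<close>

lemma fund_surj:
  assumes p: "p \<in> pts (Tot P)" and v: "v \<in> tspace (Tot P) p" "dproj p v = 0"
  shows "\<exists>\<alpha>\<in>algebroid X (anchor P p). fund X P p \<alpha> = v"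
proof -
  obtain G where G: "smooth_at (prod_atlas (Tot P) (Tot P)) (Ar X) G (p, p) \<and>
    eventually (\<lambda>z. z \<in> fibre_pairs \<longrightarrow> G z = quotient z) (mnhds (prod_atlas (Tot P) (Tot P)) (p, p))"
    using quotient_ext[OF p] ..
  note S = quotient_slice[OF p conjunct1[OF G] conjunct2[OF G]]
  have "has_vel (Base P) (\<lambda>s. proj P p) (dproj p v)" using has_vel_const[OF M, of "proj P p"] p v(2) by simp
  then obtain \<gamma> where \<gamma>: "\<gamma> 0 = p" "has_vel (Tot P) \<gamma> v" "eventually (\<lambda>s. proj P (\<gamma> s) = proj P p) (nhds 0)"
    using curve_lift_submersion[OF T M proj_smooth[OF p] proj_surj[OF p], of "\<lambda>s. proj P p" v] v(1) by auto
  have ts: "eventually (\<lambda>s. \<gamma> s \<in> pts (Tot P)) (nhds 0)"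
    by (rule has_vel_eventually[OF \<gamma>(2) eventually_in_pts[OF T has_velD(1)[OF \<gamma>(2)]]])
  have e: "eventually (\<lambda>s. proj P p = proj P (\<gamma> s) \<longrightarrow> G (p, \<gamma> s) = quotient (p, \<gamma> s)) (nhds 0)"
    by (rule has_vel_eventually[OF \<gamma>(2)]) (use S(2) \<gamma>(1) in simp)
  define \<alpha> where "\<alpha> = differential (Tot P) (Ar X) (\<lambda>y. G (p, y)) p v"
  have "has_vel (Ar X) (\<lambda>s. G (p, \<gamma> s)) \<alpha>"
    using has_vel_differential[OF T R \<gamma>(2), of "\<lambda>y. G (p, y)"] S(1) \<gamma>(1) by (simp add: \<alpha>_def)
  then have h: "has_vel (Ar X) (\<lambda>s. quotient (p, \<gamma> s)) \<alpha>"
    by (rule has_vel_cong) (use e \<gamma>(3) in \<open>eventually_elim, simp\<close>)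
  have h0: "quotient (p, \<gamma> 0) = gunit X (anchor P p)"
    using quotient_act[OF p, of "gunit X (anchor P p)"] p \<gamma>(1) by (simp add: src_fibre_iff)
  have hs: "eventually (\<lambda>s. quotient (p, \<gamma> s) \<in> src_fibre X (anchor P p)) (nhds 0)"
    using ts \<gamma>(3) by eventually_elim (use act_quotient(1)[OF p] in simp)
  have "\<alpha> \<in> algebroid X (anchor P p)" by (rule algebroidI[OF _ h h0 hs]) (use p in simp)
  moreover have "has_vel (Tot P) (\<lambda>s. act P p (ginv X (quotient (p, \<gamma> s)))) (fund X P p \<alpha>)"
    by (rule has_vel_fund[OF p h h0 hs])
  then have "has_vel (Tot P) \<gamma> (fund X P p \<alpha>)"
    by (rule has_vel_cong) (use ts \<gamma>(3) in \<open>eventually_elim, simp add: act_quotient(2)[OF p]\<close>)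
  then have "fund X P p \<alpha> = v" by (rule has_vel_unique[OF _ \<gamma>(2)])
  ultimately show ?thesis by blast
qed

lemma fund_inj:
  assumes p: "p \<in> pts (Tot P)" and "\<alpha> \<in> algebroid X (anchor P p)" "\<beta> \<in> algebroid X (anchor P p)"
    and "fund X P p \<alpha> = fund X P p \<beta>"
  shows "\<alpha> = \<beta>"
proof -
  obtain G where G: "smooth_at (prod_atlas (Tot P) (Tot P)) (Ar X) G (p, p) \<and>
    eventually (\<lambda>z. z \<in> fibre_pairs \<longrightarrow> G z = quotient z) (mnhds (prod_atlas (Tot P) (Tot P)) (p, p))"
    using quotient_ext[OF p] ..
  note S = quotient_slice[OF p conjunct1[OF G] conjunct2[OF G]]
  show ?thesis
    by (rule trans[OF sym[OF quotient_fund[OF p assms(2) S, unfolded assms(4)]] quotient_fund[OF p assms(3) S]])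
qed

end

section \<open>Smooth linear algebra\<close>

lemma independent_familyI:
  fixes X :: "nat \<Rightarrow> 'v::real_vector"
  assumes "\<And>c. (\<Sum>i<k. c i *\<^sub>R X i) = 0 \<Longrightarrow> \<forall>i<k. c i = 0"
  shows "inj_on X {..<k}" "independent (X ` {..<k})"
proof -
  show inj: "inj_on X {..<k}"
  proof (rule inj_onI)
    fix i j assume ij: "i \<in> {..<k}" "j \<in> {..<k}" "X i = X j"
    define c where "c l = (if l = i then 1 else 0) - (if l = j then 1 else 0 :: real)" for l
    have "(\<Sum>l<k. c l *\<^sub>R X l) = (\<Sum>l<k. (if l = i then X l else 0)) - (\<Sum>l<k. (if l = j then X l else 0))"
      unfolding sum_subtractf[symmetric] by (rule sum.cong) (simp_all add: c_def)
    also have "\<dots> = 0" using ij by simp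
    finally have "c i = 0" using assms ij(1) by blast
    then show "i = j" by (simp add: c_def split: if_splits)
  qed
  show "independent (X ` {..<k})"
  proof (rule independent_if_scalars_zero)
    fix f x assume s: "(\<Sum>x\<in>X ` {..<k}. f x *\<^sub>R x) = 0" and x: "x \<in> X ` {..<k}"
    have "(\<Sum>i<k. f (X i) *\<^sub>R X i) = 0" using s by (simp add: sum.reindex[OF inj])
    then show "f x = 0" using assms[of "\<lambda>i. f (X i)"] x by auto
  qed simp
qed

lemma independent_familyD:
  fixes X :: "nat \<Rightarrow> 'v::real_vector"
  assumes inj: "inj_on X {..<k}" and "independent (X ` {..<k})" and s: "(\<Sum>i<k. c i *\<^sub>R X i) = 0" and "i < k"
  shows "c i = 0"
proof -
  define f where "f x = c (the_inv_into {..<k} X x)" for x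
  have f: "f (X j) = c j" if "j < k" for j using that by (simp add: f_def the_inv_into_f_f[OF inj])
  have "(\<Sum>x\<in>X ` {..<k}. f x *\<^sub>R x) = (\<Sum>j<k. c j *\<^sub>R X j)"
    unfolding sum.reindex[OF inj] by (rule sum.cong) (simp_all add: f)
  then have "f (X i) = 0" using independentD[OF assms(2), of "X ` {..<k}" f "X i"] s \<open>i < k\<close> by simp
  then show ?thesis using f \<open>i < k\<close> by simp
qed

lemma span_family: "v \<in> span (X ` {..<k::nat}) \<Longrightarrow> \<exists>c. v = (\<Sum>i<k. c i *\<^sub>R X i)"
proof (induction rule: span_induct_alt)
  case base
  show ?case by (rule exI[of _ "\<lambda>i. 0"]) simp
next
  case (step r x y)
  then obtain c j where c: "y = (\<Sum>i<k. c i *\<^sub>R X i)" and j: "j < k" "x = X j" by auto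
  have "(\<Sum>i<k. (c i + (if i = j then r else 0)) *\<^sub>R X i) = y + (\<Sum>i<k. if i = j then r *\<^sub>R X i else 0)"
    unfolding c sum.distrib[symmetric] by (rule sum.cong) (simp_all add: scaleR_add_left)
  also have "\<dots> = r *\<^sub>R x + y" using j by simp
  finally show ?case by (intro exI[of _ "\<lambda>i. c i + (if i = j then r else 0)"]) simp
qed

lemma sum_in_span_family: "(\<Sum>i<k. c i *\<^sub>R X i) \<in> span (X ` {..<k::nat})"
  by (intro span_sum span_scale span_base) simp

text \<open>Vectors whose images are close to an orthonormal basis are a basis of \<open>H\<close>: the map that sends
  the orthonormal basis to these images differs from the identity by a map of norm less than 1.\<close>

lemma frame_near_orthonormal:
  fixes L :: "'v::real_vector \<Rightarrow> 'n::model_space"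
  assumes L: "linear L" and H: "subspace H" and inj: "\<And>u. u \<in> H \<Longrightarrow> L u = 0 \<Longrightarrow> u = 0"
    and f: "bij_betw f {..<k::nat} (obasis :: 'n set)" and X: "\<And>i. i < k \<Longrightarrow> X i \<in> H"
    and near: "(\<Sum>i<k. norm (L (X i) - f i)) < 1"
  shows "inj_on X {..<k}" "independent (X ` {..<k})" "span (X ` {..<k}) = H"
proof -
  have fo: "f i \<in> obasis" if "i < k" for i using f that by (auto simp: bij_betw_def)
  have ff: "inner (f i) (f j) = (if i = j then 1 else 0)" if "i < k" "j < k" for i j
    using inner_obasis[OF fo[OF that(1)] fo[OF that(2)]] f that by (auto simp: bij_betw_def inj_on_def)
  have *: "\<forall>i<k. c i = 0" if s: "(\<Sum>i<k. c i *\<^sub>R L (X i)) = 0" for c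
  proof -
    define x where "x = (\<Sum>i<k. c i *\<^sub>R f i)"
    have cx: "inner x (f i) = c i" if "i < k" for i
    proof -
      have "inner x (f i) = (\<Sum>j<k. c j * inner (f j) (f i))" by (simp add: x_def inner_sum_left)
      also have "\<dots> = (\<Sum>j<k. if j = i then c i else 0)"
        by (rule sum.cong) (use ff that in auto)
      finally show ?thesis using that by simp
    qed
    have ci: "\<bar>c i\<bar> \<le> norm x" if "i < k" for i
    proof -
      have "norm (f i) = 1" using ff[OF that that] by (simp add: norm_eq_sqrt_inner)
      then show ?thesis using Cauchy_Schwarz_ineq2[of x "f i"] cx[OF that] by simp
    qed
    have "x = - (\<Sum>i<k. c i *\<^sub>R (L (X i) - f i))"
      using s by (simp add: x_def scaleR_diff_right sum_subtractf)
    then have "norm x \<le> (\<Sum>i<k. norm (c i *\<^sub>R (L (X i) - f i)))"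
      using norm_sum[of "\<lambda>i. c i *\<^sub>R (L (X i) - f i)" "{..<k}"] by simp
    also have "\<dots> \<le> (\<Sum>i<k. norm x * norm (L (X i) - f i))"
      by (rule sum_mono) (simp add: ci mult_right_mono)
    finally have "norm x \<le> norm x * (\<Sum>i<k. norm (L (X i) - f i))" by (simp add: sum_distrib_left)
    then have "norm x * (1 - (\<Sum>i<k. norm (L (X i) - f i))) \<le> 0" by (simp add: algebra_simps)
    then have "norm x \<le> 0" using near by (simp add: mult_le_0_iff)
    then have "x = 0" by simp
    then show ?thesis using cx by auto
  qed
  have Lsum: "L (\<Sum>i<k. c i *\<^sub>R X i) = (\<Sum>i<k. c i *\<^sub>R L (X i))" for c
    by (simp add: linear_sum[OF L] linear_scale[OF L])
  have **: "\<forall>i<k. c i = 0" if "(\<Sum>i<k. c i *\<^sub>R X i) = 0" for c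
    by (rule *) (use that Lsum[of c] linear_0[OF L] in simp)
  show "inj_on X {..<k}" "independent (X ` {..<k})"
    by (rule independent_familyI[where X = X, OF **], assumption)+
  have w: "inj_on (\<lambda>i. L (X i)) {..<k}" "independent ((\<lambda>i. L (X i)) ` {..<k})"
    by (rule independent_familyI[where X = "\<lambda>i. L (X i)", OF *], assumption)+
  have spanw: "y \<in> span ((\<lambda>i. L (X i)) ` {..<k})" for y
  proof (rule ccontr)
    let ?S = "(\<lambda>i. L (X i)) ` {..<k}"
    assume y: "y \<notin> span ?S"
    then have ind: "independent (insert y ?S)" using w(2) by (simp add: independent_insert)
    have "card (insert y ?S) \<le> card (obasis :: 'n set)"
      using independent_span_bound[OF finite_obasis ind] by (simp add: span_obasis)
    moreover have "y \<notin> ?S" using y span_base[of y ?S] by argo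
    then have "card (insert y ?S) = Suc k" using card_image[OF w(1)] by simp
    moreover have "card (obasis :: 'n set) = k" using bij_betw_same_card[OF f] by simp
    ultimately show False by simp
  qed
  have sub: "span (X ` {..<k}) \<subseteq> H" using X by (intro span_minimal H) auto
  moreover have "u \<in> span (X ` {..<k})" if u: "u \<in> H" for u
  proof -
    obtain c where c: "L u = (\<Sum>i<k. c i *\<^sub>R L (X i))" using span_family[OF spanw[of "L u"]] ..
    have v: "(\<Sum>i<k. c i *\<^sub>R X i) \<in> span (X ` {..<k})" by (rule sum_in_span_family)
    then have "u - (\<Sum>i<k. c i *\<^sub>R X i) \<in> H" using subspace_diff[OF H u subsetD[OF sub]] by simp
    moreover have "L (u - (\<Sum>i<k. c i *\<^sub>R X i)) = 0" using c Lsum linear_diff[OF L] by simp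
    ultimately have "u - (\<Sum>i<k. c i *\<^sub>R X i) = 0" using inj by blast
    then show ?thesis using v by simp
  qed
  ultimately show "span (X ` {..<k}) = H" by blast
qed

lemma smooth_fn_scaleR: "smooth_fn A r p \<Longrightarrow> smooth_fn A \<phi> p \<Longrightarrow> smooth_fn A (\<lambda>q. r q *\<^sub>R \<phi> q) p"
  and smooth_fn_inner: "smooth_fn A \<phi> p \<Longrightarrow> smooth_fn A \<psi> p \<Longrightarrow> smooth_fn A (\<lambda>q. inner (\<phi> q) (\<psi> q)) p"
  and smooth_fn_diff: "smooth_fn A \<phi> p \<Longrightarrow> smooth_fn A \<psi> p \<Longrightarrow> smooth_fn A (\<lambda>q. \<phi> q - \<psi> q) p"
  and smooth_fn_mult: "smooth_fn A a p \<Longrightarrow> smooth_fn A b p \<Longrightarrow> smooth_fn A (\<lambda>q. a q * b q :: real) p"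
  unfolding smooth_fn_def o_def
  by (simp_all add: smooth_near_scaleR smooth_near_inner smooth_near_diff smooth_near_mult)

lemma smooth_fn_sum: 
  "p \<in> pts A \<Longrightarrow> (\<And>i. i \<in> I \<Longrightarrow> smooth_fn A (\<phi> i) p) \<Longrightarrow> smooth_fn A (\<lambda>q. \<Sum>i\<in>I. \<phi> i q) p"
  unfolding smooth_fn_def o_def by (simp add: smooth_near_sum)

lemma smooth_fn_inverse:
  assumes "smooth_atlas A" "smooth_fn A r p" "r p \<noteq> (0::real)"
  shows "smooth_fn A (\<lambda>q. inverse (r q)) p"
  by (rule smooth_fn_compose_vec[OF smooth_near_inverse[OF smooth_near_ident assms(3)] assms(2,1)])

text \<open>The coefficients with respect to a smooth basis are smooth: projecting orthogonally to the last
  basis vector reduces the number of vectors by one.\<close>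

lemma smooth_coefficients:
  fixes w :: "nat \<Rightarrow> 'a \<Rightarrow> 'n::model_space"
  assumes Z: "smooth_atlas Z" and z0: "z0 \<in> pts Z"
    and "\<And>i. i < k \<Longrightarrow> smooth_fn Z (w i) z0" "smooth_fn Z y z0"
    and "eventually (\<lambda>z. \<forall>c. (\<Sum>i<k. c i *\<^sub>R w i z) = 0 \<longrightarrow> (\<forall>i<k. c i = 0)) (mnhds Z z0)"
    and "eventually (\<lambda>z. \<exists>c. y z = (\<Sum>i<k. c i *\<^sub>R w i z)) (mnhds Z z0)"
  shows "\<exists>\<theta>. (\<forall>i<k. smooth_fn Z (\<theta> i) z0) \<and> eventually (\<lambda>z. y z = (\<Sum>i<k. \<theta> i z *\<^sub>R w i z)) (mnhds Z z0)"
  using assms(3-6)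
proof (induction k arbitrary: w y)
  case 0
  then show ?case by simp
next
  case (Suc k)
  define n where "n z = inner (w k z) (w k z)" for z
  define \<rho> where "\<rho> v z = inner v (w k z) * inverse (n z)" for v z
  have wk: "smooth_fn Z (w k) z0" using Suc.prems(1) by simp
  have nz: "n z \<noteq> 0" if ind: "\<forall>c. (\<Sum>i<Suc k. c i *\<^sub>R w i z) = 0 \<longrightarrow> (\<forall>i<Suc k. c i = 0)" for z
  proof
    assume "n z = 0"
    then have "w k z = 0" by (simp add: n_def)
    then have "(\<Sum>i<Suc k. (if i = k then 1 else 0) *\<^sub>R w i z) = 0" by simp
    then have "\<forall>i<Suc k. (if i = k then 1 else 0 :: real) = 0"
      using spec[OF ind, of "\<lambda>i. if i = k then 1 else 0"] by blast
    then show False by auto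
  qed
  have n0: "n z0 \<noteq> 0" using eventually_mnhds_imp[OF Z z0 Suc.prems(3)] by (rule nz)
  have ns: "smooth_fn Z (\<lambda>z. inverse (n z)) z0"
    unfolding n_def by (rule smooth_fn_inverse[OF Z smooth_fn_inner[OF wk wk]]) (use n0 in \<open>simp add: n_def\<close>)
  have \<rho>s: "smooth_fn Z (\<lambda>z. \<rho> (v z) z) z0" if "smooth_fn Z v z0" for v
    unfolding \<rho>_def by (rule smooth_fn_mult[OF smooth_fn_inner[OF that wk] ns])
  define w' where "w' i z = w i z - \<rho> (w i z) z *\<^sub>R w k z" for i z
  define y' where "y' z = y z - \<rho> (y z) z *\<^sub>R w k z" for z
  have w'_sum: "(\<Sum>i<k. c i *\<^sub>R w' i z) = (\<Sum>i<k. c i *\<^sub>R w i z) - (\<Sum>i<k. c i * \<rho> (w i z) z) *\<^sub>R w k z" for c z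
    by (simp add: w'_def scaleR_diff_right sum_subtractf scaleR_sum_left)
  have "\<exists>\<theta>. (\<forall>i<k. smooth_fn Z (\<theta> i) z0) \<and> eventually (\<lambda>z. y' z = (\<Sum>i<k. \<theta> i z *\<^sub>R w' i z)) (mnhds Z z0)"
  proof (rule Suc.IH)
    show "smooth_fn Z (w' i) z0" if "i < k" for i
      unfolding w'_def[abs_def] using Suc.prems(1)[of i] that
      by (intro smooth_fn_diff smooth_fn_scaleR \<rho>s wk) simp_all
    show "smooth_fn Z y' z0"
      unfolding y'_def[abs_def] by (intro smooth_fn_diff smooth_fn_scaleR \<rho>s wk Suc.prems)
    show "eventually (\<lambda>z. \<forall>c. (\<Sum>i<k. c i *\<^sub>R w' i z) = 0 \<longrightarrow> (\<forall>i<k. c i = 0)) (mnhds Z z0)"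
      using Suc.prems(3)
    proof eventually_elim
      case (elim z)
      show ?case
      proof (intro allI impI)
        fix c i assume s: "(\<Sum>i<k. c i *\<^sub>R w' i z) = 0" and i: "i < k"
        define c' where "c' j = (if j = k then - (\<Sum>i<k. c i * \<rho> (w i z) z) else c j)" for j
        have "(\<Sum>i<k. c' i *\<^sub>R w i z) = (\<Sum>i<k. c i *\<^sub>R w i z)" by (rule sum.cong) (simp_all add: c'_def)
        then have "(\<Sum>i<Suc k. c' i *\<^sub>R w i z) = 0" using s by (simp add: w'_sum) (simp add: c'_def)
        from spec[OF elim, of c', THEN mp, OF this] have "c' i = 0" using i by simp
        then show "c i = 0" using i by (simp add: c'_def)
      qed
    qed
    show "eventually (\<lambda>z. \<exists>c. y' z = (\<Sum>i<k. c i *\<^sub>R w' i z)) (mnhds Z z0)"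
      using Suc.prems(3,4)
    proof eventually_elim
      case (elim z)
      from elim(2) obtain c where c: "y z = (\<Sum>i<Suc k. c i *\<^sub>R w i z)" ..
      have 1: "inner (w k z) (w k z) * inverse (n z) = 1"
        using right_inverse[OF nz[OF elim(1)]] unfolding n_def .
      have "\<rho> (y z) z = (\<Sum>i<k. c i * inner (w i z) (w k z)) * inverse (n z) + c k * (inner (w k z) (w k z) * inverse (n z))"
        by (simp add: \<rho>_def c inner_add_left inner_sum_left distrib_right)
      then have "\<rho> (y z) z = (\<Sum>i<k. c i * \<rho> (w i z) z) + c k"
        unfolding 1 by (simp add: \<rho>_def sum_distrib_right mult.assoc)
      then have "y' z = (\<Sum>i<k. c i *\<^sub>R w' i z)" by (simp add: y'_def w'_sum c scaleR_add_left)
      then show ?case by (rule exI[of _ c])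
    qed
  qed
  then obtain \<theta> where "(\<forall>i<k. smooth_fn Z (\<theta> i) z0) \<and>
    eventually (\<lambda>z. y' z = (\<Sum>i<k. \<theta> i z *\<^sub>R w' i z)) (mnhds Z z0)" ..
  then have \<theta>: "\<And>i. i < k \<Longrightarrow> smooth_fn Z (\<theta> i) z0"
    "eventually (\<lambda>z. y' z = (\<Sum>i<k. \<theta> i z *\<^sub>R w' i z)) (mnhds Z z0)" by simp_all
  define \<theta>' where "\<theta>' i z = (if i = k then \<rho> (y z) z - (\<Sum>i<k. \<theta> i z * \<rho> (w i z) z) else \<theta> i z)" for i z
  have "smooth_fn Z (\<theta>' i) z0" if "i < Suc k" for i
  proof (cases "i = k")
    case True
    have "smooth_fn Z (\<lambda>z. \<rho> (y z) z - (\<Sum>i<k. \<theta> i z * \<rho> (w i z) z)) z0"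
      using Suc.prems(1,2) \<theta>(1) by (intro smooth_fn_diff \<rho>s smooth_fn_sum[OF z0] smooth_fn_mult) simp_all
    then show ?thesis by (simp add: \<theta>'_def[abs_def] True)
  next
    case False
    then show ?thesis using \<theta>(1)[of i] that by (simp add: \<theta>'_def[abs_def])
  qed
  moreover have "eventually (\<lambda>z. y z = (\<Sum>i<Suc k. \<theta>' i z *\<^sub>R w i z)) (mnhds Z z0)"
    using \<theta>(2)
  proof eventually_elim
    case (elim z)
    have "(\<Sum>i<k. \<theta>' i z *\<^sub>R w i z) = (\<Sum>i<k. \<theta> i z *\<^sub>R w i z)" by (rule sum.cong) (simp_all add: \<theta>'_def)
    then show ?case using elim by (simp add: w'_sum y'_def) (simp add: \<theta>'_def algebra_simps)
  qed
  ultimately show ?case by (intro exI[of _ \<theta>'] conjI) simp_all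
qed

section \<open>Connection forms and horizontal subbundles\<close>

context principal_connection
begin

text \<open>Fundamental vectors are partial differentials, at units, of one smooth map on a product: a local
  extension of \<open>(q, h) \<mapsto> q h\<^sup>-\<^sup>1\<close>.\<close>

lemma smooth_fn_fund:
  assumes Z: "smooth_atlas Z" and b: "smooth_at Z (Tot P) b z0"
    and c: "c \<in> Tot P" "b z0 \<in> fst c" and e: "e \<in> Ar X" "gunit X (anchor P (b z0)) \<in> fst e"
    and v: "smooth_fn Z (\<lambda>z. v z e) z0"
      "eventually (\<lambda>z. v z \<in> algebroid X (anchor P (b z))) (mnhds Z z0)"
  shows "smooth_fn Z (\<lambda>z. fund X P (b z) (v z) c) z0"
proof -
  let ?u = "\<lambda>q. gunit X (anchor P q)"
  define p where "p = b z0"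
  have p: "p \<in> pts (Tot P)" unfolding p_def by (rule smooth_at_pts[OF b])
  have up: "(p, ?u p) \<in> act_dom X P" "(p, ?u p) \<in> pts (prod_atlas (Tot P) (Ar X))"
    using p by (simp_all add: act_dom_iff pts_prod)
  define F where "F = (SOME F. local_ext (prod_atlas (Tot P) (Ar X)) (act_dom X P) (Tot P) (\<lambda>(p, g). act P p g) (p, ?u p) F)"
  note F = local_ext_some[OF TR T act_smooth_map up, folded F_def]
  define G where "G w = F (fst w, ginv X (snd w))" for w
  have \<phi>: "smooth_at (prod_atlas (Tot P) (Ar X)) (prod_atlas (Tot P) (Ar X)) (\<lambda>w. (fst w, ginv X (snd w))) (q, h)"
    if "q \<in> pts (Tot P)" "h \<in> pts (Ar X)" for q h
  proof -
    have w: "(q, h) \<in> pts (prod_atlas (Tot P) (Ar X))" using that by (simp add: pts_prod)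
    have "smooth_at (prod_atlas (Tot P) (Ar X)) (Ar X) (\<lambda>w. ginv X (snd w)) (q, h)"
      by (rule smooth_at_compose[OF TR R smooth_at_snd[OF T R w]]) (simp add: that inv_smooth)
    then show ?thesis by (rule smooth_at_Pair[OF TR T R smooth_at_fst[OF T R w]])
  qed
  have ip: "ginv X (?u p) = ?u p" "?u p \<in> pts (Ar X)" using p by simp_all
  have G: "smooth_at (prod_atlas (Tot P) (Ar X)) (Tot P) G (p, ?u p)"
    unfolding G_def[abs_def]
    by (rule smooth_at_compose[OF TR TR \<phi>[OF p ip(2)]]) (simp add: F(1) ip(1))
  have Gev: "eventually (\<lambda>w. (fst w, ginv X (snd w)) \<in> act_dom X P \<longrightarrow> G w = act P (fst w) (ginv X (snd w)))
      (mnhds (prod_atlas (Tot P) (Ar X)) (p, ?u p))"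
  proof -
    have "eventually (\<lambda>w. w \<in> act_dom X P \<longrightarrow> F w = (\<lambda>(p, g). act P p g) w)
        (mnhds (prod_atlas (Tot P) (Ar X)) (fst (p, ?u p), ginv X (snd (p, ?u p))))"
      using F(2) by (simp add: ip(1))
    from smooth_at_eventually_comp[where f = "\<lambda>w. (fst w, ginv X (snd w))" and p = "(p, ?u p)", OF \<phi>[OF p ip(2)] this]
    show ?thesis by eventually_elim (simp add: G_def)
  qed
  have au: "smooth_at Z (Ar X) (\<lambda>z. ?u (b z)) z0"
  proof (rule smooth_at_compose[OF Z O])
    show "smooth_at Z (Ob X) (\<lambda>z. anchor P (b z)) z0"
      by (rule smooth_at_compose[OF Z T b anchor_smooth]) (use p in \<open>simp add: p_def\<close>)
    show "smooth_at (Ob X) (Ar X) (gunit X) (anchor P (b z0))"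
      by (rule unit_smooth) (use p in \<open>simp add: p_def\<close>)
  qed
  have vt: "eventually (\<lambda>z. v z \<in> tspace (Ar X) (?u (b z))) (mnhds Z z0)"
    using v(2) by eventually_elim (simp add: algebroid_def tker_def)
  have "G (b z0, ?u (b z0)) = p" using F(3) p ip(1) by (simp add: G_def p_def)
  then have "G (b z0, ?u (b z0)) \<in> fst c" using c(2) by (simp add: p_def)
  from smooth_fn_partial_differential[OF Z T R T b au G[unfolded p_def] e c(1) this v(1) vt]
  have "smooth_fn Z (\<lambda>z. differential (Ar X) (Tot P) (\<lambda>h. G (b z, h)) (?u (b z)) (v z) c) z0" .
  moreover have "eventually (\<lambda>z. differential (Ar X) (Tot P) (\<lambda>h. G (b z, h)) (?u (b z)) (v z) c = fund X P (b z) (v z) c) (mnhds Z z0)"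
  proof -
    note bu = smooth_at_Pair[OF Z T R b au]
    have 1: "eventually (\<lambda>z. smooth_at (prod_atlas (Tot P) (Ar X)) (Tot P) G (b z, ?u (b z))) (mnhds Z z0)"
      by (rule smooth_at_eventually_comp[where f = "\<lambda>z. (b z, ?u (b z))" and p = z0, OF bu
            smooth_at_eventually[OF TR T G[unfolded p_def]]])
    have 2: "eventually (\<lambda>z. eventually (\<lambda>w. (fst w, ginv X (snd w)) \<in> act_dom X P \<longrightarrow> G w = act P (fst w) (ginv X (snd w)))
      (mnhds (prod_atlas (Tot P) (Ar X)) (b z, ?u (b z)))) (mnhds Z z0)"
      by (rule smooth_at_eventually_comp[where f = "\<lambda>z. (b z, ?u (b z))" and p = z0, OF bu
            eventually_eventually_mnhds[OF TR _ Gev[unfolded p_def]]]) (use up(2) in \<open>simp add: p_def\<close>)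
    show ?thesis
      using 1 2 v(2)
    proof eventually_elim
      case (elim z)
      have q: "b z \<in> pts (Tot P)" using smooth_at_pts(1)[OF elim(1)] by (simp add: pts_prod)
      obtain h where h: "h 0 = ?u (b z)" "has_vel (Ar X) h (v z)"
        "eventually (\<lambda>s. h s \<in> src_fibre X (anchor P (b z))) (nhds 0)"
        using algebroid_curve[OF in_pts(5)[OF q] elim(3)] by auto
      have f: "has_vel (Tot P) (\<lambda>s. act P (b z) (ginv X (h s))) (fund X P (b z) (v z))"
        by (rule has_vel_fund[OF q h(2,1,3)])
      have zeta: "has_vel (prod_atlas (Tot P) (Ar X)) (\<lambda>s. (b z, h s)) (tpair (Tot P) (Ar X) (b z, h 0) 0 (v z))"
        by (rule has_vel_tpair[OF T R has_vel_const[OF T q] h(2)])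
      have "eventually (\<lambda>s. (fst (b z, h s), ginv X (snd (b z, h s))) \<in> act_dom X P \<longrightarrow>
          G (b z, h s) = act P (fst (b z, h s)) (ginv X (snd (b z, h s)))) (nhds 0)"
        by (rule has_vel_eventually[OF zeta]) (use elim(2) h(1) in simp)
      then have "eventually (\<lambda>s. G (b z, h s) = act P (b z) (ginv X (h s))) (nhds 0)"
        using h(3) by eventually_elim (use q in \<open>simp add: src_fibre_iff act_dom_iff\<close>)
      then have "differential (Ar X) (Tot P) (\<lambda>h. G (b z, h)) (h 0) (v z) = fund X P (b z) (v z)"
        by (intro differential_along_curve[where f = "\<lambda>h. G (b z, h)", OF R T h(2) _ _ f])
           (simp add: h(1) smooth_at_partial[OF T R elim(1)], assumption)
      then show ?case by (simp add: h(1))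
    qed
  qed
  ultimately show ?thesis by (rule smooth_fn_cong[OF Z])
qed

lemma fund_0: "p \<in> pts (Tot P) \<Longrightarrow> fund X P p 0 = 0"
  by (rule linear_0[OF linear_fund])

lemma linear_dproj: "p \<in> pts (Tot P) \<Longrightarrow> linear (dproj p)"
  by (rule linear_differential[OF T M proj_smooth])

lemma algebroid_0: "p \<in> pts (Tot P) \<Longrightarrow> 0 \<in> algebroid X (anchor P p)"
  using subspace_0[OF subspace_algebroid] by simp

lemma tbundle_iff: "(p, u) \<in> tbundle (Tot P) \<longleftrightarrow> p \<in> pts (Tot P) \<and> u \<in> tspace (Tot P) p"
  by (simp add: tbundle_def)

subsection \<open>The kernel of a connection form\<close>

context
  fixes \<omega> :: "'p \<times> ('p, 'q) tvec \<Rightarrow> ('g, 'f) tvec"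
  assumes form: "connection_form X E P \<omega>"
begin

lemma form_in: "p \<in> pts (Tot P) \<Longrightarrow> u \<in> tspace (Tot P) p \<Longrightarrow> \<omega> (p, u) \<in> algebroid X (anchor P p)"
  using form unfolding connection_form_def tbundle_def by blast

lemma form_add: "p \<in> pts (Tot P) \<Longrightarrow> u \<in> tspace (Tot P) p \<Longrightarrow> v \<in> tspace (Tot P) p \<Longrightarrow>
    \<omega> (p, u + v) = \<omega> (p, u) + \<omega> (p, v)"
  and form_scale: "p \<in> pts (Tot P) \<Longrightarrow> u \<in> tspace (Tot P) p \<Longrightarrow> \<omega> (p, r *\<^sub>R u) = r *\<^sub>R \<omega> (p, u)"
  and form_fund: "p \<in> pts (Tot P) \<Longrightarrow> \<alpha> \<in> algebroid X (anchor P p) \<Longrightarrow> \<omega> (p, fund X P p \<alpha>) = \<alpha>"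
  using form unfolding connection_form_def by blast+

lemma form_tau:
  assumes "(p, g) \<in> act_dom X P" "u \<in> tspace (Tot P) p"
  shows "\<omega> (act P p g, tau X E P p g u) = lambda X E (ginv X g) (\<omega> (p, u))"
  using form assms unfolding connection_form_def by blast

lemma form_diff:
  assumes p: "p \<in> pts (Tot P)" and u: "u \<in> tspace (Tot P) p" "v \<in> tspace (Tot P) p"
  shows "\<omega> (p, u - v) = \<omega> (p, u) - \<omega> (p, v)"
proof -
  have "(- 1) *\<^sub>R v \<in> tspace (Tot P) p" by (rule subspace_scale[OF subspace_tspace[OF T p] u(2)])
  then have "\<omega> (p, u + (- 1) *\<^sub>R v) = \<omega> (p, u) + (- 1) *\<^sub>R \<omega> (p, v)"
    by (simp only: form_add[OF p u(1)] form_scale[OF p u(2)])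
  then show ?thesis by simp
qed

definition hproj :: "'p \<Rightarrow> ('p, 'q) tvec \<Rightarrow> ('p, 'q) tvec" where
  "hproj p u = u - fund X P p (\<omega> (p, u))"

lemma kernel_fibre: "form_kernel P \<omega> `` {p} = {u \<in> tspace (Tot P) p. p \<in> pts (Tot P) \<and> \<omega> (p, u) = 0}"
  by (auto simp: form_kernel_def tbundle_def)

lemma hproj:
  assumes p: "p \<in> pts (Tot P)" and u: "u \<in> tspace (Tot P) p"
  shows "hproj p u \<in> tspace (Tot P) p" "hproj p u \<in> form_kernel P \<omega> `` {p}" "dproj p (hproj p u) = dproj p u"
proof -
  note \<alpha> = form_in[OF p u]
  note f = fund_in_ker[OF p \<alpha>]
  show t: "hproj p u \<in> tspace (Tot P) p"
    unfolding hproj_def by (rule subspace_diff[OF subspace_tspace[OF T p] u f(1)])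
  have "\<omega> (p, hproj p u) = 0" unfolding hproj_def by (simp add: form_diff[OF p u f(1)] form_fund[OF p \<alpha>])
  then show "hproj p u \<in> form_kernel P \<omega> `` {p}" using t p by (simp add: kernel_fibre)
  show "dproj p (hproj p u) = dproj p u" by (simp add: hproj_def linear_diff[OF linear_dproj[OF p]] f(2))
qed

lemma kernel_subspace:
  assumes p: "p \<in> pts (Tot P)"
  shows "subspace (form_kernel P \<omega> `` {p})"
proof (rule subspaceI)
  note S = subspace_tspace[OF T p]
  have "\<omega> (p, 0 *\<^sub>R 0) = 0 *\<^sub>R \<omega> (p, 0)" by (rule form_scale[OF p subspace_0[OF S]])
  then show "0 \<in> form_kernel P \<omega> `` {p}" using p subspace_0[OF S] by (simp add: kernel_fibre)
  show "u + v \<in> form_kernel P \<omega> `` {p}" if "u \<in> form_kernel P \<omega> `` {p}" "v \<in> form_kernel P \<omega> `` {p}" for u v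
    using that subspace_add[OF S, of u v] form_add[OF p, of u v] by (simp add: kernel_fibre)
  show "r *\<^sub>R u \<in> form_kernel P \<omega> `` {p}" if "u \<in> form_kernel P \<omega> `` {p}" for r u
    using that subspace_scale[OF S, of u r] form_scale[OF p, of u r] by (simp add: kernel_fibre)
qed

lemma kernel_vertical:
  assumes p: "p \<in> pts (Tot P)" and u: "u \<in> form_kernel P \<omega> `` {p}" "dproj p u = 0"
  shows "u = 0"
proof -
  have u': "u \<in> tspace (Tot P) p" "\<omega> (p, u) = 0" using u(1) by (simp_all add: kernel_fibre)
  obtain \<alpha> where \<alpha>: "\<alpha> \<in> algebroid X (anchor P p)" "fund X P p \<alpha> = u" using fund_surj[OF p u'(1) u(2)] by blast
  then have "\<alpha> = 0" using form_fund[OF p \<alpha>(1)] u'(2) by simp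
  then show ?thesis using \<alpha>(2) fund_0[OF p] by simp
qed

lemma kernel_direct_sum:
  assumes p: "p \<in> pts (Tot P)"
  shows "direct_sum (tspace (Tot P) p) (form_kernel P \<omega> `` {p}) (tker (Tot P) (Base P) (proj P) p)"
  unfolding direct_sum_def
proof
  note S = subspace_tspace[OF T p]
  show "form_kernel P \<omega> `` {p} \<inter> tker (Tot P) (Base P) (proj P) p = {0}"
  proof
    show "form_kernel P \<omega> `` {p} \<inter> tker (Tot P) (Base P) (proj P) p \<subseteq> {0}"
      using kernel_vertical[OF p] unfolding tker_def by blast
    show "{0} \<subseteq> form_kernel P \<omega> `` {p} \<inter> tker (Tot P) (Base P) (proj P) p"
      using subspace_0[OF kernel_subspace[OF p]] subspace_0[OF S] linear_0[OF linear_dproj[OF p]]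
      by (simp add: tker_def)
  qed
  show "tspace (Tot P) p = {u + w |u w. u \<in> form_kernel P \<omega> `` {p} \<and> w \<in> tker (Tot P) (Base P) (proj P) p}" (is "_ = ?S")
  proof
    show "tspace (Tot P) p \<subseteq> ?S"
    proof
      fix u assume u: "u \<in> tspace (Tot P) p"
      have "fund X P p (\<omega> (p, u)) \<in> tker (Tot P) (Base P) (proj P) p"
        using fund_in_ker[OF p form_in[OF p u]] by (simp add: tker_def)
      moreover have "u = hproj p u + fund X P p (\<omega> (p, u))" by (simp add: hproj_def)
      ultimately show "u \<in> ?S" using hproj(2)[OF p u] by blast
    qed
    show "?S \<subseteq> tspace (Tot P) p"
    proof
      fix x assume "x \<in> ?S"
      then obtain u w where "x = u + w" "u \<in> tspace (Tot P) p" "w \<in> tspace (Tot P) p"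
        unfolding kernel_fibre tker_def by blast
      then show "x \<in> tspace (Tot P) p" using subspace_add[OF S] by simp
    qed
  qed
qed

text \<open>Equivariance gives one inclusion. For the other, \<open>v\<close> over \<open>p g\<close> has the same projection as some
  horizontal \<open>u'\<close> over \<open>p\<close>; as \<open>\<tau>\<close> preserves projections, \<open>v - \<tau>\<^sub>g u'\<close> is horizontal and vertical.\<close>

lemma kernel_tau:
  assumes pg: "(p, g) \<in> act_dom X P"
  shows "form_kernel P \<omega> `` {act P p g} = tau X E P p g ` (form_kernel P \<omega> `` {p})"
proof
  have p: "p \<in> pts (Tot P)" and q: "act P p g \<in> pts (Tot P)" using pg by (simp_all add: act_dom_iff)
  have t: "tau X E P p g u \<in> form_kernel P \<omega> `` {act P p g}" if u: "u \<in> form_kernel P \<omega> `` {p}" for u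
  proof -
    have u': "u \<in> tspace (Tot P) p" "\<omega> (p, u) = 0" using u by (simp_all add: kernel_fibre)
    have l0: "lambda X E (ginv X g) 0 = 0"
    proof -
      note tf = tau_fund[OF pg algebroid_0[OF p]]
      have "tau X E P p g (0 + 0) = tau X E P p g 0 + tau X E P p g 0"
        using tau_add[OF pg, of 0 0] subspace_0[OF subspace_tspace[OF T p]] by simp
      then have "tau X E P p g 0 = 0" by simp
      then have "fund X P (act P p g) (lambda X E (ginv X g) 0) = fund X P (act P p g) 0"
        using tf(1) by (simp add: fund_0[OF p] fund_0[OF q])
      then show ?thesis by (rule fund_inj[OF q tf(2) algebroid_0[OF q]])
    qed
    have "\<omega> (act P p g, tau X E P p g u) = 0" using form_tau[OF pg u'(1)] u'(2) l0 by simp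
    then show ?thesis using tau_props(1)[OF pg u'(1)] q by (simp add: kernel_fibre)
  qed
  then show "tau X E P p g ` (form_kernel P \<omega> `` {p}) \<subseteq> form_kernel P \<omega> `` {act P p g}" by blast
  show "form_kernel P \<omega> `` {act P p g} \<subseteq> tau X E P p g ` (form_kernel P \<omega> `` {p})"
  proof
    fix v assume v: "v \<in> form_kernel P \<omega> `` {act P p g}"
    then have vt: "v \<in> tspace (Tot P) (act P p g)" by (simp add: kernel_fibre)
    have "dproj (act P p g) v \<in> tspace (Base P) (proj P p)"
      using differential_in_tspace[OF T M proj_smooth[OF q] vt] pg by simp
    then obtain u where u: "u \<in> tspace (Tot P) p" "dproj (act P p g) v = dproj p u"
      using proj_surj[OF p] by blast
    define u' where "u' = hproj p u"
    note h = hproj[OF p u(1), folded u'_def]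
    have "dproj (act P p g) (v - tau X E P p g u') = 0"
      using tau_props(2)[OF pg h(1)] u(2) h(3) by (simp add: linear_diff[OF linear_dproj[OF q]])
    moreover have "v - tau X E P p g u' \<in> form_kernel P \<omega> `` {act P p g}"
      by (rule subspace_diff[OF kernel_subspace[OF q] v t[OF h(2)]])
    ultimately have "v - tau X E P p g u' = 0" by (intro kernel_vertical[OF q])
    then have "v = tau X E P p g u'" by simp
    then show "v \<in> tau X E P p g ` (form_kernel P \<omega> `` {p})" using h(2) by (rule image_eqI)
  qed
qed

lemma form_smooth:
  assumes "z \<in> tbundle (Tot P)"
  shows "smooth_at (tangent_atlas (Tot P)) (tangent_atlas (Ar X)) (\<lambda>z. (gunit X (anchor P (fst z)), \<omega> z)) z"
proof -
  have "smooth_map (tangent_atlas (Tot P)) (tbundle (Tot P)) (tangent_atlas (Ar X))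
      (\<lambda>(p, u). (gunit X (anchor P p), \<omega> (p, u)))"
    using form unfolding connection_form_def by blast
  then have "smooth_map (tangent_atlas (Tot P)) (tbundle (Tot P)) (tangent_atlas (Ar X)) (\<lambda>z. (gunit X (anchor P (fst z)), \<omega> z))"
    by (simp add: case_prod_unfold)
  then show ?thesis
    using smooth_map_imp_smooth_at[OF smooth_atlas_tangent[OF T] smooth_atlas_tangent[OF R]
        mopen_pts[OF smooth_atlas_tangent[OF T]]] assms by (simp add: pts_tangent)
qed

lemma hproj_smooth:
  assumes p: "p \<in> pts (Tot P)" and c: "c \<in> Tot P" "p \<in> fst c"
  shows "smooth_at (Tot P) (tangent_atlas (Tot P)) (\<lambda>q. (q, hproj q (tvec_of (Tot P) c q r))) p"
proof -
  define U where "U q = tvec_of (Tot P) c q r" for q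
  obtain e where e: "e \<in> Ar X" "gunit X (anchor P p) \<in> fst e"
    using ptsE[of "gunit X (anchor P p)" "Ar X"] p by auto
  have ev: "eventually (\<lambda>q. q \<in> fst c) (mnhds (Tot P) p)" by (rule eventually_in_chart[OF T c])
  have Ut: "U q \<in> tspace (Tot P) q" "U q c = r" if "q \<in> fst c" for q
    unfolding U_def using tvec_of_in_tspace[OF T c(1) that] tvec_of_self[OF T c(1) that] by simp_all
  have Uc: "smooth_fn (Tot P) (\<lambda>q. U q c) p"
    by (rule smooth_fn_cong[OF T smooth_fn_const[OF p, of r]]) (use ev in \<open>eventually_elim, simp add: Ut\<close>)
  have evU: "eventually (\<lambda>q. U q \<in> tspace (Tot P) q) (mnhds (Tot P) p)" using ev by eventually_elim (rule Ut)
  have U: "smooth_at (Tot P) (tangent_atlas (Tot P)) (\<lambda>q. (q, U q)) p"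
    by (rule smooth_at_section[where a = "\<lambda>q. q", OF T T smooth_at_id[OF T p] c Uc evU])
  have "(p, U p) \<in> tbundle (Tot P)" using Ut(1)[OF c(2)] p by (simp add: tbundle_def)
  from form_smooth[OF this]
  have "smooth_at (Tot P) (tangent_atlas (Ar X)) (\<lambda>q. (gunit X (anchor P (fst (q, U q))), \<omega> (q, U q))) p"
    by (rule smooth_at_compose[where f = "\<lambda>q. (q, U q)" and p = p, OF T smooth_atlas_tangent[OF T] U])
  from smooth_at_tangent_component[OF T R this e(1)] e(2)
  have \<omega>s: "smooth_fn (Tot P) (\<lambda>q. \<omega> (q, U q) e) p" by simp
  have "eventually (\<lambda>q. \<omega> (q, U q) \<in> algebroid X (anchor P q)) (mnhds (Tot P) p)"
    using ev eventually_in_pts[OF T p] by eventually_elim (rule form_in, simp_all add: Ut)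
  from smooth_fn_fund[where b = "\<lambda>q. q", OF T smooth_at_id[OF T p] c e \<omega>s this]
  have "smooth_fn (Tot P) (\<lambda>q. fund X P q (\<omega> (q, U q)) c) p" .
  from smooth_fn_diff[OF Uc this]
  have hc: "smooth_fn (Tot P) (\<lambda>q. hproj q (U q) c) p" by (simp add: hproj_def)
  have "eventually (\<lambda>q. hproj q (U q) \<in> tspace (Tot P) q) (mnhds (Tot P) p)"
    using ev eventually_in_pts[OF T p] by eventually_elim (rule hproj, simp_all add: Ut)
  from smooth_at_section[where a = "\<lambda>q. q", OF T T smooth_at_id[OF T p] c hc this]
  show ?thesis by (simp add: U_def)
qed

text \<open>The frame consists of the horizontal parts of vector fields with constant coordinates in a
  chart, chosen so that their projections at \<open>p\<close> are an orthonormal basis in a chart of the base.\<close>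

lemma kernel_smooth_subbundle: "smooth_subbundle (Tot P) (form_kernel P \<omega>)"
  unfolding smooth_subbundle_def
proof (intro conjI ballI)
  show "form_kernel P \<omega> \<subseteq> tbundle (Tot P)" by (auto simp: form_kernel_def)
  fix p assume p: "p \<in> pts (Tot P)"
  obtain c where c: "c \<in> Tot P" "p \<in> fst c" using ptsE[OF p] by blast
  obtain d where d: "d \<in> Base P" "proj P p \<in> fst d" using ptsE[OF in_pts(6)[OF p]] by blast
  define k where "k = card (obasis :: 'n set)"
  obtain f where f: "bij_betw f {..<k} (obasis :: 'n set)"
    using ex_bij_betw_nat_finite[OF finite_obasis] unfolding k_def atLeast0LessThan by blast
  have "\<exists>r. dproj p (tvec_of (Tot P) c p r) d = b" for b
  proof -
    have "tvec_of (Base P) d (proj P p) b \<in> dproj p ` tspace (Tot P) p"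
      unfolding proj_surj[OF p] by (rule tvec_of_in_tspace[OF M d])
    then obtain v where v: "v \<in> tspace (Tot P) p" "tvec_of (Base P) d (proj P p) b = dproj p v" by blast
    then have "dproj p v d = b" using tvec_of_self[OF M d, of b] by simp
    then show ?thesis using tspace_eq_tvec_of[OF v(1) c] by metis
  qed
  then obtain r where r: "\<And>b. dproj p (tvec_of (Tot P) c p (r b)) d = b" by metis
  define Y where "Y i q = hproj q (tvec_of (Tot P) c q (r (f i)))" for i q
  have Ys: "smooth_at (Tot P) (tangent_atlas (Tot P)) (\<lambda>q. (q, Y i q)) p" for i
    unfolding Y_def by (rule hproj_smooth[OF p c])
  have Yq: "Y i q \<in> tspace (Tot P) q" "Y i q \<in> form_kernel P \<omega> `` {q}"
    "dproj q (Y i q) = dproj q (tvec_of (Tot P) c q (r (f i)))" if "q \<in> fst c" for i q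
    unfolding Y_def using hproj[OF chart_subset_pts[OF c(1) that] tvec_of_in_tspace[OF T c(1) that]] by simp_all
  define D where "D q = (\<Sum>i<k. norm (dproj q (Y i q) d - f i))" for q
  have Dp: "D p = 0" by (simp add: D_def Yq(3)[OF c(2)] r)
  have "filterlim D (nhds (D p)) (mnhds (Tot P) p)" unfolding D_def
  proof (intro tendsto_sum tendsto_norm tendsto_diff tendsto_const)
    fix i
    have Yc: "smooth_fn (Tot P) (\<lambda>q. Y i q c) p"
      using smooth_at_tangent_component[where F = "\<lambda>q. (q, Y i q)", OF T T Ys c(1)] c(2) by simp
    have "eventually (\<lambda>q. Y i q \<in> tspace (Tot P) q) (mnhds (Tot P) p)"
      using eventually_in_chart[OF T c] by eventually_elim (rule Yq)
    from smooth_fn_differential[where b = "\<lambda>q. q", OF T T M smooth_at_id[OF T p] proj_smooth[OF p] c d Yc this]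
    show "filterlim (\<lambda>q. dproj q (Y i q) d) (nhds (dproj p (Y i p) d)) (mnhds (Tot P) p)"
      by (rule smooth_fn_tendsto[OF _ T])
  qed
  then have "eventually (\<lambda>q. D q < 1) (mnhds (Tot P) p)"
    using order_tendstoD(2)[of D "D p" "mnhds (Tot P) p" 1] Dp by simp
  moreover have "eventually (\<lambda>q. \<forall>i\<in>{..<k}. smooth_at (Tot P) (tangent_atlas (Tot P)) (\<lambda>q. (q, Y i q)) q) (mnhds (Tot P) p)"
    by (rule eventually_ball_finite)
       (simp_all add: smooth_at_eventually[OF T smooth_atlas_tangent[OF T] Ys])
  moreover have "eventually (\<lambda>q. proj P q \<in> fst d) (mnhds (Tot P) p)"
    by (rule smooth_at_eventually_comp[OF proj_smooth[OF p] eventually_in_chart[OF M d]])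
  ultimately have "eventually (\<lambda>q. D q < 1 \<and> q \<in> fst c \<and> proj P q \<in> fst d \<and>
      (\<forall>i\<in>{..<k}. smooth_at (Tot P) (tangent_atlas (Tot P)) (\<lambda>q. (q, Y i q)) q)) (mnhds (Tot P) p)"
    using eventually_in_chart[OF T c] by eventually_elim simp
  then obtain W where W: "mopen (Tot P) W" "p \<in> W" and WQ: "\<forall>q\<in>W. D q < 1 \<and> q \<in> fst c \<and> proj P q \<in> fst d \<and>
      (\<forall>i\<in>{..<k}. smooth_at (Tot P) (tangent_atlas (Tot P)) (\<lambda>q. (q, Y i q)) q)"
    unfolding eventually_mnhds[OF T p] by blast
  have "smooth_map (Tot P) W (tangent_atlas (Tot P)) (\<lambda>q. (q, Y i q))" if "i < k" for i
    by (rule smooth_mapI[OF T smooth_atlas_tangent[OF T]]) (use WQ that in simp)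
  moreover have "inj_on (\<lambda>i. Y i q) {..<k}" "independent ((\<lambda>i. Y i q) ` {..<k})"
      "span ((\<lambda>i. Y i q) ` {..<k}) = form_kernel P \<omega> `` {q}" if q: "q \<in> W" for q
  proof -
    have qc: "q \<in> fst c" and qd: "proj P q \<in> fst d" and Dq: "D q < 1" using WQ q by simp_all
    have qp: "q \<in> pts (Tot P)" by (rule chart_subset_pts[OF c(1) qc])
    have L: "linear (\<lambda>u. dproj q u d)"
      using linear_dproj[OF qp] by (simp add: linear_iff plus_fun_def scaleR_fun_def)
    have "u = 0" if u: "u \<in> form_kernel P \<omega> `` {q}" "dproj q u d = 0" for u
    proof -
      have "dproj q u \<in> tspace (Base P) (proj P q)"
        using differential_in_tspace[OF T M proj_smooth[OF qp], of u] u(1) by (simp add: kernel_fibre)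
      moreover have "0 \<in> tspace (Base P) (proj P q)" by (rule subspace_0[OF subspace_tspace[OF M in_pts(6)[OF qp]]])
      ultimately have "dproj q u = 0" by (rule tspace_eqI[OF _ _ d(1) qd]) (simp add: u(2))
      then show ?thesis by (rule kernel_vertical[OF qp u(1)])
    qed
    note fr = frame_near_orthonormal[where L = "\<lambda>u. dproj q u d" and X = "\<lambda>i. Y i q", OF L kernel_subspace[OF qp] this f Yq(2)[OF qc]
      Dq[unfolded D_def]]
    show "inj_on (\<lambda>i. Y i q) {..<k}" "independent ((\<lambda>i. Y i q) ` {..<k})"
      "span ((\<lambda>i. Y i q) ` {..<k}) = form_kernel P \<omega> `` {q}" by (rule fr; assumption)+
  qed
  ultimately have fr: "\<forall>i<k. smooth_map (Tot P) W (tangent_atlas (Tot P)) (\<lambda>q. (q, Y i q))"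
      "\<forall>q\<in>W. inj_on (\<lambda>i. Y i q) {..<k} \<and> independent ((\<lambda>i. Y i q) ` {..<k}) \<and>
         span ((\<lambda>i. Y i q) ` {..<k}) = form_kernel P \<omega> `` {q}" by simp_all
  show "\<exists>W (k::nat) X. mopen (Tot P) W \<and> p \<in> W \<and>
      (\<forall>i<k. smooth_map (Tot P) W (tangent_atlas (Tot P)) (\<lambda>q. (q, X i q))) \<and>
      (\<forall>q\<in>W. inj_on (\<lambda>i. X i q) {..<k} \<and> independent ((\<lambda>i. X i q) ` {..<k}) \<and>
         span ((\<lambda>i. X i q) ` {..<k}) = form_kernel P \<omega> `` {q})"
    by (rule exI[where x = W], rule exI[where x = k], rule exI[where x = Y], intro conjI W fr)
qed

lemma kernel_horizontal: "horizontal_subbundle X E P (form_kernel P \<omega>)"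
  unfolding horizontal_subbundle_def
proof (intro conjI ballI kernel_smooth_subbundle kernel_direct_sum)
  show "case z of (p, g) \<Rightarrow> form_kernel P \<omega> `` {act P p g} = tau X E P p g ` (form_kernel P \<omega> `` {p})"
    if "z \<in> act_dom X P" for z
    using that by (cases z) (simp only: prod.case kernel_tau)
qed

end

text \<open>The vector \<open>u - d\<delta> (\<omega> u)\<close> is in the kernel of \<open>\<omega>\<close>, hence in that of \<open>\<omega>'\<close>, and \<open>\<omega>'\<close> maps
  \<open>d\<delta> (\<omega> u)\<close> to \<open>\<omega> u\<close>.\<close>

lemma form_kernel_inj:
  assumes \<omega>: "connection_form X E P \<omega>" and \<omega>': "connection_form X E P \<omega>'"
    and eq: "form_kernel P \<omega> = form_kernel P \<omega>'"
  shows "\<omega> = \<omega>'"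
proof (rule extensionalityI)
  show "\<omega> \<in> extensional (tbundle (Tot P))" "\<omega>' \<in> extensional (tbundle (Tot P))"
    using \<omega> \<omega>' unfolding connection_form_def by blast+
  fix z assume "z \<in> tbundle (Tot P)"
  then obtain p u where z: "z = (p, u)" and p: "p \<in> pts (Tot P)" and u: "u \<in> tspace (Tot P) p"
    by (auto simp: tbundle_def)
  note \<alpha> = form_in[OF \<omega> p u]
  have "u - fund X P p (\<omega> (p, u)) \<in> form_kernel P \<omega>' `` {p}"
    using hproj(2)[OF \<omega> p u] unfolding hproj_def[OF \<omega>] eq .
  then have "\<omega>' (p, u - fund X P p (\<omega> (p, u))) = 0" by (simp add: kernel_fibre[OF \<omega>'])
  then show "\<omega> z = \<omega>' z"
    by (simp add: z form_diff[OF \<omega>' p u fund_in_ker(1)[OF p \<alpha>]] form_fund[OF \<omega>' p \<alpha>])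
qed

end

context principal_connection
begin

subsection \<open>The connection form of a horizontal subbundle\<close>

context
  fixes H :: "('p \<times> ('p, 'q) tvec) set"
  assumes hor: "horizontal_subbundle X E P H"
begin

lemma H_smooth: "smooth_subbundle (Tot P) H"
  using hor unfolding horizontal_subbundle_def by blast

lemma H_fibre:
  assumes "p \<in> pts (Tot P)"
  shows "subspace (H `` {p})" "H `` {p} \<subseteq> tspace (Tot P) p"
    "direct_sum (tspace (Tot P) p) (H `` {p}) {v \<in> tspace (Tot P) p. dproj p v = 0}"
  using smooth_subbundle_fibre[OF H_smooth assms] hor assms
  unfolding horizontal_subbundle_def tker_def by blast+

lemma H_tau:
  assumes pg: "(p, g) \<in> act_dom X P" and u: "u \<in> H `` {p}"
  shows "tau X E P p g u \<in> H `` {act P p g}"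
proof -
  have "H `` {act P p g} = tau X E P p g ` (H `` {p})"
    using hor pg unfolding horizontal_subbundle_def by blast
  then show ?thesis using u by blast
qed

lemma H_unique:
  assumes p: "p \<in> pts (Tot P)" and "u \<in> H `` {p}" "u' \<in> H `` {p}" "dproj p u = dproj p u'"
  shows "u = u'"
  by (rule direct_sum_complement(2)[where L = "dproj p", OF H_fibre(3)[OF p] linear_dproj[OF p] H_fibre(1,2)[OF p] assms(2-4)])

definition form_of :: "'p \<times> ('p, 'q) tvec \<Rightarrow> ('g, 'f) tvec" where
  "form_of = restrict (\<lambda>(p, u). THE \<alpha>. \<alpha> \<in> algebroid X (anchor P p) \<and> u - fund X P p \<alpha> \<in> H `` {p})
     (tbundle (Tot P))"

lemma form_of_eqI:
  assumes p: "p \<in> pts (Tot P)" and u: "u \<in> tspace (Tot P) p"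
    and \<alpha>: "\<alpha> \<in> algebroid X (anchor P p)" "u - fund X P p \<alpha> \<in> H `` {p}"
  shows "form_of (p, u) = \<alpha>"
proof -
  have "(THE \<alpha>. \<alpha> \<in> algebroid X (anchor P p) \<and> u - fund X P p \<alpha> \<in> H `` {p}) = \<alpha>"
  proof (rule the_equality)
    fix \<beta> assume \<beta>: "\<beta> \<in> algebroid X (anchor P p) \<and> u - fund X P p \<beta> \<in> H `` {p}"
    have "dproj p (u - fund X P p \<beta>) = dproj p (u - fund X P p \<alpha>)"
      using fund_in_ker(2)[OF p] \<alpha>(1) \<beta> by (simp add: linear_diff[OF linear_dproj[OF p]])
    then have "u - fund X P p \<beta> = u - fund X P p \<alpha>" using H_unique[OF p] \<alpha>(2) \<beta> by blast
    then have "fund X P p \<beta> = fund X P p \<alpha>" by simp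
    then show "\<beta> = \<alpha>" using fund_inj[OF p] \<alpha>(1) \<beta> by blast
  qed (rule conjI[OF \<alpha>])
  then show ?thesis using p u by (simp add: form_of_def tbundle_iff)
qed

lemma form_of_spec:
  assumes p: "p \<in> pts (Tot P)" and u: "u \<in> tspace (Tot P) p"
  shows "form_of (p, u) \<in> algebroid X (anchor P p)" "u - fund X P p (form_of (p, u)) \<in> H `` {p}"
proof -
  obtain w where w: "w \<in> H `` {p}" "dproj p w = dproj p u"
    using direct_sum_complement(1)[OF H_fibre(3)[OF p] linear_dproj[OF p] H_fibre(1,2)[OF p] u] by blast
  have "w \<in> tspace (Tot P) p" using w(1) H_fibre(2)[OF p] by blast
  then have "u - w \<in> tspace (Tot P) p" by (rule subspace_diff[OF subspace_tspace[OF T p] u])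
  moreover have "dproj p (u - w) = 0" using w(2) by (simp add: linear_diff[OF linear_dproj[OF p]])
  ultimately obtain \<alpha> where \<alpha>: "\<alpha> \<in> algebroid X (anchor P p)" "fund X P p \<alpha> = u - w"
    using fund_surj[OF p] by blast
  then have "u - fund X P p \<alpha> \<in> H `` {p}" using w(1) by simp
  then show "form_of (p, u) \<in> algebroid X (anchor P p)" "u - fund X P p (form_of (p, u)) \<in> H `` {p}"
    using form_of_eqI[OF p u \<alpha>(1)] \<alpha>(1) by simp_all
qed

lemma form_of_kernel: "form_kernel P form_of = H"
proof -
  have "form_of (p, u) = 0 \<longleftrightarrow> u \<in> H `` {p}" if p: "p \<in> pts (Tot P)" and u: "u \<in> tspace (Tot P) p" for p u
  proof
    assume "form_of (p, u) = 0"
    then show "u \<in> H `` {p}" using form_of_spec(2)[OF p u] fund_0[OF p] by simp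
  next
    assume "u \<in> H `` {p}"
    then show "form_of (p, u) = 0" using form_of_eqI[OF p u algebroid_0[OF p]] fund_0[OF p] by simp
  qed
  moreover have "H \<subseteq> tbundle (Tot P)" using H_smooth unfolding smooth_subbundle_def by blast
  ultimately show ?thesis unfolding form_kernel_def by (auto simp: tbundle_iff)
qed

lemma form_of_add:
  assumes p: "p \<in> pts (Tot P)" and u: "u \<in> tspace (Tot P) p" "v \<in> tspace (Tot P) p"
  shows "form_of (p, u + v) = form_of (p, u) + form_of (p, v)"
proof (rule form_of_eqI[OF p subspace_add[OF subspace_tspace[OF T p] u]])
  note 1 = form_of_spec[OF p u(1)] and 2 = form_of_spec[OF p u(2)]
  show "form_of (p, u) + form_of (p, v) \<in> algebroid X (anchor P p)"
    by (rule subspace_add[OF subspace_algebroid[OF in_pts(5)[OF p]] 1(1) 2(1)])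
  have "(u - fund X P p (form_of (p, u))) + (v - fund X P p (form_of (p, v))) \<in> H `` {p}"
    by (rule subspace_add[OF H_fibre(1)[OF p] 1(2) 2(2)])
  then show "u + v - fund X P p (form_of (p, u) + form_of (p, v)) \<in> H `` {p}"
    by (simp only: linear_add[OF linear_fund[OF p]] add_diff_add)
qed

lemma form_of_scale:
  assumes p: "p \<in> pts (Tot P)" and u: "u \<in> tspace (Tot P) p"
  shows "form_of (p, r *\<^sub>R u) = r *\<^sub>R form_of (p, u)"
proof (rule form_of_eqI[OF p subspace_scale[OF subspace_tspace[OF T p] u]])
  note 1 = form_of_spec[OF p u]
  show "r *\<^sub>R form_of (p, u) \<in> algebroid X (anchor P p)"
    by (rule subspace_scale[OF subspace_algebroid[OF in_pts(5)[OF p]] 1(1)])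
  have "r *\<^sub>R (u - fund X P p (form_of (p, u))) \<in> H `` {p}"
    by (rule subspace_scale[OF H_fibre(1)[OF p] 1(2)])
  then show "r *\<^sub>R u - fund X P p (r *\<^sub>R form_of (p, u)) \<in> H `` {p}"
    by (simp only: linear_scale[OF linear_fund[OF p]] scaleR_diff_right)
qed

lemma form_of_fund:
  assumes p: "p \<in> pts (Tot P)" and \<alpha>: "\<alpha> \<in> algebroid X (anchor P p)"
  shows "form_of (p, fund X P p \<alpha>) = \<alpha>"
  by (rule form_of_eqI[OF p fund_in_ker(1)[OF p \<alpha>] \<alpha>]) (use subspace_0[OF H_fibre(1)[OF p]] in simp)

lemma form_of_tau:
  assumes pg: "(p, g) \<in> act_dom X P" and u: "u \<in> tspace (Tot P) p"
  shows "form_of (act P p g, tau X E P p g u) = lambda X E (ginv X g) (form_of (p, u))"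
proof -
  have p: "p \<in> pts (Tot P)" and q: "act P p g \<in> pts (Tot P)" using pg by (simp_all add: act_dom_iff)
  define \<alpha> where "\<alpha> = form_of (p, u)"
  define h where "h = u - fund X P p \<alpha>"
  note 1 = form_of_spec[OF p u, folded \<alpha>_def, folded h_def]
  have ht: "h \<in> tspace (Tot P) p" using 1(2) H_fibre(2)[OF p] by blast
  have "u = h + fund X P p \<alpha>" by (simp add: h_def)
  then have "tau X E P p g u = tau X E P p g h + fund X P (act P p g) (lambda X E (ginv X g) \<alpha>)"
    using tau_add[OF pg ht fund_in_ker(1)[OF p 1(1)]] tau_fund(1)[OF pg 1(1)] by simp
  then have "tau X E P p g u - fund X P (act P p g) (lambda X E (ginv X g) \<alpha>) \<in> H `` {act P p g}"
    using H_tau[OF pg 1(2)] by simp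
  then show ?thesis
    unfolding \<alpha>_def[symmetric] by (rule form_of_eqI[OF q tau_props(1)[OF pg u] tau_fund(2)[OF pg 1(1)]])
qed

text \<open>The horizontal part of \<open>u\<close> is the combination of a local frame of \<open>H\<close> with the same projection
  as \<open>u\<close>, and the form is the differential of the quotient map applied to the vertical part.\<close>

lemma form_of_smooth:
  assumes z: "z0 \<in> tbundle (Tot P)"
  shows "smooth_at (tangent_atlas (Tot P)) (tangent_atlas (Ar X)) (\<lambda>z. (gunit X (anchor P (fst z)), form_of z)) z0"
proof -
  let ?Z = "tangent_atlas (Tot P)"
  define p where "p = fst z0"
  have p: "p \<in> pts (Tot P)" using z by (auto simp: p_def tbundle_def)
  note Z = smooth_atlas_tangent[OF T]
  have z0: "z0 \<in> pts ?Z" using z by (simp add: pts_tangent)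
  obtain c where c: "c \<in> Tot P" "p \<in> fst c" using ptsE[OF p] by blast
  obtain d where d: "d \<in> Base P" "proj P p \<in> fst d" using ptsE[OF in_pts(6)[OF p]] by blast
  obtain e where e: "e \<in> Ar X" "gunit X (anchor P p) \<in> fst e"
    using ptsE[of "gunit X (anchor P p)" "Ar X"] p by auto
  have "\<exists>W k (Y :: nat \<Rightarrow> 'p \<Rightarrow> ('p, 'q) tvec). mopen (Tot P) W \<and> p \<in> W \<and>
      (\<forall>i<k. smooth_map (Tot P) W ?Z (\<lambda>q. (q, Y i q))) \<and>
      (\<forall>q\<in>W. inj_on (\<lambda>i. Y i q) {..<k} \<and> independent ((\<lambda>i. Y i q) ` {..<k}) \<and>
         span ((\<lambda>i. Y i q) ` {..<k}) = H `` {q})"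
    using bspec[OF conjunct2[OF H_smooth[unfolded smooth_subbundle_def]] p] .
  then obtain W k and Y :: "nat \<Rightarrow> 'p \<Rightarrow> ('p, 'q) tvec" where fr: "mopen (Tot P) W \<and> p \<in> W \<and>
      (\<forall>i<k. smooth_map (Tot P) W ?Z (\<lambda>q. (q, Y i q))) \<and>
      (\<forall>q\<in>W. inj_on (\<lambda>i. Y i q) {..<k} \<and> independent ((\<lambda>i. Y i q) ` {..<k}) \<and>
         span ((\<lambda>i. Y i q) ` {..<k}) = H `` {q})"
    by (elim exE) (rule that)
  then have W: "mopen (Tot P) W" "p \<in> W"
    and Ysm: "\<And>i. i < k \<Longrightarrow> smooth_map (Tot P) W ?Z (\<lambda>q. (q, Y i q))"
    and Yfr: "\<And>q. q \<in> W \<Longrightarrow> inj_on (\<lambda>i. Y i q) {..<k} \<and> independent ((\<lambda>i. Y i q) ` {..<k}) \<and>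
           span ((\<lambda>i. Y i q) ` {..<k}) = H `` {q}"
    by simp_all
  have b: "smooth_at ?Z (Tot P) fst z0" by (rule smooth_at_tangent_proj[OF T z])
  have evW: "eventually (\<lambda>z. fst z \<in> W) (mnhds ?Z z0)"
    by (rule smooth_at_eventually_comp[OF b]) (use eventually_mopen[OF T W] in \<open>simp add: p_def\<close>)
  have evZ: "eventually (\<lambda>z. z \<in> tbundle (Tot P)) (mnhds ?Z z0)"
    using eventually_in_pts[OF Z z0] by (simp add: pts_tangent)
  have evd: "eventually (\<lambda>z. proj P (fst z) \<in> fst d) (mnhds ?Z z0)"
    by (rule smooth_at_eventually_comp[OF b])
       (use smooth_at_eventually_comp[OF proj_smooth[OF p] eventually_in_chart[OF M d]] in \<open>simp add: p_def\<close>)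
  have YH: "Y i q \<in> H `` {q}" if "i < k" "q \<in> W" for i q
  proof -
    have "Y i q \<in> span ((\<lambda>i. Y i q) ` {..<k})" using that(1) by (intro span_base) simp
    then show ?thesis using Yfr[OF that(2)] by simp
  qed
  have WT: "q \<in> pts (Tot P)" if "q \<in> W" for q using W(1) that by (auto simp: mopen_def)
  have Yt: "Y i q \<in> tspace (Tot P) q" if "i < k" "q \<in> W" for i q
    using YH[OF that] H_fibre(2)[OF WT[OF that(2)]] by blast
  have Yc: "smooth_fn ?Z (\<lambda>z. Y i (fst z) c) z0" if i: "i < k" for i
  proof -
    have "smooth_at (Tot P) ?Z (\<lambda>q. (q, Y i q)) p" by (rule smooth_map_imp_smooth_at[OF T Z W(1) Ysm[OF i] W(2)])
    from smooth_at_tangent_component[where F = "\<lambda>q. (q, Y i q)", OF T T this c(1)] c(2)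
    have "smooth_fn (Tot P) (\<lambda>q. Y i q c) (fst z0)" by (simp add: p_def)
    from smooth_fn_compose[OF Z T b this] show ?thesis .
  qed
  define w where "w i z = dproj (fst z) (Y i (fst z)) d" for i and z :: "'p \<times> ('p, 'q) tvec"
  define y where "y z = dproj (fst z) (snd z) d" for z
  have dfn: "smooth_fn ?Z (\<lambda>z. dproj (fst z) (v z) d) z0"
    if v: "smooth_fn ?Z (\<lambda>z. v z c) z0" "eventually (\<lambda>z. v z \<in> tspace (Tot P) (fst z)) (mnhds ?Z z0)" for v
    by (rule smooth_fn_differential[where b = fst and f = "proj P", OF Z T M b _ c(1) _ d(1) _ v])
       (use proj_smooth[OF p] c(2) d(2) in \<open>simp_all add: p_def\<close>)
  have ws: "smooth_fn ?Z (w i) z0" if i: "i < k" for i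
    unfolding w_def[abs_def]
    by (rule dfn[where v = "\<lambda>z. Y i (fst z)", OF Yc[OF i]]) (use evW in \<open>eventually_elim, simp add: Yt i\<close>)
  have uc: "smooth_fn ?Z (\<lambda>z. snd z c) z0"
    by (rule smooth_fn_tangent_component[OF T z c(1)]) (use c(2) in \<open>simp add: p_def\<close>)
  have ut: "eventually (\<lambda>z. snd z \<in> tspace (Tot P) (fst z)) (mnhds ?Z z0)"
    using evZ by eventually_elim (auto simp: tbundle_def)
  have ys: "smooth_fn ?Z y z0" unfolding y_def[abs_def] by (rule dfn[where v = snd, OF uc ut])
  have dproj_eq: "u = u'" if q: "q \<in> W" "proj P q \<in> fst d" and u: "u \<in> H `` {q}" "u' \<in> H `` {q}"
    and eq: "dproj q u d = dproj q u' d" for q u u'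
  proof -
    have qp: "q \<in> pts (Tot P)" by (rule WT[OF q(1)])
    have ut: "u \<in> tspace (Tot P) q" "u' \<in> tspace (Tot P) q" using u H_fibre(2)[OF qp] by blast+
    have "dproj q u = dproj q u'"
      by (rule tspace_eqI[OF differential_in_tspace[OF T M proj_smooth[OF qp] ut(1)]
            differential_in_tspace[OF T M proj_smooth[OF qp] ut(2)] d(1) q(2) eq])
    then show ?thesis by (rule H_unique[OF qp u])
  qed
  have Lsum: "dproj q (\<Sum>i<k. a i *\<^sub>R Y i q) d = (\<Sum>i<k. a i *\<^sub>R dproj q (Y i q) d)" if q: "q \<in> W" for q a
  proof -
    have L: "linear (\<lambda>u. dproj q u d)"
      using linear_dproj[OF WT[OF q]] by (simp add: linear_iff plus_fun_def scaleR_fun_def)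
    show ?thesis by (simp add: linear_sum[OF L] linear_scale[OF L])
  qed
  have sumH: "(\<Sum>i<k. a i *\<^sub>R Y i q) \<in> H `` {q}" if q: "q \<in> W" for q and a :: "nat \<Rightarrow> real"
    by (rule subspace_sum[OF H_fibre(1)[OF WT[OF q]]])
       (rule subspace_scale[OF H_fibre(1)[OF WT[OF q]] YH[OF _ q]], simp)
  have ind: "eventually (\<lambda>z. \<forall>a. (\<Sum>i<k. a i *\<^sub>R w i z) = 0 \<longrightarrow> (\<forall>i<k. a i = 0)) (mnhds ?Z z0)"
    using evW evd
  proof eventually_elim
    case (elim z)
    show ?case
    proof (intro allI impI)
      fix a i assume a: "(\<Sum>i<k. a i *\<^sub>R w i z) = 0" and i: "i < k"
      have qp: "fst z \<in> pts (Tot P)" by (rule WT[OF elim(1)])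
      have "dproj (fst z) (\<Sum>i<k. a i *\<^sub>R Y i (fst z)) d = dproj (fst z) 0 d"
        using a by (simp add: Lsum[OF elim(1)] w_def linear_0[OF linear_dproj[OF qp]])
      then have "(\<Sum>i<k. a i *\<^sub>R Y i (fst z)) = 0"
        by (rule dproj_eq[OF elim sumH[OF elim(1)] subspace_0[OF H_fibre(1)[OF qp]]])
      then show "a i = 0" by (rule independent_familyD[rotated 2, OF _ i]) (use Yfr[OF elim(1)] in simp_all)
    qed
  qed
  have spn: "eventually (\<lambda>z. \<exists>a. y z = (\<Sum>i<k. a i *\<^sub>R w i z)) (mnhds ?Z z0)"
    using evW ut
  proof eventually_elim
    case (elim z)
    have qp: "fst z \<in> pts (Tot P)" by (rule WT[OF elim(1)])
    obtain v where v: "v \<in> H `` {fst z}" "dproj (fst z) v = dproj (fst z) (snd z)"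
      using direct_sum_complement(1)[OF H_fibre(3)[OF qp] linear_dproj[OF qp] H_fibre(1,2)[OF qp] elim(2)] by blast
    have "v \<in> span ((\<lambda>i. Y i (fst z)) ` {..<k})" using v(1) Yfr[OF elim(1)] by simp
    then obtain a where a: "v = (\<Sum>i<k. a i *\<^sub>R Y i (fst z))" using span_family[of v "\<lambda>i. Y i (fst z)" k] by blast
    have "y z = (\<Sum>i<k. a i *\<^sub>R w i z)" using v(2) Lsum[OF elim(1), of a] by (simp add: y_def w_def a)
    then show ?case by (rule exI[of _ a])
  qed
  obtain \<theta> where "(\<forall>i<k. smooth_fn ?Z (\<theta> i) z0) \<and> eventually (\<lambda>z. y z = (\<Sum>i<k. \<theta> i z *\<^sub>R w i z)) (mnhds ?Z z0)"
    using smooth_coefficients[OF Z z0 ws ys ind spn] ..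
  then have \<theta>: "\<And>i. i < k \<Longrightarrow> smooth_fn ?Z (\<theta> i) z0"
    and \<theta>y: "eventually (\<lambda>z. y z = (\<Sum>i<k. \<theta> i z *\<^sub>R w i z)) (mnhds ?Z z0)" by simp_all
  define hz where "hz z = (\<Sum>i<k. \<theta> i z *\<^sub>R Y i (fst z))" for z
  define v where "v z = snd z - hz z" for z
  have hH: "hz z \<in> H `` {fst z}" if "fst z \<in> W" for z unfolding hz_def by (rule sumH[OF that])
  have vt: "eventually (\<lambda>z. v z \<in> tspace (Tot P) (fst z)) (mnhds ?Z z0)"
    using evW ut
  proof eventually_elim
    case (elim z)
    have qp: "fst z \<in> pts (Tot P)" by (rule WT[OF elim(1)])
    show ?case
      unfolding v_def
      by (rule subspace_diff[OF subspace_tspace[OF T qp] elim(2) subsetD[OF H_fibre(2)[OF qp] hH[OF elim(1)]]])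
  qed
  have "hz z c = (\<Sum>i<k. \<theta> i z *\<^sub>R Y i (fst z) c)" for z
  proof -
    have "linear (\<lambda>u :: ('p, 'q) tvec. u c)" by (simp add: linear_iff plus_fun_def scaleR_fun_def)
    from linear_sum[OF this] show ?thesis by (simp add: hz_def scaleR_fun_def)
  qed
  then have veq: "(\<lambda>z. v z c) = (\<lambda>z. snd z c - (\<Sum>i<k. \<theta> i z *\<^sub>R Y i (fst z) c))"
    by (simp add: v_def fun_eq_iff)
  have "smooth_fn ?Z (\<lambda>z. \<Sum>i<k. \<theta> i z *\<^sub>R Y i (fst z) c) z0"
    by (rule smooth_fn_sum[OF z0]) (rule smooth_fn_scaleR[OF \<theta> Yc], simp_all)
  from smooth_fn_diff[OF uc this] have vc: "smooth_fn ?Z (\<lambda>z. v z c) z0" unfolding veq .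
  obtain G where G: "smooth_at (prod_atlas (Tot P) (Tot P)) (Ar X) G (p, p) \<and>
    eventually (\<lambda>z. z \<in> fibre_pairs \<longrightarrow> G z = quotient z) (mnhds (prod_atlas (Tot P) (Tot P)) (p, p))"
    using quotient_ext[OF p] ..
  have Gp: "G (p, p) = gunit X (anchor P p)"
  proof -
    have "(p, p) \<in> pts (prod_atlas (Tot P) (Tot P))" using p by (simp add: pts_prod)
    from eventually_mnhds_imp[OF TT this conjunct2[OF G]] have "G (p, p) = quotient (p, p)" using p by simp
    also have "\<dots> = gunit X (anchor P p)"
      using quotient_act[OF p, of "gunit X (anchor P p)"] p by (simp add: src_fibre_iff)
    finally show ?thesis .
  qed
  have "smooth_fn ?Z (\<lambda>z. differential (Tot P) (Ar X) (\<lambda>x. G (fst z, x)) (fst z) (v z) e) z0"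
    by (rule smooth_fn_partial_differential[where a = fst and b = fst and G = G and d = c, OF Z T T R b b _ c(1) _ e(1) _ vc vt])
       (use conjunct1[OF G] c(2) e(2) in \<open>simp_all add: p_def[symmetric] Gp\<close>)
  moreover have "eventually (\<lambda>z. differential (Tot P) (Ar X) (\<lambda>x. G (fst z, x)) (fst z) (v z) e = form_of z e) (mnhds ?Z z0)"
  proof -
    have bb: "smooth_at ?Z (prod_atlas (Tot P) (Tot P)) (\<lambda>z. (fst z, fst z)) z0"
      by (rule smooth_at_Pair[OF Z T T b b])
    have G1: "eventually (\<lambda>z. smooth_at (prod_atlas (Tot P) (Tot P)) (Ar X) G (fst z, fst z)) (mnhds ?Z z0)"
      by (rule smooth_at_eventually_comp[where f = "\<lambda>z. (fst z, fst z)", OF bb])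
         (use smooth_at_eventually[OF TT R conjunct1[OF G]] in \<open>simp add: p_def\<close>)
    have "(p, p) \<in> pts (prod_atlas (Tot P) (Tot P))" using p by (simp add: pts_prod)
    note eventually_eventually_mnhds[OF TT this conjunct2[OF G], unfolded p_def]
    from smooth_at_eventually_comp[where f = "\<lambda>z. (fst z, fst z)" and p = z0, OF bb this]
    have G2: "eventually (\<lambda>z. eventually (\<lambda>z. z \<in> fibre_pairs \<longrightarrow> G z = quotient z)
        (mnhds (prod_atlas (Tot P) (Tot P)) (fst z, fst z))) (mnhds ?Z z0)" .
    show ?thesis
      using G1 G2 evW evd ut vt \<theta>y
    proof eventually_elim
      case (elim z)
      define q where "q = fst z"
      have qW: "q \<in> W" using elim(3) by (simp add: q_def)
      have qp: "q \<in> pts (Tot P)" by (rule WT[OF qW])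
      have ztq: "snd z \<in> tspace (Tot P) q" and vtq: "v z \<in> tspace (Tot P) q" using elim(5,6) by (simp_all add: q_def)
      have hq: "hz z \<in> H `` {q}" using hH[OF elim(3)] by (simp add: q_def)
      have htq: "hz z \<in> tspace (Tot P) q" using hq H_fibre(2)[OF qp] by blast
      have "dproj q (hz z) d = dproj q (snd z) d"
        using elim(7) Lsum[OF qW, of "\<lambda>i. \<theta> i z"] by (simp add: hz_def y_def w_def q_def)
      then have "dproj q (hz z) = dproj q (snd z)"
        by (rule tspace_eqI[OF differential_in_tspace[OF T M proj_smooth[OF qp] htq]
            differential_in_tspace[OF T M proj_smooth[OF qp] ztq] d(1) elim(4)[folded q_def]])
      then have "dproj q (v z) = 0" by (simp add: v_def linear_diff[OF linear_dproj[OF qp]])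
      then obtain \<alpha> where \<alpha>: "\<alpha> \<in> algebroid X (anchor P q)" "fund X P q \<alpha> = v z"
        using fund_surj[OF qp vtq] by blast
      have "snd z - fund X P q \<alpha> \<in> H `` {q}" using hq \<alpha>(2) by (simp add: v_def)
      from form_of_eqI[OF qp ztq \<alpha>(1) this] have f: "form_of z = \<alpha>" by (simp add: q_def)
      note S = quotient_slice[OF qp elim(1)[folded q_def] elim(2)[folded q_def]]
      have "differential (Tot P) (Ar X) (\<lambda>x. G (q, x)) q (v z) = \<alpha>"
        using quotient_fund[OF qp \<alpha>(1) S] \<alpha>(2) by (simp only:)
      then show ?case using f by (simp add: q_def)
    qed
  qed
  ultimately have fe: "smooth_fn ?Z (\<lambda>z. form_of z e) z0" by (rule smooth_fn_cong[OF Z])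
  have au: "smooth_at ?Z (Ar X) (\<lambda>z. gunit X (anchor P (fst z))) z0"
  proof (rule smooth_at_compose[OF Z O])
    show "smooth_at ?Z (Ob X) (\<lambda>z. anchor P (fst z)) z0"
      by (rule smooth_at_compose[OF Z T b anchor_smooth]) (use p in \<open>simp add: p_def\<close>)
    show "smooth_at (Ob X) (Ar X) (gunit X) (anchor P (fst z0))"
      by (rule unit_smooth) (use p in \<open>simp add: p_def\<close>)
  qed
  have ft: "eventually (\<lambda>z. form_of z \<in> tspace (Ar X) (gunit X (anchor P (fst z)))) (mnhds ?Z z0)"
    using evZ
  proof eventually_elim
    case (elim z)
    then have "fst z \<in> pts (Tot P)" "snd z \<in> tspace (Tot P) (fst z)" by (auto simp: tbundle_def)
    from form_of_spec(1)[OF this] show ?case by (simp add: algebroid_def tker_def)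
  qed
  show ?thesis
    by (rule smooth_at_section[where a = "\<lambda>z. gunit X (anchor P (fst z))", OF Z R au e(1) _ fe ft])
       (use e(2) in \<open>simp add: p_def\<close>)
qed

lemma form_of_connection_form: "connection_form X E P form_of"
  unfolding connection_form_def
proof (intro conjI)
  show "form_of \<in> extensional (tbundle (Tot P))" by (simp add: form_of_def)
  show "\<forall>(p, u)\<in>tbundle (Tot P). form_of (p, u) \<in> algebroid X (anchor P p)"
    using form_of_spec(1) by (auto simp: tbundle_iff)
  show "\<forall>p\<in>pts (Tot P). \<forall>u\<in>tspace (Tot P) p. \<forall>v\<in>tspace (Tot P) p. \<forall>r::real.
      form_of (p, u + v) = form_of (p, u) + form_of (p, v) \<and> form_of (p, r *\<^sub>R u) = r *\<^sub>R form_of (p, u)"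
    by (intro ballI allI conjI form_of_add form_of_scale)
  have "smooth_map (tangent_atlas (Tot P)) (tbundle (Tot P)) (tangent_atlas (Ar X))
      (\<lambda>z. (gunit X (anchor P (fst z)), form_of z))"
    by (rule smooth_mapI[OF smooth_atlas_tangent[OF T] smooth_atlas_tangent[OF R] form_of_smooth])
  then show "smooth_map (tangent_atlas (Tot P)) (tbundle (Tot P)) (tangent_atlas (Ar X))
      (\<lambda>(p, u). (gunit X (anchor P p), form_of (p, u)))"
    by (simp add: case_prod_unfold)
  show "\<forall>(p, g)\<in>act_dom X P. \<forall>u\<in>tspace (Tot P) p.
      form_of (act P p g, tau X E P p g u) = lambda X E (ginv X g) (form_of (p, u))"
    using form_of_tau by blast
  show "\<forall>p\<in>pts (Tot P). \<forall>\<alpha>\<in>algebroid X (anchor P p). form_of (p, fund X P p \<alpha>) = \<alpha>"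
    by (intro ballI form_of_fund)
qed

end

end

theorem theorem2:
  fixes X :: "('x, 'e::model_space, 'g, 'f::model_space) groupoid_data"
    and E :: "('g \<times> ('g, 'f) tvec) set"
    and P :: "('p, 'q::model_space, 'm, 'n::model_space, 'g, 'x) bundle_data"
  assumes "lie_groupoid X"
    and "principal_bundle X P"
    and "ehresmann_connection X E"
  shows "bij_betw (form_kernel P)
           {\<omega>. connection_form X E P \<omega>} {H. horizontal_subbundle X E P H}"
proof -
  interpret principal_connection X E P
    using assms by unfold_locales
  show ?thesis
  proof (rule bij_betw_imageI)
    show "inj_on (form_kernel P) {\<omega>. connection_form X E P \<omega>}"
      by (rule inj_onI) (simp add: form_kernel_inj)
    show "form_kernel P ` {\<omega>. connection_form X E P \<omega>} = {H. horizontal_subbundle X E P H}"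
    proof
      show "form_kernel P ` {\<omega>. connection_form X E P \<omega>} \<subseteq> {H. horizontal_subbundle X E P H}"
        using kernel_horizontal by blast
      show "{H. horizontal_subbundle X E P H} \<subseteq> form_kernel P ` {\<omega>. connection_form X E P \<omega>}"
        using form_of_connection_form form_of_kernel by (metis (mono_tags) imageI mem_Collect_eq subsetI)
    qed
  qed
qed

end
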